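(* Let $K:\mathbb{R}\to\mathbb{R}\cup\{\infty\}$ be a function which may be infinite only at $t=0$ and which satisfies: (I)(a) $K\in L^1_{loc}(\mathbb{R})$, $K$ is symmetric around zero, and $K(t)>0$ for all $t\neq 0$; (I)(b) $K(t)\to 0$ as $t\to\infty$ and $K$ is eventually decreasing; (I)(c) the improper integral $\mathcal{K}_{\cos}(\omega)=\int_0^\infty K(t)\cos(\omega t)\,dt$ is positive for all $\omega\neq 0$; (V) $K(t)\sim t^{-1}$ as $t\to\infty$ and there exist $C_1>0$ and $\beta_1>0$ such that $|tK(t)-C_1|=O(t^{-\beta_1})$ as $t\to\infty$. Let $V$ be the weak solution of the generalized Langevin equation $$m\dot V(t)=-\beta\int_{-\infty}^t K(t-s)V(s)\,ds+\sqrt{\beta}\,F(t),\qquad m,\beta>0,$$ and let $X(t)=\langle V,1_{[0,t]}\rangle$ be the associated position process. Then $$\Big|\frac{\mathbb{E}[X(t)^2]}{t/\log(t)}-\frac{2}{\beta C_1}\Big|=O(|\log(t)|^{-1}),\qquad t\to\infty,$$ where $C_1=\lim_{t\to\infty}tK(t)$.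
   Context: Notation: $f(t)\sim g(t)$ as $t\to\infty$ means $f(t)/g(t)\to c$ for some constant $c\in(0,\infty)$ (not necessarily $1$). $\mathcal{K}_{\cos}(\omega)=\int_0^\infty K(t)\cos(t\omega)\,dt$ and $\mathcal{K}_{\sin}(\omega)=\int_0^\infty K(t)\sin(t\omega)\,dt$ are improper integrals. "Eventually decreasing" means decreasing on $[A,\infty)$ for some $A$. $m>0$ and $\beta>0$ are constants. Fourier conventions: $\widehat\varphi(\omega)=\int_{\mathbb{R}}e^{it\omega}\varphi(t)\,dt$. $\mathcal{S}$ is the Schwartz space, $\mathcal{S}'$ the tempered distributions, $\mathcal{F}[g]$ the Fourier transform of $g\in\mathcal{S}'$, defined by $\langle\mathcal{F}[g],\varphi\rangle=\langle g,\widehat\varphi\rangle$. Operator with spectral measure $\nu$: let $\nu$ be a non-negative measure on $\mathbb{R}$, absolutely continuous with respect to Lebesgue measure, with $\int_{\mathbb{R}}(1+x^2)^{-k}\nu(dx)<\infty$ for some integer $k$. The operator $V$ associated with $\nu$ is a linear map from $\mathrm{Dom}(V)$ to square-integrable complex-valued Gaussian random variables, where $\mathrm{Dom}(V)$ is the set of $g\in\mathcal{S}'$ such that $\mathcal{F}[g]$ is a complex-valued function belonging to $L^2(\nu)$, and $$\mathbb{E}\big[\langle V,g_1\rangle\overline{\langle V,g_2\rangle}\big]=\int_{\mathbb{R}}\mathcal{F}[g_1](\omega)\overline{\mathcal{F}[g_2](\omega)}\,\nu(d\omega),\qquad g_1,g_2\in\mathrm{Dom}(V).$$ Weak solution: let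 $K^+(t)=K(t)1_{\{t\ge0\}}$ and $\widetilde f(x)=f(-x)$, so $\widetilde{K^+*\widetilde\varphi}(t)=\int_{\mathbb{R}}K^+(u)\varphi(t+u)\,du$. The noise $F$ is the stationary random distribution on $\mathcal{S}$ with $\mathbb{E}[\langle F,\varphi_1\rangle\overline{\langle F,\varphi_2\rangle}]=\int_{\mathbb{R}}K(t)(\varphi_1*\varphi_2^{*})(t)\,dt$, $\varphi_2^*(t)=\overline{\varphi_2(-t)}$. $V$ is a weak solution of the equation if (a) $K^+*\varphi\in\mathrm{Dom}(V)$ for every $\varphi\in\mathcal{S}$, and (b) for all $\varphi,\psi\in\mathcal{S}$, $\mathbb{E}\big[\langle V,-m\varphi'+\beta\widetilde{K^+*\widetilde\varphi}\rangle\overline{\langle V,-m\psi'+\beta\widetilde{K^+*\widetilde\psi}\rangle}\big]=\mathbb{E}\big[\langle\sqrt\beta F,\varphi\rangle\overline{\langle\sqrt\beta F,\psi\rangle}\big]$. In this regime the weak solution is the operator with spectral measure $\nu(d\omega)=\widehat r(\omega)\,d\omega$, $$\widehat r(\omega)=\frac{1}{2\pi}\,\frac{2\beta\mathcal{K}_{\cos}(\omega)}{[\beta\mathcal{K}_{\cos}(\omega)]^2+[m\omega-\beta\mathcal{K}_{\sin}(\omega)]^2},$$ so that $\mathbb{E}[X(t)^2]=\int_{\mathbb{R}}|\widehat{1_{[0,t]}}(\omega)|^2\,\widehat r(\omega)\,d\omega$. *)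

theory Defs
  imports "HOL-Probability.Probability" "HOL-Library.Landau_Symbols"
begin

section \<open>Schwartz functions and tempered distributions\<close>

definition vderiv :: "(real \<Rightarrow> complex) \<Rightarrow> real \<Rightarrow> complex" where
  "vderiv f = (\<lambda>t. vector_derivative f (at t))"

definition schwartz :: "(real \<Rightarrow> complex) \<Rightarrow> bool" where
  "schwartz f \<longleftrightarrow>
     (\<forall>k t. (vderiv ^^ k) f differentiable (at t)) \<and>
     (\<forall>j k. bounded (range (\<lambda>t. t ^ j *\<^sub>R (vderiv ^^ k) f t)))"

definition schwartz_norm :: "nat \<Rightarrow> (real \<Rightarrow> complex) \<Rightarrow> real" where
  "schwartz_norm N f = (\<Sum>j\<le>N. \<Sum>k\<le>N. SUP t. norm (t ^ j *\<^sub>R (vderiv ^^ k) f t))"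

text \<open>A functional on the Schwartz space is a function on all of \<^typ>\<open>real \<Rightarrow> complex\<close>, normalised
  to be 0 off the Schwartz space; thus equal distributions are equal terms.\<close>

type_synonym functional = "(real \<Rightarrow> complex) \<Rightarrow> complex"

definition tempered_distribution :: "functional \<Rightarrow> bool" where
  "tempered_distribution g \<longleftrightarrow>
     (\<forall>\<phi>. \<not> schwartz \<phi> \<longrightarrow> g \<phi> = 0) \<and>
     (\<forall>\<phi> \<psi> a b. schwartz \<phi> \<longrightarrow> schwartz \<psi> \<longrightarrow>
        g (\<lambda>t. a * \<phi> t + b * \<psi> t) = a * g \<phi> + b * g \<psi>) \<and>
     (\<exists>N C. \<forall>\<phi>. schwartz \<phi> \<longrightarrow> cmod (g \<phi>) \<le> C * schwartz_norm N \<phi>)"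

definition dist_of :: "(real \<Rightarrow> complex) \<Rightarrow> functional" where
  "dist_of h = (\<lambda>\<phi>. if schwartz \<phi> then (LINT t|lebesgue. h t * \<phi> t) else 0)"

definition fourier :: "(real \<Rightarrow> complex) \<Rightarrow> real \<Rightarrow> complex" where
  "fourier \<phi> = (\<lambda>\<omega>. LINT t|lebesgue. exp (\<i> * of_real (t * \<omega>)) * \<phi> t)"

definition fourier_dist :: "functional \<Rightarrow> functional" where
  "fourier_dist g = (\<lambda>\<phi>. if schwartz \<phi> then g (fourier \<phi>) else 0)"

text \<open>\<^term>\<open>fourier_is_fun g h\<close>: the distribution \<open>\<F>[g]\<close> is the function \<open>h\<close>. Such an \<open>h\<close> is
  determined up to Lebesgue null sets; a Borel representative is always available.\<close>

definition fourier_is_fun :: "functional \<Rightarrow> (real \<Rightarrow> complex) \<Rightarrow> bool" where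
  "fourier_is_fun g h \<longleftrightarrow>
     h \<in> borel_measurable borel \<and>
     (\<forall>\<phi>. schwartz \<phi> \<longrightarrow> integrable lebesgue (\<lambda>\<omega>. h \<omega> * \<phi> \<omega>)) \<and>
     fourier_dist g = dist_of h"


section \<open>Random variables and the operator with a given spectral measure\<close>

definition gaussian_rv :: "'w measure \<Rightarrow> ('w \<Rightarrow> real) \<Rightarrow> bool" where
  "gaussian_rv M X \<longleftrightarrow>
     X \<in> borel_measurable M \<and>
     (\<exists>\<mu>. (AE w in M. X w = \<mu>) \<or>
          (\<exists>\<sigma>>0. distributed M lborel X (\<lambda>x. ennreal (normal_density \<mu> \<sigma> x))))"

definition complex_gaussian_rv :: "'w measure \<Rightarrow> ('w \<Rightarrow> complex) \<Rightarrow> bool" where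
  "complex_gaussian_rv M Z \<longleftrightarrow>
     Z \<in> borel_measurable M \<and>
     (\<forall>a b :: real. gaussian_rv M (\<lambda>w. a * Re (Z w) + b * Im (Z w)))"

definition square_integrable :: "'w measure \<Rightarrow> ('w \<Rightarrow> complex) \<Rightarrow> bool" where
  "square_integrable M Z \<longleftrightarrow> Z \<in> borel_measurable M \<and> integrable M (\<lambda>w. (cmod (Z w))\<^sup>2)"

definition cov :: "'w measure \<Rightarrow> ('w \<Rightarrow> complex) \<Rightarrow> ('w \<Rightarrow> complex) \<Rightarrow> complex" where
  "cov M Y Z = (LINT w|M. Y w * cnj (Z w))"

definition spectral_measure :: "real measure \<Rightarrow> bool" where
  "spectral_measure \<nu> \<longleftrightarrow>
     sets \<nu> = sets borel \<and> absolutely_continuous lborel \<nu> \<and>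
     (\<exists>k::int. (\<integral>\<^sup>+ x. ennreal ((1 + x\<^sup>2) powi (- k)) \<partial>\<nu>) < \<infinity>)"

definition Dom :: "real measure \<Rightarrow> functional set" where
  "Dom \<nu> = {g. tempered_distribution g \<and>
              (\<exists>h. fourier_is_fun g h \<and> integrable \<nu> (\<lambda>\<omega>. (cmod (h \<omega>))\<^sup>2))}"

text \<open>Random variables are identified when they agree almost surely, so linearity is required
  almost surely. Values of \<open>V\<close> outside \<open>Dom \<nu>\<close> are unconstrained.\<close>

definition spectral_operator ::
  "'w measure \<Rightarrow> real measure \<Rightarrow> (functional \<Rightarrow> 'w \<Rightarrow> complex) \<Rightarrow> bool" where
  "spectral_operator M \<nu> V \<longleftrightarrow>
     prob_space M \<and> spectral_measure \<nu> \<and>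
     (\<forall>g\<in>Dom \<nu>. complex_gaussian_rv M (V g) \<and> square_integrable M (V g)) \<and>
     (\<forall>g1\<in>Dom \<nu>. \<forall>g2\<in>Dom \<nu>. \<forall>a b.
        AE w in M. V (\<lambda>\<phi>. a * g1 \<phi> + b * g2 \<phi>) w = a * V g1 w + b * V g2 w) \<and>
     (\<forall>g1\<in>Dom \<nu>. \<forall>g2\<in>Dom \<nu>. \<forall>h1 h2. fourier_is_fun g1 h1 \<longrightarrow> fourier_is_fun g2 h2 \<longrightarrow>
        cov M (V g1) (V g2) = (LINT \<omega>|\<nu>. h1 \<omega> * cnj (h2 \<omega>)))"


section \<open>The memory kernel, the noise and weak solutions\<close>

text \<open>The kernel takes values in \<^typ>\<open>ereal\<close>. In integrals it enters as
  \<^term>\<open>\<lambda>t. real_of_ereal (K t)\<close>, which changes it only at 0, and only if \<^prop>\<open>K 0 = \<infinity>\<close>.\<close>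

definition has_K_cos :: "(real \<Rightarrow> ereal) \<Rightarrow> real \<Rightarrow> real \<Rightarrow> bool" where
  "has_K_cos K \<omega> I \<longleftrightarrow>
     ((\<lambda>T. LINT t:{0..T}|lebesgue. real_of_ereal (K t) * cos (t * \<omega>)) \<longlongrightarrow> I) at_top"

definition kernel :: "(real \<Rightarrow> ereal) \<Rightarrow> bool" where
  "kernel K \<longleftrightarrow> (\<forall>t. K t \<noteq> -\<infinity>) \<and> (\<forall>t. t \<noteq> 0 \<longrightarrow> K t \<noteq> \<infinity>)"

definition cond_Ia :: "(real \<Rightarrow> ereal) \<Rightarrow> bool" where
  "cond_Ia K \<longleftrightarrow>
     (\<forall>a b. set_integrable lebesgue {a..b} (\<lambda>t. real_of_ereal (K t))) \<and>
     (\<forall>t. K (- t) = K t) \<and> (\<forall>t. t \<noteq> 0 \<longrightarrow> K t > 0)"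

definition cond_Ib :: "(real \<Rightarrow> ereal) \<Rightarrow> bool" where
  "cond_Ib K \<longleftrightarrow> (K \<longlongrightarrow> 0) at_top \<and> (\<exists>A. antimono_on {A..} K)"

definition cond_Ic :: "(real \<Rightarrow> ereal) \<Rightarrow> bool" where
  "cond_Ic K \<longleftrightarrow> (\<forall>\<omega>. \<omega> \<noteq> 0 \<longrightarrow> (\<exists>I. has_K_cos K \<omega> I \<and> I > 0))"

definition sim_const :: "(real \<Rightarrow> real) \<Rightarrow> (real \<Rightarrow> real) \<Rightarrow> bool" where
  "sim_const f g \<longleftrightarrow> (\<exists>c>0. ((\<lambda>t. f t / g t) \<longlongrightarrow> c) at_top)"

definition cond_V :: "(real \<Rightarrow> ereal) \<Rightarrow> bool" where
  "cond_V K \<longleftrightarrow>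
     sim_const (\<lambda>t. real_of_ereal (K t)) (\<lambda>t. inverse t) \<and>
     (\<exists>C1>0. \<exists>\<beta>1>0. (\<lambda>t. \<bar>t * real_of_ereal (K t) - C1\<bar>) \<in> O[at_top](\<lambda>t. t powr (- \<beta>1)))"

definition K_plus :: "(real \<Rightarrow> ereal) \<Rightarrow> real \<Rightarrow> complex" where
  "K_plus K = (\<lambda>t. if t \<ge> 0 then of_real (real_of_ereal (K t)) else 0)"

definition conv :: "(real \<Rightarrow> complex) \<Rightarrow> (real \<Rightarrow> complex) \<Rightarrow> real \<Rightarrow> complex" where
  "conv f g = (\<lambda>t. LINT u|lebesgue. f u * g (t - u))"

definition reflect :: "(real \<Rightarrow> complex) \<Rightarrow> real \<Rightarrow> complex" where
  "reflect f = (\<lambda>x. f (- x))"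

text \<open>A stationary random distribution in the sense of It\^o: a continuous linear map from the
  Schwartz space to square-integrable random variables with translation-invariant covariance.\<close>

definition stationary_random_distribution ::
  "'v measure \<Rightarrow> ((real \<Rightarrow> complex) \<Rightarrow> 'v \<Rightarrow> complex) \<Rightarrow> bool" where
  "stationary_random_distribution N F \<longleftrightarrow>
     prob_space N \<and>
     (\<forall>\<phi>. schwartz \<phi> \<longrightarrow> square_integrable N (F \<phi>)) \<and>
     (\<forall>\<phi> \<psi> a b. schwartz \<phi> \<longrightarrow> schwartz \<psi> \<longrightarrow>
        (AE w in N. F (\<lambda>t. a * \<phi> t + b * \<psi> t) w = a * F \<phi> w + b * F \<psi> w)) \<and>
     (\<exists>n C. \<forall>\<phi>. schwartz \<phi> \<longrightarrow>
        sqrt (LINT w|N. (cmod (F \<phi> w))\<^sup>2) \<le> C * schwartz_norm n \<phi>) \<and>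
     (\<forall>\<phi> \<psi> s. schwartz \<phi> \<longrightarrow> schwartz \<psi> \<longrightarrow>
        cov N (F (\<lambda>t. \<phi> (t + s))) (F (\<lambda>t. \<psi> (t + s))) = cov N (F \<phi>) (F \<psi>))"

definition noise ::
  "'v measure \<Rightarrow> (real \<Rightarrow> ereal) \<Rightarrow> ((real \<Rightarrow> complex) \<Rightarrow> 'v \<Rightarrow> complex) \<Rightarrow> bool" where
  "noise N K F \<longleftrightarrow>
     stationary_random_distribution N F \<and>
     (\<forall>\<phi>1 \<phi>2. schwartz \<phi>1 \<longrightarrow> schwartz \<phi>2 \<longrightarrow>
        cov N (F \<phi>1) (F \<phi>2) =
          (LINT t|lebesgue. of_real (real_of_ereal (K t)) * conv \<phi>1 (\<lambda>s. cnj (\<phi>2 (- s))) t))"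

text \<open>The equation tested against \<open>\<phi>\<close>: this is \<open>-m \<phi>' + \<beta> (K\<^sup>+ * \<phi>\<^sup>~)\<^sup>~\<close>, where \<open>\<^sup>~\<close> is
  reflection.\<close>

definition gle_adjoint ::
  "real \<Rightarrow> real \<Rightarrow> (real \<Rightarrow> ereal) \<Rightarrow> (real \<Rightarrow> complex) \<Rightarrow> real \<Rightarrow> complex" where
  "gle_adjoint m \<beta> K \<phi> =
     (\<lambda>t. - of_real m * vderiv \<phi> t + of_real \<beta> * reflect (conv (K_plus K) (reflect \<phi>)) t)"

text \<open>A weak solution is an operator associated with some spectral measure \<open>\<nu>\<close>; the equation is
  required in the sense of covariances only, so \<open>V\<close> and the noise \<open>F\<close> may live on different
  probability spaces.\<close>

definition weak_solution ::
  "real \<Rightarrow> real \<Rightarrow> (real \<Rightarrow> ereal) \<Rightarrow> 'v measure \<Rightarrow> ((real \<Rightarrow> complex) \<Rightarrow> 'v \<Rightarrow> complex) \<Rightarrow>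
   'w measure \<Rightarrow> (functional \<Rightarrow> 'w \<Rightarrow> complex) \<Rightarrow> bool" where
  "weak_solution m \<beta> K N F M V \<longleftrightarrow>
     (\<exists>\<nu>. spectral_operator M \<nu> V \<and>
        (\<forall>\<phi>. schwartz \<phi> \<longrightarrow> dist_of (conv (K_plus K) \<phi>) \<in> Dom \<nu>) \<and>
        (\<forall>\<phi> \<psi>. schwartz \<phi> \<longrightarrow> schwartz \<psi> \<longrightarrow>
           cov M (V (dist_of (gle_adjoint m \<beta> K \<phi>))) (V (dist_of (gle_adjoint m \<beta> K \<psi>))) =
           cov N (\<lambda>w. of_real (sqrt \<beta>) * F \<phi> w) (\<lambda>w. of_real (sqrt \<beta>) * F \<psi> w)))"

definition position :: "(functional \<Rightarrow> 'w \<Rightarrow> complex) \<Rightarrow> real \<Rightarrow> 'w \<Rightarrow> complex" where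
  "position V t = V (dist_of (indicator {0..t}))"

text \<open>The mean-square displacement is \<open>E[X(t) X(t)\<^sup>*] = E[\<bar>X(t)\<bar>\<^sup>2]\<close> (star for the complex
  conjugate), the quantity fixed by the spectral measure; it is \<open>E[X(t)\<^sup>2]\<close> when \<open>X\<close> is real.
  For complex \<open>X\<close>, \<open>E[X(t)\<^sup>2]\<close> without conjugate is not determined: \<open>\<i> V\<close> has the same
  spectral measure as \<open>V\<close>.\<close>

definition msd :: "'w measure \<Rightarrow> (functional \<Rightarrow> 'w \<Rightarrow> complex) \<Rightarrow> real \<Rightarrow> real" where
  "msd M V t = (LINT w|M. (cmod (position V t w))\<^sup>2)"

end

theory Submission
  imports Defs "HOL-Real_Asymp.Real_Asymp"
begin

text \<open>
  Write \<open>k\<close> for the kernel on the half line, \<open>k\<^sup>*\<close> for its one-sided Fourier transform (an improper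
  integral, controlled by the second mean value theorem because \<open>k\<close> is eventually decreasing) and
  \<open>\<sigma>(\<omega>) = \<i> m \<omega> + \<beta> k\<^sup>*(- \<omega>)\<close> for the Fourier multiplier of the equation. Testing the weak equation with
  translated Gaussians identifies the characteristic functions of the finite measures
  \<open>exp (- \<omega>\<^sup>2) \<bar>\<sigma>(\<omega>)\<bar>\<^sup>2 \<nu>(d\<omega>)\<close> and \<open>(\<beta> / \<pi>) exp (- \<omega>\<^sup>2) Re k\<^sup>*(\<omega>) d\<omega>\<close>,
  so by Levy's uniqueness theorem \<open>\<nu>\<close> has density \<open>\<beta> Re k\<^sup>* / (\<pi> \<bar>\<sigma>\<bar>\<^sup>2)\<close>. Comparing \<open>k(t)\<close> with \<open>C / t\<close> up
  to \<open>t = 1 / \<bar>\<omega>\<bar>\<close> and using the mean value bound beyond gives \<open>k\<^sup>*(\<omega>) = C ln (1 / \<bar>\<omega>\<bar>) + O(1)\<close> near 0, whence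
  the density is \<open>1 / (\<pi> \<beta> C ln (1 / \<bar>\<omega>\<bar>)) + O(1 / ln\<^sup>2 \<bar>\<omega>\<bar>)\<close>.
  The mean-square displacement is the integral of this density against \<open>2 (1 - cos (t \<omega>)) / \<omega>\<^sup>2\<close>, a
  kernel of total mass \<open>2 \<pi> t\<close> concentrated at frequencies of order \<open>1 / t\<close>.
\<close>

section \<open>The Fourier transform on the Schwartz space\<close>

text \<open>The kernel has a tail of order \<open>1 / t\<close>. It is therefore not integrable, its
  transform converges only conditionally and blows up logarithmically at frequency 0, and the
  convolution of \<open>K_plus K\<close> with a test function is in general not integrable either.
  Its Fourier transform is thus distributional and is reached through truncations, with the
  logarithm traded for the cruder but integrable singularity \<open>1 / sqrt \<bar>w\<bar>\<close>.
  The measure \<nu> is known only through covariances, and \<open>V\<close> is unconstrained outside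
  \<open>Dom \<nu>\<close>, so each distribution fed to \<open>V\<close> must first be shown to lie
  in the domain. At frequencies bounded away from 0 and infinity the density is controlled by the
  growth condition on \<nu>. The rate \<open>1 / ln t\<close> comes from scaling: at frequency
  \<open>x / t\<close> the logarithm is \<open>ln t - ln \<bar>x\<bar>\<close>, and the relative
  error \<open>ln \<bar>x\<bar> / ln t\<close> is integrable against the Fejer kernel. The limit is
  the mass \<open>2 * pi\<close> of that kernel times \<open>1 / (pi * \<beta> * C)\<close>.\<close>

lemma schwartzI:
  assumes "D 0 = f"
    and "\<And>k t. (D k has_vector_derivative D (Suc k) t) (at t)"
    and "\<And>j k. bounded (range (\<lambda>t. t ^ j *\<^sub>R D k t))"
  shows "schwartz f"
proof -
  \<comment> \<open>Vector derivatives at a point are unique, so any family linked by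
    differentiation is the family of iterates.\<close>
  have *: "(vderiv ^^ k) f = D k" for k
    by (induction k) (auto simp: assms(1) vderiv_def intro!: ext vector_derivative_at assms(2))
  show ?thesis
    unfolding schwartz_def * using assms by (auto intro: differentiableI_vector)
qed

lemma schwartz_iterated_vderiv:
  assumes "schwartz f"
  shows "((vderiv ^^ k) f has_vector_derivative (vderiv ^^ Suc k) f t) (at t)"
  using assms by (auto simp: schwartz_def vderiv_def vector_derivative_works)

lemma schwartz_has_vderiv: "schwartz f \<Longrightarrow> (f has_vector_derivative vderiv f t) (at t)"
  using schwartz_iterated_vderiv[of f 0 t] by simp

lemma schwartz_iterated_bounded:
  "schwartz f \<Longrightarrow> bounded (range (\<lambda>t. t ^ j *\<^sub>R (vderiv ^^ k) f t))"
  by (auto simp: schwartz_def)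

lemma schwartz_vderiv:
  assumes "schwartz f" shows "schwartz (vderiv f)"
proof (rule schwartzI)
  show "(vderiv ^^ Suc 0) f = vderiv f" by simp
  show "((vderiv ^^ Suc k) f has_vector_derivative (vderiv ^^ Suc (Suc k)) f t) (at t)" for k t
    by (rule schwartz_iterated_vderiv[OF assms])
  show "bounded (range (\<lambda>t. t ^ j *\<^sub>R (vderiv ^^ Suc k) f t))" for j k
    by (rule schwartz_iterated_bounded[OF assms])
qed

lemma schwartz_cmult:
  assumes "schwartz f" shows "schwartz (\<lambda>t. c * f t)"
proof (rule schwartzI)
  show "((\<lambda>t. c * (vderiv ^^ k) f t) has_vector_derivative c * (vderiv ^^ Suc k) f t) (at t)" for k t
    by (intro has_vector_derivative_mult_right schwartz_iterated_vderiv assms)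
  show "bounded (range (\<lambda>t. t ^ j *\<^sub>R (c * (vderiv ^^ k) f t)))" for j k
  proof -
    obtain B where "norm (t ^ j *\<^sub>R (vderiv ^^ k) f t) \<le> B" for t
      using schwartz_iterated_bounded[OF assms, of j k] by (auto simp: bounded_iff)
    then have "norm (t ^ j *\<^sub>R (c * (vderiv ^^ k) f t)) \<le> norm c * B" for t
      using mult_left_mono[of _ B "norm c"] by (simp add: norm_mult mult.left_commute)
    then show ?thesis by (auto simp: bounded_iff)
  qed
qed simp

lemma schwartz_mult_id:
  assumes "schwartz f" shows "schwartz (\<lambda>t. of_real t * f t)"
proof (rule schwartzI)
  \<comment> \<open>Leibniz rule for the product with the identity. At \<open>k = 0\<close> the
    truncated \<open>k - 1\<close> is harmless because its coefficient \<open>of_nat k\<close>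
    vanishes.\<close>
  let ?D = "\<lambda>k t. of_real t * (vderiv ^^ k) f t + of_nat k * (vderiv ^^ (k - 1)) f t"
  show "(?D k has_vector_derivative ?D (Suc k) t) (at t)" for k t
  proof (cases k)
    case 0
    show ?thesis unfolding 0
      by (auto intro!: derivative_eq_intros has_vector_derivative_mult
        schwartz_has_vderiv assms has_vector_derivative_of_real)
  next
    case (Suc l)
    show ?thesis unfolding Suc
      using schwartz_iterated_vderiv[OF assms, of "Suc l"] schwartz_iterated_vderiv[OF assms, of l]
      by (auto intro!: derivative_eq_intros has_vector_derivative_mult has_vector_derivative_of_real
         simp: algebra_simps)
  qed
  show "bounded (range (\<lambda>t. t ^ j *\<^sub>R ?D k t))" for j k
  proof -
    obtain B where B: "norm (t ^ Suc j *\<^sub>R (vderiv ^^ k) f t) \<le> B" for t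
      using schwartz_iterated_bounded[OF assms, of "Suc j" k] by (auto simp: bounded_iff)
    obtain B' where B': "norm (t ^ j *\<^sub>R (vderiv ^^ (k - 1)) f t) \<le> B'" for t
      using schwartz_iterated_bounded[OF assms, of j "k - 1"] by (auto simp: bounded_iff)
    have "norm (t ^ j *\<^sub>R ?D k t) \<le> B + of_nat k * B'" for t
    proof -
      have "t ^ j *\<^sub>R ?D k t
          = t ^ Suc j *\<^sub>R (vderiv ^^ k) f t + of_nat k * (t ^ j *\<^sub>R (vderiv ^^ (k - 1)) f t)"
        by (simp add: scaleR_conv_of_real algebra_simps)
      moreover have "norm (of_nat k * (t ^ j *\<^sub>R (vderiv ^^ (k - 1)) f t)) \<le> of_nat k * B'"
        unfolding norm_mult using B'[of t] by (simp add: mult_left_mono)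
      ultimately show ?thesis using B[of t] norm_triangle_mono by metis
    qed
    then show ?thesis by (auto simp: bounded_iff)
  qed
qed simp

text \<open>Almost all later estimates use Schwartz functions only through this Cauchy bound, a
  weight that is integrable and stable under convolution.\<close>

lemma schwartz_decay:
  assumes "schwartz f"
  obtains C where "C \<ge> 0" "\<And>t. cmod (f t) \<le> C / (1 + t\<^sup>2)"
proof -
  obtain B where B: "norm (f t) \<le> B" for t
    using schwartz_iterated_bounded[OF assms, of 0 0] by (auto simp: bounded_iff)
  obtain B' where B': "t\<^sup>2 * norm (f t) \<le> B'" for t
    using schwartz_iterated_bounded[OF assms, of 2 0] by (auto simp: bounded_iff)
  have "cmod (f t) * (1 + t\<^sup>2) \<le> B + B'" for t
    using B[of t] B'[of t] by (simp add: algebra_simps)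
  then have "cmod (f t) \<le> (B + B') / (1 + t\<^sup>2)" for t
    by (simp add: pos_le_divide_eq add_pos_nonneg)
  moreover have "B + B' \<ge> 0"
    using order_trans[OF norm_ge_zero B] B'[of 0] by simp
  ultimately show ?thesis using that by blast
qed

lemma schwartz_continuous: "schwartz f \<Longrightarrow> continuous_on UNIV f"
  by (meson continuous_at_imp_continuous_on has_vector_derivative_continuous schwartz_has_vderiv)

lemma schwartz_borel [measurable_dest]: "schwartz f \<Longrightarrow> f \<in> borel_measurable borel"
  by (simp add: borel_measurable_continuous_onI schwartz_continuous)

lemma integrable_cauchy: "integrable lborel (\<lambda>t::real. C / (1 + t\<^sup>2))"
  using integrable_mult_right[OF integrable_inverse_1_plus_square[unfolded set_integrable_def], of C]
  by (simp add: divide_inverse)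

lemma integrable_cauchy_bound:
  fixes f :: "real \<Rightarrow> 'a::{banach, second_countable_topology}"
  assumes "f \<in> borel_measurable borel" "\<And>t. norm (f t) \<le> C / (1 + t\<^sup>2)"
  shows "integrable lborel f"
proof (rule Bochner_Integration.integrable_bound[OF integrable_cauchy[of C]])
  show "AE t in lborel. norm (f t) \<le> norm (C / (1 + t\<^sup>2))"
    by (rule AE_I2, rule order_trans[OF assms(2)]) (simp only: real_norm_def abs_ge_self)
qed (use assms(1) in simp)

lemma schwartz_integrable:
  assumes "schwartz f" shows "integrable lborel f"
proof -
  obtain C where "\<And>t. cmod (f t) \<le> C / (1 + t\<^sup>2)" using schwartz_decay[OF assms] by blast
  then show ?thesis using assms by (intro integrable_cauchy_bound) auto
qed

lemma fourier_lborel: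
  assumes "f \<in> borel_measurable borel"
  shows "fourier f w = (LINT t|lborel. iexp (t * w) * f t)"
  unfolding fourier_def using assms by (intro integral_completion) simp

lemma fourier_borel [measurable]:
  assumes [measurable]: "f \<in> borel_measurable borel"
  shows "fourier f \<in> borel_measurable borel"
proof -
  have "fourier f = (\<lambda>w. LINT t|lborel. iexp (t * w) * f t)"
    by (rule ext) (rule fourier_lborel[OF assms])
  also have "\<dots> \<in> borel_measurable borel" by measurable
  finally show ?thesis .
qed

lemma integrable_iexp_mult:
  fixes f :: "real \<Rightarrow> complex"
  assumes "integrable lborel f"
  shows "integrable lborel (\<lambda>t. iexp (c * t) * f t)" "integrable lborel (\<lambda>t. iexp (t * c) * f t)"
proof -
  have [measurable]: "f \<in> borel_measurable borel" using assms by auto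
  show "integrable lborel (\<lambda>t. iexp (c * t) * f t)"
    by (rule Bochner_Integration.integrable_bound[OF assms]) (auto simp: norm_mult)
  then show "integrable lborel (\<lambda>t. iexp (t * c) * f t)" by (simp add: mult.commute)
qed

lemma norm_fourier_le:
  assumes "integrable lborel f"
  shows "cmod (fourier f w) \<le> (LINT t|lborel. cmod (f t))"
proof -
  have "f \<in> borel_measurable borel" using assms by auto
  then show ?thesis
    using integral_norm_bound[of lborel "\<lambda>t. iexp (t * w) * f t"]
    by (simp add: fourier_lborel norm_mult)
qed

lemma fourier_has_vector_derivative:
  assumes "schwartz f"
  shows "(fourier f has_vector_derivative fourier (\<lambda>t. \<i> * (of_real t * f t)) w) (at w)"
proof -
  let ?g = "\<lambda>t. \<i> * (of_real t * f t)"
  let ?f2 = "\<lambda>t. of_real t * (of_real t * f t)"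
  have g: "schwartz ?g" and f2: "schwartz ?f2"
    by (intro schwartz_cmult schwartz_mult_id assms)+
  note [measurable] = schwartz_borel[OF assms]
  define B where "B = (LINT t|lborel. cmod (?f2 t))"
  \<comment> \<open>A quadratic remainder bound: \<open>iexp\<close> minus its first-order Taylor
    polynomial is at most the square of its argument, and the second moment of \<open>f\<close> is
    finite. This gives the derivative without a limit theorem under the integral.\<close>
  have est: "cmod (fourier f (w + h) - fourier f w - h *\<^sub>R fourier ?g w) \<le> B * h\<^sup>2" for h
  proof -
    have "fourier f (w + h) - fourier f w - h *\<^sub>R fourier ?g w
       = (LINT t|lborel. iexp (t * (w + h)) * f t - iexp (t * w) * f t - h *\<^sub>R (iexp (t * w) * ?g t))"
      using integrable_iexp_mult(2)[OF schwartz_integrable[OF assms]]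
        integrable_iexp_mult(2)[OF schwartz_integrable[OF g]]
      by (simp add: fourier_lborel del: of_real_add of_real_mult)
    also have "cmod \<dots> \<le> (LINT t|lborel. h\<^sup>2 * cmod (?f2 t))"
    proof (rule Bochner_Integration.integral_norm_bound_integral)
      show "integrable lborel (\<lambda>t. iexp (t * (w + h)) * f t - iexp (t * w) * f t - h *\<^sub>R (iexp (t * w) * ?g t))"
        by (intro Bochner_Integration.integrable_diff integrable_scaleR_right
            integrable_iexp_mult schwartz_integrable assms g)
      show "integrable lborel (\<lambda>t. h\<^sup>2 * cmod (?f2 t))"
        using schwartz_integrable[OF f2] by (intro integrable_mult_right integrable_norm)
      fix t :: real
      have "iexp (t * (w + h)) * f t - iexp (t * w) * f t - h *\<^sub>R (iexp (t * w) * ?g t)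
          = iexp (t * w) * (iexp (t * h) - (1 + \<i> * of_real (t * h))) * f t"
        by (simp add: algebra_simps scaleR_conv_of_real flip: exp_add)
      moreover have "cmod (iexp (t * h) - (1 + \<i> * of_real (t * h))) * cmod (f t)
          \<le> (\<bar>t * h\<bar>\<^sup>2 / 2) * cmod (f t)"
        using iexp_approx1[of "t * h" 1] by (intro mult_right_mono) (simp_all add: power2_eq_square)
      ultimately have "cmod (iexp (t * (w + h)) * f t - iexp (t * w) * f t - h *\<^sub>R (iexp (t * w) * ?g t))
         \<le> (\<bar>t * h\<bar>\<^sup>2 / 2) * cmod (f t)"
        by (simp only: norm_mult norm_exp_i_times mult_1)
      also have "\<dots> \<le> \<bar>t * h\<bar>\<^sup>2 * cmod (f t)" by (simp add: mult_right_mono)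
      finally show "cmod (iexp (t * (w + h)) * f t - iexp (t * w) * f t - h *\<^sub>R (iexp (t * w) * ?g t))
         \<le> h\<^sup>2 * cmod (?f2 t)"
        by (simp add: norm_mult power_mult_distrib power2_eq_square mult_ac)
    qed
    also have "\<dots> = B * h\<^sup>2" by (simp add: B_def)
    finally show ?thesis .
  qed
  show ?thesis
    unfolding has_vector_derivative_def has_derivative_iff_norm
  proof (intro conjI bounded_linear_scaleR_left)
    show "((\<lambda>y. cmod (fourier f y - fourier f w - (y - w) *\<^sub>R fourier ?g w) / norm (y - w)) \<longlongrightarrow> 0) (at w)"
    proof (rule Lim_null_comparison)
      show "\<forall>\<^sub>F y in at w. norm (cmod (fourier f y - fourier f w - (y - w) *\<^sub>R fourier ?g w) / norm (y - w))
          \<le> B * \<bar>y - w\<bar>"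
      proof (rule eventually_at_filter[THEN iffD2], rule always_eventually, intro allI impI)
        fix y :: real assume "y \<noteq> w"
        then show "norm (cmod (fourier f y - fourier f w - (y - w) *\<^sub>R fourier ?g w) / norm (y - w))
            \<le> B * \<bar>y - w\<bar>"
          using est[of "y - w"]
          by (simp add: pos_divide_le_eq power2_eq_square mult.assoc flip: abs_mult)
      qed
      have "((\<lambda>y. B * \<bar>y - w\<bar>) \<longlongrightarrow> B * \<bar>w - w\<bar>) (at w)" by (intro tendsto_intros)
      then show "((\<lambda>y. B * \<bar>y - w\<bar>) \<longlongrightarrow> 0) (at w)" by simp
    qed
  qed
qed

text \<open>Integration by parts on the line: for a product \<open>f\<close> the derivative
  \<open>g\<close> is the sum of the two terms, and the Cauchy bound kills the boundary
  values.\<close>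

lemma integral_vector_derivative_eq_0:
  fixes f :: "real \<Rightarrow> complex"
  assumes d: "\<And>t. (f has_vector_derivative g t) (at t)" and c: "continuous_on UNIV g"
    and i: "integrable lborel g" and b: "\<And>t. cmod (f t) \<le> C / (1 + t\<^sup>2)"
  shows "(LINT t|lborel. g t) = 0"
proof -
  have 1: "((\<lambda>t. C / (1 + t\<^sup>2)) \<longlongrightarrow> 0) at_top" "((\<lambda>t. C / (1 + t\<^sup>2)) \<longlongrightarrow> 0) at_bot"
    by real_asymp+
  have "(f \<longlongrightarrow> 0) at_top" "(f \<longlongrightarrow> 0) at_bot"
    by (rule Lim_null_comparison[OF _ 1(1)], simp add: b)
       (rule Lim_null_comparison[OF _ 1(2)], simp add: b)
  then have "(LBINT t=-\<infinity>..\<infinity>. g t) = 0 - 0"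
    using c i
    by (intro interval_integral_FTC_integrable[where F=f])
       (auto simp: d ereal_tendsto_simps set_integrable_def continuous_on_eq_continuous_at)
  then show ?thesis by (simp add: interval_integral_eq_integral set_lebesgue_integral_def
      interval_lebesgue_integral_def einterval_eq)
qed

lemma fourier_vderiv:
  assumes "schwartz f"
  shows "fourier (vderiv f) w = - \<i> * of_real w * fourier f w"
proof -
  note f' = schwartz_vderiv[OF assms]
  note [measurable] = schwartz_borel[OF assms] schwartz_borel[OF f']
  obtain C where C: "\<And>t. cmod (f t) \<le> C / (1 + t\<^sup>2)" using schwartz_decay[OF assms] by blast
  have "(LINT t|lborel. iexp (t * w) * vderiv f t + (\<i> * of_real w) * (iexp (t * w) * f t)) = 0"
  proof (rule integral_vector_derivative_eq_0[where f = "\<lambda>t. iexp (t * w) * f t" and C = C])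
    show "((\<lambda>t. iexp (t * w) * f t) has_vector_derivative
       iexp (t * w) * vderiv f t + \<i> * complex_of_real w * (iexp (t * w) * f t)) (at t)" for t
    proof -
      have "((\<lambda>t. iexp (t * w)) has_vector_derivative (\<i> * of_real w) * iexp (t * w)) (at t)"
      proof -
        have "((\<lambda>z. exp (\<i> * of_real w * z)) has_field_derivative (\<i> * of_real w) * iexp (t * w)) (at
            (of_real t))"
          by (auto intro!: derivative_eq_intros simp: mult_ac)
        from has_vector_derivative_real_field[OF this] show ?thesis by (simp add: mult_ac)
      qed
      from has_vector_derivative_mult[OF this schwartz_has_vderiv[OF assms]]
      show ?thesis by (simp add: mult_ac add.commute)
    qed
    show "continuous_on UNIV (\<lambda>t. iexp (t * w) * vderiv f t + \<i> * complex_of_real w * (iexp (t * w) * f t))"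
      by (intro continuous_intros schwartz_continuous assms f')
    show "integrable lborel (\<lambda>t. iexp (t * w) * vderiv f t + \<i> * complex_of_real w * (iexp (t * w) * f t))"
      using integrable_iexp_mult(2)[OF schwartz_integrable[OF assms]]
        integrable_iexp_mult(2)[OF schwartz_integrable[OF f']]
      by (intro Bochner_Integration.integrable_add integrable_mult_right)
    show "cmod (iexp (t * w) * f t) \<le> C / (1 + t\<^sup>2)" for t using C by (simp add: norm_mult)
  qed
  then have "fourier (vderiv f) w + (\<i> * of_real w) * fourier f w = 0"
    using integrable_iexp_mult(2)[OF schwartz_integrable[OF assms]]
        integrable_iexp_mult(2)[OF schwartz_integrable[OF f']]
    by (simp add: fourier_lborel)
  then show ?thesis by (simp add: add_eq_0_iff)
qed

text \<open>Differentiating the transform multiplies the function by \<open>\<i> * t\<close>, and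
  multiplying the transform by the frequency differentiates the function. The induction on
  \<open>j\<close> trades one power for one \<open>vderiv\<close>, hence the arbitrary
  \<open>h\<close>, and ends in the L1 bound.\<close>

lemma schwartz_fourier:
  assumes "schwartz f" shows "schwartz (fourier f)"
proof (rule schwartzI)
  define g where "g = (\<lambda>k::nat. ((\<lambda>h t. \<i> * (of_real t * h t)) ^^ k) f)"
  have g: "schwartz (g k)" for k
    by (induction k) (auto simp: g_def assms intro: schwartz_cmult schwartz_mult_id)
  show "fourier (g 0) = fourier f" by (simp add: g_def)
  show "(fourier (g k) has_vector_derivative fourier (g (Suc k)) t) (at t)" for k t
    using fourier_has_vector_derivative[OF g, of k] by (simp add: g_def)
  have "bounded (range (\<lambda>t. t ^ j *\<^sub>R fourier h t))" if "schwartz h" for j h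
    using that
  proof (induction j arbitrary: h)
    case 0
    then show ?case using norm_fourier_le[OF schwartz_integrable[of h]] by (auto simp: bounded_iff)
  next
    case (Suc j)
    have "t ^ Suc j *\<^sub>R fourier h t = \<i> * (t ^ j *\<^sub>R fourier (vderiv h) t)" for t
      by (simp add: fourier_vderiv[OF Suc.prems] scaleR_conv_of_real mult_ac)
    then show ?case using Suc.IH[OF schwartz_vderiv[OF Suc.prems]]
      by (simp add: bounded_iff norm_mult)
  qed
  then show "bounded (range (\<lambda>t. t ^ j *\<^sub>R fourier (g k) t))" for j k using g by blast
qed

section \<open>Gaussians and uniqueness of Fourier transforms\<close>

lemma power_le_fact_exp:
  fixes x :: real assumes "0 \<le> x" shows "x ^ n \<le> fact n * exp x"
proof -
  have "(\<Sum>i\<in>{n}. x ^ i /\<^sub>R fact i) \<le> exp x"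
    unfolding exp_def using assms summable_exp_generic[of x]
    by (intro sum_le_suminf) auto
  then show ?thesis by (simp add: field_simps)
qed

text \<open>The linear coefficient is complex in order to cover translated Gaussians (real
  \<open>b\<close>) and modulated ones (imaginary \<open>b\<close>) at once.\<close>

lemma schwartz_gaussian:
  "schwartz (\<lambda>t. exp (- (of_real t)\<^sup>2 / 2 + b * of_real t + c))"
proof -
  define E where "E = (\<lambda>t::real. exp (- (of_real t)\<^sup>2 / 2 + b * of_real t + c))"
  \<comment> \<open>The polynomial \<open>[:b, -1:]\<close> is the logarithmic derivative of
    \<open>E\<close>, so differentiating \<open>q * E\<close> replaces \<open>q\<close> by
    \<open>pderiv q + [:b, -1:] * q\<close>.\<close>
  define p where "p = (\<lambda>k::nat. ((\<lambda>q. pderiv q + [:b, -1:] * q) ^^ k) 1)"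
  let ?D = "\<lambda>k t. poly (p k) (of_real t) * E t"
  have E_bound: "\<exists>B. \<forall>t. cmod (of_real t ^ j * E t) \<le> B" for j
  proof (intro exI allI)
    fix t
    \<comment> \<open>Completing the square. The extra \<open>\<bar>t\<bar>\<close> pays for
      \<open>t ^ j\<close>, which is at most \<open>fact j * exp \<bar>t\<bar>\<close>.\<close>
    have "\<bar>t\<bar> - t\<^sup>2 / 2 + Re b * t \<le> (\<bar>Re b\<bar> + 1)\<^sup>2 / 2"
    proof -
      have "Re b * t \<le> \<bar>Re b\<bar> * \<bar>t\<bar>" by (metis abs_ge_self abs_mult)
      moreover have "0 \<le> (\<bar>t\<bar> - (\<bar>Re b\<bar> + 1))\<^sup>2" by simp
      ultimately show ?thesis by (simp add: power2_eq_square algebra_simps)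
    qed
    then have "exp \<bar>t\<bar> * exp (- t\<^sup>2 / 2 + Re b * t + Re c) \<le> exp ((\<bar>Re b\<bar> + 1)\<^sup>2 / 2 + Re c)"
      by (simp flip: exp_add)
    moreover have "cmod (of_real t ^ j * E t) = \<bar>t\<bar> ^ j * exp (- t\<^sup>2 / 2 + Re b * t + Re c)"
      by (simp add: E_def norm_mult norm_power power_abs flip: of_real_power)
    moreover have "\<dots> \<le> (fact j * exp \<bar>t\<bar>) * exp (- t\<^sup>2 / 2 + Re b * t + Re c)"
      by (intro mult_right_mono power_le_fact_exp) auto
    ultimately show "cmod (of_real t ^ j * E t) \<le> fact j * exp ((\<bar>Re b\<bar> + 1)\<^sup>2 / 2 + Re c)"
      by (smt (verit) mult.assoc mult_left_mono fact_ge_zero)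
  qed
  have poly_bound: "\<exists>B. \<forall>t. cmod (of_real t ^ j * (poly q (of_real t) * E t)) \<le> B" for j q
  proof (induction q arbitrary: j)
    case (pCons a q)
    obtain B where B: "cmod (of_real t ^ j * E t) \<le> B" for t using E_bound by blast
    obtain B' where B': "cmod (of_real t ^ Suc j * (poly q (of_real t) * E t)) \<le> B'" for t
      using pCons.IH by blast
    have "cmod (of_real t ^ j * (poly (pCons a q) (of_real t) * E t)) \<le> cmod a * B + B'" for t
    proof -
      have "of_real t ^ j * (poly (pCons a q) (of_real t) * E t)
        = a * (of_real t ^ j * E t) + of_real t ^ Suc j * (poly q (of_real t) * E t)"
        by (simp add: algebra_simps)
      moreover have "cmod (a * (of_real t ^ j * E t)) \<le> cmod a * B"
        unfolding norm_mult[of a] by (intro mult_left_mono B) simp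
      ultimately show ?thesis using B'[of t] norm_triangle_mono by metis
    qed
    then show ?case by blast
  qed (auto intro: exI[of _ 0])
  have "schwartz E"
  proof (rule schwartzI)
    show "?D 0 = E" by (simp add: p_def)
    show "(?D k has_vector_derivative ?D (Suc k) t) (at t)" for k t
    proof -
      have "((\<lambda>z. poly (p k) z * exp (- z\<^sup>2 / 2 + b * z
          + c)) has_field_derivative ?D (Suc k) t) (at (of_real t))"
        by (auto intro!: derivative_eq_intros simp: p_def E_def algebra_simps)
      from has_vector_derivative_real_field[OF this] show ?thesis by (simp add: E_def)
    qed
    show "bounded (range (\<lambda>t. t ^ j *\<^sub>R ?D k t))" for j k
      using poly_bound[of j "p k"] by (simp add: bounded_iff scaleR_conv_of_real)
  qed
  then show ?thesis by (simp add: E_def)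
qed

lemma schwartz_shifted_gaussian: "schwartz (\<lambda>t. of_real (exp (- (t - x)\<^sup>2 / 2)))"
proof -
  have "(\<lambda>t. of_real (exp (- (t - x)\<^sup>2 / 2)))
      = (\<lambda>t. exp (- (of_real t)\<^sup>2 / 2 + complex_of_real x * of_real t + of_real (- x\<^sup>2 / 2)))"
    by (rule ext) (simp add: power2_eq_square algebra_simps diff_divide_distrib add_divide_distrib flip:
        exp_of_real)
  then show ?thesis by (simp only: schwartz_gaussian)
qed

lemma has_bochner_integral_iexp_gaussian:
  "has_bochner_integral lborel (\<lambda>s. iexp (w * s) * of_real (exp (- s\<^sup>2 / 2)))
     (of_real (sqrt (2 * pi) * exp (- w\<^sup>2 / 2)))"
proof -
  have eq: "iexp (w * s) * of_real (exp (- s\<^sup>2 / 2))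
     = of_real (sqrt (2 * pi)) * (std_normal_density s *\<^sub>R iexp (w * s))" for s
    by (simp add: std_normal_density_def scaleR_conv_of_real)
  have "(LINT s|lborel. std_normal_density s *\<^sub>R iexp (w * s)) = char std_normal_distribution w"
    unfolding char_def by (rule integral_density[symmetric]) auto
  then have "(LINT s|lborel. std_normal_density s *\<^sub>R iexp (w * s)) = of_real (exp (- w\<^sup>2 / 2))"
    by (simp add: char_std_normal_distribution)
  moreover have "integrable lborel (\<lambda>s. std_normal_density s *\<^sub>R iexp (w * s))"
    by (rule Bochner_Integration.integrable_bound[OF integrable_std_normal_moment[of 0]]) auto
  ultimately have "has_bochner_integral lborel (\<lambda>s. std_normal_density s *\<^sub>R iexp (w * s))
      (of_real (exp (- w\<^sup>2 / 2)))"
    by (simp only: has_bochner_integral_iff simp_thms)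
  then have "has_bochner_integral lborel
      (\<lambda>s. of_real (sqrt (2 * pi)) * (std_normal_density s *\<^sub>R iexp (w * s)))
      (of_real (sqrt (2 * pi)) * of_real (exp (- w\<^sup>2 / 2)))"
    by (rule has_bochner_integral_mult_right)
  then show ?thesis unfolding eq by (simp only: of_real_mult)
qed

lemma fourier_shifted_gaussian:
  "fourier (\<lambda>t. of_real (exp (- (t - x)\<^sup>2 / 2))) w
     = of_real (sqrt (2 * pi)) * iexp (x * w) * of_real (exp (- w\<^sup>2 / 2))"
proof -
  have "fourier (\<lambda>t. of_real (exp (- (t - x)\<^sup>2 / 2))) w
     = (LINT t|lborel. iexp (t * w) * of_real (exp (- (t - x)\<^sup>2 / 2)))"
    by (rule fourier_lborel) measurable
  also have "\<dots> = (LINT s|lborel. iexp ((x + 1 * s) * w) * of_real (exp (- (x + 1 * s - x)\<^sup>2 / 2)))"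
    by (subst lborel_integral_real_affine[of 1 _ x]) simp_all
  also have "\<dots> = (LINT s|lborel. iexp (x * w) * (iexp (w * s) * of_real (exp (- s\<^sup>2 / 2))))"
    by (intro Bochner_Integration.integral_cong) (auto simp: algebra_simps exp_add)
  also have "\<dots> = iexp (x * w) * of_real (sqrt (2 * pi) * exp (- w\<^sup>2 / 2))"
    using has_bochner_integral_iexp_gaussian[of w]
    by (simp only: integral_mult_right_zero has_bochner_integral_integral_eq)
  finally show ?thesis by simp
qed

text \<open>The scaling \<open>s = sqrt 2 * w\<close> of the previous formula. The width is that of
  a product of two transforms of the unit Gaussian, the weight under which the spectral measure is
  compared later.\<close>

lemma has_bochner_integral_iexp_gaussian':
  "has_bochner_integral lborel (\<lambda>w. iexp (w * u) * of_real (exp (- w\<^sup>2)))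
     (of_real (sqrt pi * exp (- u\<^sup>2 / 4)))"
proof -
  have "has_bochner_integral lborel (\<lambda>w. iexp (u / sqrt 2 * (0 + sqrt 2 * w)) * of_real (exp (- (0
      + sqrt 2 * w)\<^sup>2 / 2)))
     (of_real (sqrt (2 * pi) * exp (- (u / sqrt 2)\<^sup>2 / 2)) /\<^sub>R \<bar>sqrt 2\<bar>)"
    by (rule lborel_has_bochner_integral_real_affine_iff[THEN iffD1, OF _
        has_bochner_integral_iexp_gaussian]) simp
  then show ?thesis
    by (simp add: power_divide power_mult_distrib real_sqrt_mult scaleR_conv_of_real field_simps)
qed

text \<open>Centring at the midpoint of \<open>x\<close> and \<open>t\<close> splits the exponent
  into \<open>- (x - t)\<^sup>2 / 4\<close> and \<open>- u\<^sup>2\<close>.\<close>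

lemma integral_gaussian_product:
  "(LINT u|lborel. complex_of_real (exp (- (u - x)\<^sup>2 / 2) * exp (- (u - t)\<^sup>2 / 2)))
     = of_real (sqrt pi * exp (- (x - t)\<^sup>2 / 4))"
proof -
  have "(LINT u|lborel. complex_of_real (exp (- (u - x)\<^sup>2 / 2) * exp (- (u - t)\<^sup>2 / 2)))
    = (LINT u|lborel. of_real (exp (- ((x + t) / 2 + 1 * u - x)\<^sup>2 / 2) * exp (- ((x + t) / 2
        + 1 * u - t)\<^sup>2 / 2)))"
    by (subst lborel_integral_real_affine[of 1 _ "(x + t) / 2"]) simp_all
  also have "\<dots> = (LINT u|lborel. of_real (exp (- (x - t)\<^sup>2 / 4)) * (iexp (u * 0) * of_real (exp (- u\<^sup>2))))"
  proof (intro Bochner_Integration.integral_cong refl)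
    fix u
    have "- ((x + t) / 2 + 1 * u - x)\<^sup>2 / 2 + - ((x + t) / 2 + 1 * u - t)\<^sup>2 / 2 = - (x - t)\<^sup>2 / 4 + - u\<^sup>2"
      by (simp add: power2_eq_square field_simps)
    then have "exp (- ((x + t) / 2 + 1 * u - x)\<^sup>2 / 2) * exp (- ((x + t) / 2 + 1 * u - t)\<^sup>2 / 2)
        = exp (- (x - t)\<^sup>2 / 4) * exp (- u\<^sup>2)"
      by (simp only: flip: exp_add)
    then show "complex_of_real (exp (- ((x + t) / 2 + 1 * u - x)\<^sup>2 / 2) * exp (- ((x + t) / 2
        + 1 * u - t)\<^sup>2 / 2))
      = of_real (exp (- (x - t)\<^sup>2 / 4)) * (iexp (u * 0) * of_real (exp (- u\<^sup>2)))"
      by (simp only: of_real_mult) simp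
  qed
  also have "\<dots> = of_real (exp (- (x - t)\<^sup>2 / 4)) * of_real (sqrt pi * exp (- 0\<^sup>2 / 4))"
    using has_bochner_integral_iexp_gaussian'[of 0]
    by (simp only: integral_mult_right_zero has_bochner_integral_integral_eq)
  finally show ?thesis by simp
qed

text \<open>The total mass is the characteristic function at 0, so both measures can be normalised
  by the same constant and Levy's theorem applies. Mass 0 cannot be normalised and is treated
  apart.\<close>

lemma finite_measure_eqI_char:
  fixes M1 M2 :: "real measure"
  assumes f: "finite_measure M1" "finite_measure M2" and s: "sets M1 = sets borel" "sets M2 = sets borel"
    and c: "\<And>t. char M1 t = char M2 t"
  shows "M1 = M2"
proof -
  interpret M1: finite_measure M1 by fact
  interpret M2: finite_measure M2 by fact
  have sp: "space M1 = UNIV" "space M2 = UNIV" using s[THEN sets_eq_imp_space_eq] by auto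
  define c where "c = measure M1 UNIV"
  have c1: "emeasure M1 UNIV = ennreal c" by (simp add: c_def M1.emeasure_eq_measure)
  have "c = measure M2 UNIV" using c[of 0] by (simp add: char_def sp c_def)
  then have c2: "emeasure M2 UNIV = ennreal c" by (simp add: M2.emeasure_eq_measure)
  show ?thesis
  proof (cases "c = 0")
    case True
    show ?thesis
    proof (rule measure_eqI)
      fix A assume "A \<in> sets M1"
      have "emeasure M1 A \<le> 0" using emeasure_space[of M1 A] c1 True by (simp add: sp)
      moreover have "emeasure M2 A \<le> 0" using emeasure_space[of M2 A] c2 True by (simp add: sp)
      ultimately show "emeasure M1 A = emeasure M2 A" by simp
    qed (simp add: s)
  next
    case False
    then have cpos: "c > 0" using measure_nonneg[of M1 UNIV] by (simp add: c_def less_le)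
    let ?d = "\<lambda>M. density M (\<lambda>_. ennreal (1 / c))"
    have real: "real_distribution (?d M)" if "sets M = sets borel" "emeasure M UNIV = ennreal c" for M
    proof -
      have "space M = UNIV" using sets_eq_imp_space_eq[OF that(1)] by auto
      then have "emeasure (?d M) UNIV = ennreal (1 / c) * ennreal c"
        using that by (subst emeasure_density) (auto simp: nn_integral_cmult)
      also have "\<dots> = 1" using cpos by (simp flip: ennreal_mult)
      finally have "prob_space (?d M)" using \<open>space M = UNIV\<close> by (intro prob_spaceI) simp
      then show ?thesis using that by (simp add: real_distribution_def real_distribution_axioms_def)
    qed
    have ch: "char (?d M) t = char M t / c" if "sets M = sets borel" for M t
    proof -
      have "char (?d M) t = (LINT x|M. (1 / c) *\<^sub>R iexp (t * x))"
        unfolding char_def using that cpos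
        by (subst integral_density) (auto simp: measurable_cong_sets[OF that refl])
      then show ?thesis by (simp add: char_def scaleR_conv_of_real)
    qed
    have "?d M1 = ?d M2"
      by (rule Levy_uniqueness) (auto simp: real s c1 c2 ch c)
    show ?thesis
    proof (rule measure_eqI)
      fix A assume A: "A \<in> sets M1"
      have "emeasure (?d M1) A = emeasure (?d M2) A" by (simp add: \<open>?d M1 = ?d M2\<close>)
      then have "ennreal (1 / c) * emeasure M1 A = ennreal (1 / c) * emeasure M2 A"
        using A s by (simp add: emeasure_density_const)
      then show "emeasure M1 A = emeasure M2 A"
        using cpos by (simp add: ennreal_mult_cancel_left)
    qed (simp add: s)
  qed
qed

text \<open>The positive part (\<open>\<sigma> = 1\<close>) and the negative part
  (\<open>\<sigma> = -1\<close>) of \<open>r\<close> are densities of finite measures with the same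
  characteristic function. They therefore agree almost everywhere, and as one of them is 0 at each
  point, both vanish.\<close>

lemma AE_eq_0_if_fourier_0_real:
  fixes r :: "real \<Rightarrow> real"
  assumes r: "integrable lborel r" and 0: "\<And>x. (LINT w|lborel. iexp (x * w) * of_real (r w)) = 0"
  shows "AE w in lborel. r w = 0"
proof -
  have [measurable]: "r \<in> borel_measurable borel" using r by auto
  define d where "d = (\<lambda>\<sigma>. density lborel (\<lambda>w. ennreal (max 0 (\<sigma> * r w))))"
  have i: "integrable lborel (\<lambda>w. max 0 (\<sigma> * r w))" for \<sigma> using r by auto
  have fin: "finite_measure (d \<sigma>)" for \<sigma>
  proof (rule finite_measureI)
    have "emeasure (d \<sigma>) (space (d \<sigma>)) = (\<integral>\<^sup>+w. ennreal (max 0 (\<sigma> * r w)) \<partial>lborel)"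
      unfolding d_def by (subst emeasure_density) auto
    also have "\<dots> = ennreal (LINT w|lborel. max 0 (\<sigma> * r w))"
      by (rule nn_integral_eq_integral[OF i]) simp
    finally show "emeasure (d \<sigma>) (space (d \<sigma>)) \<noteq> \<infinity>" by simp
  qed
  have ch: "char (d \<sigma>) x = (LINT w|lborel. iexp (x * w) * of_real (max 0 (\<sigma> * r w)))" for \<sigma> x
    unfolding char_def d_def
    by (subst integral_density) (auto simp: scaleR_conv_of_real mult.commute)
  have int: "integrable lborel (\<lambda>w. iexp (x * w) * of_real (max 0 (\<sigma> * r w)))" for \<sigma> x
    by (intro integrable_iexp_mult) (use i in auto)
  have "char (d 1) x - char (d (-1)) x = (LINT w|lborel. iexp (x * w) * of_real (max 0 (1 * r w)) - iexp (x
      * w) * of_real (max 0 (-1 * r w)))" for x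
    unfolding ch using int by (intro Bochner_Integration.integral_diff[symmetric])
  also have "\<dots> x = (LINT w|lborel. iexp (x * w) * of_real (r w))" for x
    by (intro Bochner_Integration.integral_cong refl) (auto simp: max_def simp flip: right_diff_distrib)
  finally have "char (d 1) x = char (d (-1)) x" for x using 0 by simp
  then have "d 1 = d (-1)"
    by (intro finite_measure_eqI_char fin) (auto simp: d_def)
  then have "AE w in lborel. ennreal (max 0 (1 * r w)) = ennreal (max 0 (-1 * r w))"
    unfolding d_def by (subst (asm) sigma_finite_measure.density_unique_iff[OF sigma_finite_lborel]) auto
  then show ?thesis by eventually_elim (auto simp: max_def split: if_splits)
qed

text \<open>Conjugating the hypothesis at \<open>- x\<close> shows that the transform of
  \<open>cnj h\<close> vanishes too, which isolates \<open>Re h\<close>. The imaginary part is the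
  real part of \<open>- \<i> * h\<close>.\<close>

lemma AE_eq_0_if_fourier_0:
  fixes h :: "real \<Rightarrow> complex"
  assumes h: "integrable lborel h" and 0: "\<And>x. (LINT w|lborel. iexp (x * w) * h w) = 0"
  shows "AE w in lborel. h w = 0"
proof -
  have Re_0: "AE w in lborel. Re (h w) = 0"
    if h: "integrable lborel h" and 0: "\<And>x. (LINT w|lborel. iexp (x * w) * h w) = 0" for h :: "real \<Rightarrow> complex"
  proof (rule AE_eq_0_if_fourier_0_real)
    show "integrable lborel (\<lambda>w. Re (h w))" using h by simp
    fix x
    have "(LINT w|lborel. cnj (iexp (- x * w) * h w)) = 0"
      using 0[of "- x"] by (simp only: Bochner_Integration.integral_cnj complex_cnj_zero)
    moreover have "integrable lborel (\<lambda>w. iexp (x * w) * h w)"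
       "integrable lborel (\<lambda>w. cnj (iexp (- x * w) * h w))"
      using integrable_iexp_mult(1)[OF h] by (simp_all only: integrable_cnj)
    ultimately have "(LINT w|lborel. iexp (x * w) * h w + cnj (iexp (- x * w) * h w)) = 0"
      using 0 by simp
    moreover have "iexp (x * w) * h w + cnj (iexp (- x * w) * h w)
        = 2 * (iexp (x * w) * of_real (Re (h w)))" for w
    proof -
      have "iexp (x * w) * h w + cnj (iexp (- x * w) * h w) = iexp (x * w) * (h w + cnj (h w))"
        by (simp add: exp_cnj distrib_left)
      then show ?thesis by (simp add: complex_add_cnj)
    qed
    ultimately have "(LINT w|lborel. 2 * (iexp (x * w) * of_real (Re (h w)))) = 0" by (simp only:)
    then show "(LINT w|lborel. iexp (x * w) * of_real (Re (h w))) = 0" by simp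
  qed
  have "AE w in lborel. Re (- \<i> * h w) = 0"
  proof (rule Re_0)
    show "integrable lborel (\<lambda>w. - \<i> * h w)" using h by simp
    show "(LINT w|lborel. iexp (x * w) * (- \<i> * h w)) = 0" for x
    proof -
      have "(LINT w|lborel. iexp (x * w) * (- \<i> * h w)) = (LINT w|lborel. - \<i> * (iexp (x * w) * h w))"
        by (simp add: algebra_simps)
      also have "\<dots> = 0" by (simp only: integral_mult_right_zero 0 mult_zero_right)
      finally show ?thesis .
    qed
  qed
  with Re_0[OF assms] show ?thesis by eventually_elim (simp add: complex_eq_iff)
qed

section \<open>Distributions whose Fourier transform is a function\<close>

text \<open>Fubini. Both functions are merely integrable, so that the formula serves indicators and
  translates as well as Schwartz functions.\<close>

lemma fourier_multiplication_formula:
  assumes f: "integrable lborel f" and g: "integrable lborel g"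
  shows "(LINT s|lborel. f s * fourier g s) = (LINT w|lborel. fourier f w * g w)"
    and "integrable lborel (\<lambda>s. f s * fourier g s)"
proof -
  have [measurable]: "f \<in> borel_measurable borel" "g \<in> borel_measurable borel" using f g by auto
  have i: "integrable (lborel \<Otimes>\<^sub>M lborel) (\<lambda>(s, w). f s * (iexp (w * s) * g w))"
  proof (rule lborel_pair.Fubini_integrable)
    show "integrable lborel (\<lambda>s. LINT w|lborel. norm (case (s, w) of (s, w) \<Rightarrow> f s * (iexp (w * s) * g w)))"
      using f by (simp add: norm_mult)
    show "AE s in lborel. integrable lborel (\<lambda>w. case (s, w) of (s, w) \<Rightarrow> f s * (iexp (w * s) * g w))"
      using integrable_iexp_mult(2)[OF g] by simp
  qed simp
  have "(LINT s|lborel. f s * fourier g s) = (LINT s|lborel. LINT w|lborel. f s * (iexp (w * s) * g w))"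
    by (simp only: fourier_lborel[OF \<open>g \<in> _\<close>] integral_mult_right_zero)
  also have "\<dots> = (LINT w|lborel. LINT s|lborel. f s * (iexp (w * s) * g w))"
    by (rule lborel_pair.Fubini_integral[OF i, symmetric])
  also have "\<dots> = (LINT w|lborel. LINT s|lborel. (iexp (s * w) * f s) * g w)"
    by (simp add: mult_ac)
  also have "\<dots> = (LINT w|lborel. fourier f w * g w)"
    by (simp only: fourier_lborel[OF \<open>f \<in> _\<close>] integral_mult_left_zero)
  finally show "(LINT s|lborel. f s * fourier g s) = (LINT w|lborel. fourier f w * g w)" .
  show "integrable lborel (\<lambda>s. f s * fourier g s)"
  proof (rule Bochner_Integration.integrable_bound)
    show "integrable lborel (\<lambda>s. (LINT t|lborel. cmod (g t)) *\<^sub>R f s)" using f by simp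
    show "AE s in lborel. norm (f s * fourier g s) \<le> norm ((LINT t|lborel. cmod (g t)) *\<^sub>R f s)"
      using norm_fourier_le[OF g]
      by (auto simp: norm_mult mult.commute[of "cmod (f _)"] intro!: mult_right_mono order_trans[OF _
          abs_ge_self])
  qed measurable
qed

lemma schwartz_norm_ge:
  assumes "schwartz f" "j \<le> n" "k \<le> n"
  shows "norm (t ^ j *\<^sub>R (vderiv ^^ k) f t) \<le> schwartz_norm n f"
proof -
  let ?S = "\<lambda>j k. SUP t. norm (t ^ j *\<^sub>R (vderiv ^^ k) f t)"
  have bdd: "bdd_above (range (\<lambda>t. norm (t ^ j *\<^sub>R (vderiv ^^ k) f t)))" for j k
    using schwartz_iterated_bounded[OF assms(1), of j k] by (auto simp: bounded_iff bdd_above_def)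
  have nn: "0 \<le> ?S j k" for j k
    by (rule cSUP_upper2[OF bdd, of 0]) auto
  have "norm (t ^ j *\<^sub>R (vderiv ^^ k) f t) \<le> ?S j k"
    by (rule cSUP_upper[OF _ bdd]) simp
  also have "\<dots> \<le> (\<Sum>k\<le>n. ?S j k)"
    using assms by (intro member_le_sum nn) auto
  also have "\<dots> \<le> (\<Sum>j\<le>n. \<Sum>k\<le>n. ?S j k)"
    using assms by (intro member_le_sum sum_nonneg nn) auto
  finally show ?thesis by (simp add: schwartz_norm_def)
qed

lemma integrable_bounded_mult_schwartz:
  assumes [measurable]: "g \<in> borel_measurable borel" and B: "\<And>t. cmod (g t) \<le> B" and \<phi>: "schwartz \<phi>"
  shows "integrable lborel (\<lambda>t. g t * \<phi> t)"
proof (rule Bochner_Integration.integrable_bound)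
  note [measurable] = schwartz_borel[OF \<phi>]
  show "integrable lborel (\<lambda>t. B *\<^sub>R \<phi> t)" using schwartz_integrable[OF \<phi>] by simp
  show "AE t in lborel. norm (g t * \<phi> t) \<le> norm (B *\<^sub>R \<phi> t)"
    using B by (auto simp: norm_mult intro!: mult_right_mono order_trans[OF _ abs_ge_self])
  show "(\<lambda>t. g t * \<phi> t) \<in> borel_measurable lborel" by measurable
qed

lemma dist_of_lborel:
  assumes [measurable]: "g \<in> borel_measurable borel" and \<phi>: "schwartz \<phi>"
  shows "dist_of g \<phi> = (LINT t|lborel. g t * \<phi> t)"
proof -
  note [measurable] = schwartz_borel[OF \<phi>]
  show ?thesis using \<phi> by (simp add: dist_of_def integral_completion)
qed

lemma schwartz_add:
  assumes "schwartz f" "schwartz g" shows "schwartz (\<lambda>t. f t + g t)"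
proof (rule schwartzI)
  show "((\<lambda>t. (vderiv ^^ k) f t + (vderiv ^^ k) g t) has_vector_derivative
      (vderiv ^^ Suc k) f t + (vderiv ^^ Suc k) g t) (at t)" for k t
    by (intro has_vector_derivative_add schwartz_iterated_vderiv assms)
  show "bounded (range (\<lambda>t. t ^ j *\<^sub>R ((vderiv ^^ k) f t + (vderiv ^^ k) g t)))" for j k
    unfolding scaleR_add_right by (intro bounded_plus_comp schwartz_iterated_bounded assms)
qed simp

lemma tempered_dist_of_bounded:
  assumes [measurable]: "g \<in> borel_measurable borel" and B: "\<And>t. cmod (g t) \<le> B"
  shows "tempered_distribution (dist_of g)"
  unfolding tempered_distribution_def
proof (intro conjI allI impI)
  show "dist_of g \<phi> = 0" if "\<not> schwartz \<phi>" for \<phi> using that by (simp add: dist_of_def)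
  fix \<phi> \<psi> and a b :: complex assume \<phi>: "schwartz \<phi>" and \<psi>: "schwartz \<psi>"
  have "schwartz (\<lambda>t. a * \<phi> t + b * \<psi> t)" by (intro schwartz_add schwartz_cmult \<phi> \<psi>)
  then show "dist_of g (\<lambda>t. a * \<phi> t + b * \<psi> t) = a * dist_of g \<phi> + b * dist_of g \<psi>"
    using integrable_bounded_mult_schwartz[OF assms \<phi>] integrable_bounded_mult_schwartz[OF assms \<psi>]
    by (simp add: dist_of_lborel \<phi> \<psi> distrib_left mult.left_commute[of "g _"])
next
  have "cmod (dist_of g \<phi>) \<le> (2 * B * (LINT t|lborel. 1 / (1 + t\<^sup>2))) * schwartz_norm 2 \<phi>"
    if \<phi>: "schwartz \<phi>" for \<phi>
  proof -
    have B0: "B \<ge> 0" using order_trans[OF norm_ge_zero B] .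
    have "cmod (dist_of g \<phi>) \<le> (LINT t|lborel. (B * (2 * schwartz_norm 2 \<phi>)) * (1 / (1 + t\<^sup>2)))"
      unfolding dist_of_lborel[OF assms(1) \<phi>]
    proof (rule Bochner_Integration.integral_norm_bound_integral)
      fix t
      \<comment> \<open>Order 2 of the Schwartz norm suffices: the seminorms with
        \<open>j = 0\<close> and \<open>j = 2\<close> and no derivative add up to the Cauchy
        weight.\<close>
      have "cmod (\<phi> t) * (1 + t\<^sup>2) \<le> 2 * schwartz_norm 2 \<phi>"
        using schwartz_norm_ge[OF \<phi>, of 0 2 0 t] schwartz_norm_ge[OF \<phi>, of 2 2 0 t]
        by (simp add: algebra_simps)
      then have "cmod (\<phi> t) \<le> (2 * schwartz_norm 2 \<phi>) * (1 / (1 + t\<^sup>2))"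
        by (simp add: pos_le_divide_eq add_pos_nonneg)
      then show "cmod (g t * \<phi> t) \<le> (B * (2 * schwartz_norm 2 \<phi>)) * (1 / (1 + t\<^sup>2))"
        unfolding norm_mult mult.assoc[of B] by (intro mult_mono B) (auto simp: B0)
    qed (intro integrable_bounded_mult_schwartz[OF assms \<phi>] integrable_mult_right integrable_cauchy)+
    then show ?thesis by (simp only: integral_mult_right_zero mult_ac)
  qed
  then show "\<exists>N C. \<forall>\<phi>. schwartz \<phi> \<longrightarrow> cmod (dist_of g \<phi>) \<le> C * schwartz_norm N \<phi>" by blast
qed

text \<open>Distributions are defined with the completed measure, whereas Fubini and substitutions
  are carried out for Borel functions; the passage between the two is made here.\<close>

lemma fourier_is_funI:
  assumes [measurable]: "g \<in> borel_measurable borel" "h \<in> borel_measurable borel"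
    and "\<And>\<psi>. schwartz \<psi> \<Longrightarrow> integrable lborel (\<lambda>w. h w * \<psi> w)"
    and "\<And>\<psi>. schwartz \<psi> \<Longrightarrow> (LINT t|lborel. g t * fourier \<psi> t) = (LINT w|lborel. h w * \<psi> w)"
  shows "fourier_is_fun (dist_of g) h"
  unfolding fourier_is_fun_def
proof (intro conjI allI impI)
  show "integrable lebesgue (\<lambda>w. h w * \<psi> w)" if "schwartz \<psi>" for \<psi>
    using assms(3)[OF that] by (rule integrable_completion[THEN iffD2, rotated]) (use that in measurable)
  show "fourier_dist (dist_of g) = dist_of h"
  proof
    fix \<psi> show "fourier_dist (dist_of g) \<psi> = dist_of h \<psi>"
    proof (cases "schwartz \<psi>")
      case True
      then show ?thesis
        by (simp add: fourier_dist_def dist_of_lborel assms schwartz_fourier)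
    next
      case False
      then show ?thesis by (simp add: fourier_dist_def dist_of_def)
    qed
  qed
qed (rule assms)

lemma fourier_is_fun_integrable:
  assumes "integrable lborel f"
  shows "fourier_is_fun (dist_of f) (fourier f)"
proof (rule fourier_is_funI)
  show [measurable]: "f \<in> borel_measurable borel" using assms by auto
  show "fourier f \<in> borel_measurable borel" by measurable
  fix \<psi> assume \<psi>: "schwartz \<psi>"
  show "integrable lborel (\<lambda>w. fourier f w * \<psi> w)"
    using fourier_multiplication_formula(2)[OF schwartz_integrable[OF \<psi>] assms] by (simp add: mult.commute)
  show "(LINT t|lborel. f t * fourier \<psi> t) = (LINT w|lborel. fourier f w * \<psi> w)"
    using fourier_multiplication_formula(1)[OF assms schwartz_integrable[OF \<psi>]] .
qed

text \<open>Tested on the modulated Gaussians \<open>e x\<close>, equality of the distributions says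
  that \<open>(h1 - h2) * e 0\<close> has vanishing Fourier transform. The factor \<open>e 0\<close>
  provides integrability and has no zeros. This identifies the unspecified representative in
  \<open>Dom\<close> with an explicit multiplier.\<close>

lemma fourier_is_fun_unique:
  assumes "fourier_is_fun g h1" "fourier_is_fun g h2"
  shows "AE w in lborel. h1 w = h2 w"
proof -
  have [measurable]: "h1 \<in> borel_measurable borel" "h2 \<in> borel_measurable borel"
    using assms by (auto simp: fourier_is_fun_def)
  define e where "e = (\<lambda>x t. exp (- (of_real t)\<^sup>2 / 2 + (\<i> * of_real x) * of_real t + 0))"
  have e: "schwartz (e x)" for x unfolding e_def by (rule schwartz_gaussian)
  have e_eq: "e x t = iexp (x * t) * e 0 t" for x t
    by (simp add: e_def algebra_simps flip: exp_add)
  note [measurable] = schwartz_borel[OF e]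
  have i: "integrable lborel (\<lambda>w. h w * e x w)" if "fourier_is_fun g h" for h x
  proof -
    have [measurable]: "h \<in> borel_measurable borel" using that by (auto simp: fourier_is_fun_def)
    have "integrable lebesgue (\<lambda>w. h w * e x w)" using that e by (auto simp: fourier_is_fun_def)
    then show ?thesis by (rule integrable_completion[THEN iffD1, rotated]) measurable
  qed
  have "AE w in lborel. (h1 w - h2 w) * e 0 w = 0"
  proof (rule AE_eq_0_if_fourier_0)
    show "integrable lborel (\<lambda>w. (h1 w - h2 w) * e 0 w)"
      using i[OF assms(1)] i[OF assms(2)] by (simp add: left_diff_distrib)
    fix x
    have "dist_of h1 (e x) = dist_of h2 (e x)"
      using assms by (simp add: fourier_is_fun_def)
    then have "(LINT w|lborel. h1 w * e x w - h2 w * e x w) = 0"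
      using i[OF assms(1)] i[OF assms(2)] by (simp add: dist_of_lborel e)
    also have "(\<lambda>w. h1 w * e x w - h2 w * e x w) = (\<lambda>w. iexp (x * w) * ((h1 w - h2 w) * e 0 w))"
      unfolding e_eq[of x] by (simp add: algebra_simps)
    finally show "(LINT w|lborel. iexp (x * w) * ((h1 w - h2 w) * e 0 w)) = 0" .
  qed
  then show ?thesis by eventually_elim (simp add: e_def)
qed

section \<open>The one-sided Fourier transform of the memory kernel\<close>

lemma norm_set_integral_le:
  fixes f :: "real \<Rightarrow> 'b::{banach, second_countable_topology}" and g :: "real \<Rightarrow> real"
  assumes "set_integrable M A f" "set_integrable M A g" "\<And>x. x \<in> A \<Longrightarrow> norm (f x) \<le> g x"
  shows "norm (LINT x:A|M. f x) \<le> (LINT x:A|M. g x)"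
  unfolding set_lebesgue_integral_def
  using assms unfolding set_integrable_def
  by (intro Bochner_Integration.integral_norm_bound_integral) (auto split: split_indicator)

lemma set_integral_ivl_combine:
  fixes f :: "real \<Rightarrow> 'b::{banach, second_countable_topology}"
  assumes "a \<le> b" "b \<le> c" "set_integrable lborel {a..c} f"
  shows "(LINT x:{a..c}|lborel. f x) = (LINT x:{a..b}|lborel. f x) + (LINT x:{b..c}|lborel. f x)"
proof -
  have "{a..c} = {a..b} \<union> {b..c}" using assms by auto
  moreover have "AE x in lborel. \<not> (x \<in> {a..b} \<and> x \<in> {b..c})"
    using AE_lborel_singleton[of b] by eventually_elim auto
  ultimately show ?thesis
    using assms by (auto intro!: set_integral_Un_AE intro: set_integrable_subset)
qed

lemma set_integrable_const_ivl:
  "set_integrable lborel {a..b::real} (\<lambda>_. c :: 'b::{banach, second_countable_topology})"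
  unfolding set_integrable_def by (intro integrable_scaleR_left integrable_real_indicator) (auto simp:
      emeasure_lborel_Icc_eq)

lemma iexp_eq_cos_sin: "iexp x = of_real (cos x) + \<i> * of_real (sin x)"
  by (simp only: exp_Euler cos_of_real sin_of_real)

lemma set_integral_inverse_ivl:
  assumes "0 < a" "a \<le> b"
  shows "set_integrable lborel {a..b} (\<lambda>t::real. 1 / t)"
    and "(LINT t:{a..b}|lborel. 1 / t) = ln b - ln a"
proof -
  have "has_bochner_integral lborel (\<lambda>t. 1 / t * indicator {a..b} t) (ln b - ln a)"
    using assms by (intro has_bochner_integral_FTC_Icc_real)
      (auto intro!: derivative_eq_intros continuous_intros)
  then show "set_integrable lborel {a..b} (\<lambda>t::real. 1 / t)"
    and "(LINT t:{a..b}|lborel. 1 / t) = ln b - ln a"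
    by (auto simp: set_integrable_def set_lebesgue_integral_def has_bochner_integral_iff mult.commute)
qed

text \<open>The second mean value theorem is for increasing weights, hence the sign change of
  \<open>g\<close>. It leaves two partial integrals of \<open>f\<close>, weighted by
  \<open>g a\<close> and \<open>g b\<close>, and both weights lie between 0 and
  \<open>g a\<close>.\<close>

lemma abs_integral_antimono_mult_le:
  fixes f g :: "real \<Rightarrow> real"
  assumes f: "f integrable_on {a..b}" and ab: "a \<le> b"
    and g: "\<And>x y. a \<le> x \<Longrightarrow> x \<le> y \<Longrightarrow> y \<le> b \<Longrightarrow> g y \<le> g x" "0 \<le> g b"
    and M: "\<And>c d. a \<le> c \<Longrightarrow> c \<le> d \<Longrightarrow> d \<le> b \<Longrightarrow> \<bar>integral {c..d} f\<bar> \<le> M"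
  shows "\<bar>integral {a..b} (\<lambda>x. g x * f x)\<bar> \<le> 2 * M * g a"
proof -
  obtain c where c: "c \<in> {a..b}" and
    eq: "integral {a..b} (\<lambda>x. - g x * f x) = - g a * integral {a..c} f + - g b * integral {c..b} f"
    using second_mean_value_theorem[OF f ab, of "\<lambda>x. - g x"] g(1) by auto
  have "g b \<le> g a" using g(1)[of a b] ab by simp
  have "\<bar>integral {a..b} (\<lambda>x. g x * f x)\<bar> = \<bar>g a * integral {a..c} f + g b * integral {c..b} f\<bar>"
    using eq by simp
  also have "\<dots> \<le> \<bar>g a * integral {a..c} f\<bar> + \<bar>g b * integral {c..b} f\<bar>" by (rule abs_triangle_ineq)
  also have "\<dots> \<le> g a * M + g a * M"
    unfolding abs_mult using c \<open>g b \<le> g a\<close> g(2) M[of a c] M[of c b]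
    by (intro add_mono mult_mono) auto
  finally show ?thesis by simp
qed

lemma abs_integral_cos_sin_le:
  fixes w c d :: real
  assumes "w \<noteq> 0" "c \<le> d"
  shows "\<bar>integral {c..d} (\<lambda>t. cos (t * w))\<bar> \<le> 2 / \<bar>w\<bar>" "\<bar>integral {c..d} (\<lambda>t. sin (t * w))\<bar> \<le> 2 / \<bar>w\<bar>"
proof -
  have "((\<lambda>t. cos (t * w)) has_integral sin (d * w) / w - sin (c * w) / w) {c..d}"
    by (rule fundamental_theorem_of_calculus[OF assms(2)])
      (use assms in \<open>auto intro!: derivative_eq_intros simp flip:
          has_real_derivative_iff_has_vector_derivative\<close>)
  then have "integral {c..d} (\<lambda>t. cos (t * w)) = (sin (d * w) - sin (c * w)) / w"
    by (simp add: integral_unique diff_divide_distrib)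
  moreover have "\<bar>sin (d * w) - sin (c * w)\<bar> \<le> 2"
    using abs_sin_le_one[of "d * w"] abs_sin_le_one[of "c * w"] by linarith
  ultimately show "\<bar>integral {c..d} (\<lambda>t. cos (t * w))\<bar> \<le> 2 / \<bar>w\<bar>" by (simp add: divide_right_mono)
  have "((\<lambda>t. sin (t * w)) has_integral - cos (d * w) / w - - cos (c * w) / w) {c..d}"
    by (rule fundamental_theorem_of_calculus[OF assms(2)])
      (use assms in \<open>auto intro!: derivative_eq_intros simp flip:
          has_real_derivative_iff_has_vector_derivative\<close>)
  then have "integral {c..d} (\<lambda>t. sin (t * w)) = (cos (c * w) - cos (d * w)) / w"
    by (simp add: integral_unique diff_divide_distrib)
  moreover have "\<bar>cos (c * w) - cos (d * w)\<bar> \<le> 2"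
    using abs_cos_le_one[of "d * w"] abs_cos_le_one[of "c * w"] by linarith
  ultimately show "\<bar>integral {c..d} (\<lambda>t. sin (t * w))\<bar> \<le> 2 / \<bar>w\<bar>" by (simp add: divide_right_mono)
qed

text \<open>The role of \<open>k\<close> is played by a Borel modification of the paper's \<open>K\<close> on the half line, extended by 0;
  beyond \<open>A\<close> it is \<open>K\<close> itself, so that monotonicity survives the modification.\<close>

locale decaying_kernel =
  fixes k :: "real \<Rightarrow> real" and A C D b :: real
  assumes k_borel [measurable]: "k \<in> borel_measurable borel"
    and k_nonneg: "0 \<le> k t"
    and k_neg: "t < 0 \<Longrightarrow> k t = 0"
    and A_ge_1: "1 \<le> A" and C_pos: "0 < C" and D_nonneg: "0 \<le> D" and b_pos: "0 < b"
    and k_integrable_A: "set_integrable lborel {0..A} k"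
    and k_antimono: "A \<le> s \<Longrightarrow> s \<le> t \<Longrightarrow> k t \<le> k s"
    and k_asymp: "A \<le> t \<Longrightarrow> \<bar>t * k t - C\<bar> \<le> D * t powr (- b)"
begin

lemma k_le: "A \<le> t \<Longrightarrow> k t \<le> (C + D) / t"
proof -
  assume t: "A \<le> t"
  have "t powr (- b) \<le> 1" using t A_ge_1 b_pos by (simp add: powr_minus_divide ge_one_powr_ge_zero)
  then have "D * t powr (- b) \<le> D" using D_nonneg by (simp add: mult_left_le)
  then have "t * k t \<le> C + D" using k_asymp[OF t] by linarith
  then show ?thesis using t A_ge_1 by (simp add: pos_le_divide_eq mult.commute)
qed

lemma k_tendsto_0: "(k \<longlongrightarrow> 0) at_top"
proof (rule Lim_null_comparison)
  show "\<forall>\<^sub>F t in at_top. norm (k t) \<le> (C + D) / t"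
    using eventually_ge_at_top[of A] by eventually_elim (simp add: k_nonneg k_le)
  show "((\<lambda>t. (C + D) / t) \<longlongrightarrow> 0) at_top" by real_asymp
qed

lemma k_integrable: "0 \<le> S \<Longrightarrow> set_integrable lborel {S..T} k"
proof -
  assume S: "0 \<le> S"
  have "set_integrable lborel {A..T} k"
  proof (rule set_integrable_bound[where f = "\<lambda>_. k A"])
    show "set_integrable lborel {A..T} (\<lambda>_. k A)" by (rule set_integrable_const_ivl)
  qed (auto simp: k_nonneg k_antimono set_borel_measurable_def)
  then have "set_integrable lborel ({0..A} \<union> {A..T}) k"
    using k_integrable_A by (intro set_integrable_Un) auto
  then show ?thesis using S by (rule_tac set_integrable_subset) auto
qed

lemma k_iexp_integrable: "0 \<le> S \<Longrightarrow> set_integrable lborel {S..T} (\<lambda>t. of_real (k t) * iexp (t * w))"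
  by (rule set_integrable_bound[OF k_integrable[of S T]]) (auto simp: norm_mult set_borel_measurable_def)

text \<open>\<open>KH\<close> is the improper integral \<open>K\<^sub>c\<^sub>o\<^sub>s + \<i> K\<^sub>s\<^sub>i\<^sub>n\<close>, and \<open>KT T\<close> its truncation at \<open>T\<close>. At frequency 0 the
  limit does not exist and the value of \<open>KH\<close> is arbitrary.\<close>

definition KT :: "real \<Rightarrow> real \<Rightarrow> complex" where
  "KT T w = (LINT t:{0..T}|lborel. of_real (k t) * iexp (t * w))"

definition KH :: "real \<Rightarrow> complex" where
  "KH w = lim (\<lambda>n. KT (real n) w)"

lemma KT_borel [measurable]: "KT T \<in> borel_measurable borel"
  unfolding KT_def[abs_def] set_lebesgue_integral_def by measurable

text \<open>The limit in \<open>KH\<close> runs over the integers so that this is a countable limit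
  of Borel functions. \<open>KT_tendsto\<close> recovers the limit over real truncations away from
  frequency 0.\<close>

lemma KH_borel [measurable]: "KH \<in> borel_measurable borel"
  unfolding KH_def[abs_def] by measurable

lemma KT_diff:
  assumes "0 \<le> S" "S \<le> T"
  shows "KT T w - KT S w = (LINT t:{S..T}|lborel. of_real (k t) * iexp (t * w))"
  using set_integral_ivl_combine[OF assms k_iexp_integrable] by (simp add: KT_def)

text \<open>The constant is \<open>2 * 2 * 2\<close>: cosine and sine parts, two endpoint terms of
  the mean value theorem, and the bound \<open>2 / \<bar>w\<bar>\<close> for integrals of cosine and
  sine. That \<open>T\<close> does not enter yields convergence as well as the tail
  estimate.\<close>

lemma norm_KT_diff_le:
  assumes S: "A \<le> S" and T: "S \<le> T" and w: "w \<noteq> 0"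
  shows "cmod (KT T w - KT S w) \<le> 8 * k S / \<bar>w\<bar>"
proof -
  have S0: "0 \<le> S" using S A_ge_1 by simp
  have int: "set_integrable lborel {S..T} (\<lambda>t. k t * cos (t * w))"
     "set_integrable lborel {S..T} (\<lambda>t. k t * sin (t * w))"
    by (rule set_integrable_bound[OF k_integrable[OF S0, of T]];
        auto simp: abs_mult k_nonneg set_borel_measurable_def intro!: mult_left_le)+
  have bound: "\<bar>LINT t:{S..T}|lborel. k t * f t\<bar> \<le> 4 * k S / \<bar>w\<bar>"
    if f: "f integrable_on {S..T}" "set_integrable lborel {S..T} (\<lambda>t. k t * f t)"
      and M: "\<And>c d. c \<le> d \<Longrightarrow> \<bar>integral {c..d} f\<bar> \<le> 2 / \<bar>w\<bar>" for f :: "real \<Rightarrow> real"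
  proof -
    have "\<bar>integral {S..T} (\<lambda>t. k t * f t)\<bar> \<le> 2 * (2 / \<bar>w\<bar>) * k S"
      using S T by (intro abs_integral_antimono_mult_le f M) (auto simp: k_antimono k_nonneg)
    then show ?thesis by (simp add: set_borel_integral_eq_integral(2)[OF f(2)])
  qed
  have cs: "\<bar>LINT t:{S..T}|lborel. k t * cos (t * w)\<bar> \<le> 4 * k S / \<bar>w\<bar>"
     "\<bar>LINT t:{S..T}|lborel. k t * sin (t * w)\<bar> \<le> 4 * k S / \<bar>w\<bar>"
    by (intro bound int abs_integral_cos_sin_le[OF w] integrable_continuous_interval continuous_intros; simp)+
  have "KT T w - KT S w = (LINT t:{S..T}|lborel. of_real (k t) * iexp (t * w))"
    by (rule KT_diff[OF S0 T])
  also have "\<dots> = (LINT t:{S..T}|lborel. complex_of_real (k t * cos (t * w))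
      + \<i> * complex_of_real (k t * sin (t * w)))"
    by (intro set_lebesgue_integral_cong) (simp_all only: iexp_eq_cos_sin, simp_all add: algebra_simps)
  also have "\<dots> = (LINT t:{S..T}|lborel. complex_of_real (k t * cos (t * w)))
      + (LINT t:{S..T}|lborel. \<i> * complex_of_real (k t * sin (t * w)))"
  proof (rule set_integral_add(2))
    show "set_integrable lborel {S..T} (\<lambda>t. complex_of_real (k t * cos (t * w)))"
      "set_integrable lborel {S..T} (\<lambda>t. \<i> * complex_of_real (k t * sin (t * w)))"
      by (rule set_integrable_bound[OF int(1)], auto simp: set_borel_measurable_def norm_mult abs_mult)
         (rule set_integrable_bound[OF int(2)], auto simp: set_borel_measurable_def norm_mult abs_mult)
  qed
  also have "\<dots> = complex_of_real (LINT t:{S..T}|lborel. k t * cos (t * w))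
      + \<i> * complex_of_real (LINT t:{S..T}|lborel. k t * sin (t * w))"
    by (simp only: set_integral_complex_of_real set_integral_mult_right)
  finally show ?thesis
    using cs norm_triangle_le[of "complex_of_real (LINT t:{S..T}|lborel. k t * cos (t * w))" "\<i> *
        complex_of_real (LINT t:{S..T}|lborel. k t * sin (t * w))" "8 * k S / \<bar>w\<bar>"]
    by (simp add: norm_mult)
qed

lemma KT_tendsto_seq:
  assumes w: "w \<noteq> 0" shows "(\<lambda>n. KT (real n) w) \<longlonglongrightarrow> KH w"
proof -
  have "Cauchy (\<lambda>n. KT (real n) w)"
  proof (rule CauchyI')
    fix e :: real assume e: "0 < e"
    have "((\<lambda>t. 8 * k t / \<bar>w\<bar>) \<longlongrightarrow> 8 * 0 / \<bar>w\<bar>) at_top"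
      using w by (intro tendsto_intros k_tendsto_0) auto
    then have "\<forall>\<^sub>F n in sequentially. 8 * k (real n) / \<bar>w\<bar> < e"
      using e by (auto simp: filterlim_real_sequentially intro: order_tendstoD eventually_compose_filterlim)
    moreover have "\<forall>\<^sub>F n in sequentially. A \<le> real n"
      using filterlim_real_sequentially by (simp add: filterlim_at_top)
    ultimately have "\<forall>\<^sub>F n in sequentially. 8 * k (real n) / \<bar>w\<bar> < e \<and> A \<le> real n"
      by eventually_elim simp
    then obtain N where N: "\<And>n. n \<ge> N \<Longrightarrow> 8 * k (real n) / \<bar>w\<bar> < e \<and> A \<le> real n"
      by (auto simp: eventually_sequentially)
    have "dist (KT (real m) w) (KT (real n) w) < e" if "m \<ge> N" "n > m" for m n
      using N[OF that(1)] norm_KT_diff_le[of "real m" "real n", OF _ _ w] that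
      by (simp add: dist_norm norm_minus_commute)
    then show "\<exists>M. \<forall>m\<ge>M. \<forall>n>m. dist (KT (real m) w) (KT (real n) w) < e" by blast
  qed
  then show ?thesis unfolding KH_def by (metis Cauchy_convergent convergent_LIMSEQ_iff)
qed

lemma norm_KH_KT_le:
  assumes "A \<le> S" "w \<noteq> 0"
  shows "cmod (KH w - KT S w) \<le> 8 * k S / \<bar>w\<bar>"
proof (rule LIMSEQ_le_const2)
  show "(\<lambda>n. cmod (KT (real n) w - KT S w)) \<longlonglongrightarrow> cmod (KH w - KT S w)"
    by (intro tendsto_intros KT_tendsto_seq assms)
  obtain N where "S \<le> real N" using real_arch_simple by blast
  then show "\<exists>N. \<forall>n\<ge>N. cmod (KT (real n) w - KT S w) \<le> 8 * k S / \<bar>w\<bar>"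
    using assms by (intro exI[of _ N]) (auto intro!: norm_KT_diff_le intro: order_trans)
qed

lemma KT_tendsto:
  assumes w: "w \<noteq> 0" shows "((\<lambda>T. KT T w) \<longlongrightarrow> KH w) at_top"
proof -
  have "((\<lambda>T. KT T w - KH w) \<longlongrightarrow> 0) at_top"
  proof (rule Lim_null_comparison)
    show "\<forall>\<^sub>F T in at_top. norm (KT T w - KH w) \<le> 8 * k T / \<bar>w\<bar>"
      using eventually_ge_at_top[of A]
      by eventually_elim (use norm_KH_KT_le[OF _ w] in \<open>simp add: norm_minus_commute\<close>)
    have "((\<lambda>t. 8 * k t / \<bar>w\<bar>) \<longlongrightarrow> 8 * 0 / \<bar>w\<bar>) at_top"
      using w by (intro tendsto_intros k_tendsto_0) auto
    then show "((\<lambda>t. 8 * k t / \<bar>w\<bar>) \<longlongrightarrow> 0) at_top" by simp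
  qed
  then show ?thesis by (simp add: LIM_zero_iff)
qed

lemma KT_uminus: "KT T (- w) = cnj (KT T w)"
proof -
  have "cnj (KT T w) = (LINT t:{0..T}|lborel. cnj (of_real (k t) * iexp (t * w)))"
    unfolding KT_def set_lebesgue_integral_def
    by (subst Bochner_Integration.integral_cnj[symmetric]) simp
  then show ?thesis by (simp add: KT_def exp_cnj)
qed

lemma KH_uminus: "KH (- w) = cnj (KH w)" if "w \<noteq> 0"
proof (rule LIMSEQ_unique)
  show "(\<lambda>n. KT (real n) (- w)) \<longlonglongrightarrow> KH (- w)" using that by (intro KT_tendsto_seq) simp
  show "(\<lambda>n. KT (real n) (- w)) \<longlonglongrightarrow> cnj (KH w)"
    unfolding KT_uminus by (intro tendsto_cnj KT_tendsto_seq that)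
qed

definition KI :: real where "KI = (LINT t:{0..A}|lborel. k t)"

lemma integral_k_le:
  assumes "A \<le> S" shows "(LINT t:{0..S}|lborel. k t) \<le> KI + (C + D) * ln S"
proof -
  have S: "0 \<le> A" "0 < A" using A_ge_1 by auto
  have "(LINT t:{0..S}|lborel. k t) = KI + (LINT t:{A..S}|lborel. k t)"
    unfolding KI_def using set_integral_ivl_combine[OF S(1) assms k_integrable] by simp
  moreover have "(LINT t:{A..S}|lborel. k t) \<le> (LINT t:{A..S}|lborel. (C + D) * (1 / t))"
    using k_le S assms by (intro set_integral_mono k_integrable set_integrable_mult_right
        set_integral_inverse_ivl) auto
  moreover have "\<dots> = (C + D) * (ln S - ln A)"
    using set_integral_inverse_ivl(2)[OF S(2) assms] by (simp only: set_integral_mult_right)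
  moreover have "\<dots> \<le> (C + D) * ln S" using A_ge_1 C_pos D_nonneg by (intro mult_left_mono) auto
  ultimately show ?thesis by linarith
qed

lemma norm_KT_le_integral: "cmod (KT T w) \<le> (LINT t:{0..T}|lborel. k t)"
  unfolding KT_def
  by (rule norm_set_integral_le[OF k_iexp_integrable k_integrable]) (auto simp: norm_mult k_nonneg)

text \<open>The non-singular part of the bound below: the mass \<open>KI\<close> on
  \<open>[0, A]\<close>, a term \<open>(C + D) * ln A\<close> from the logarithmic growth, and
  \<open>8 * (C + D)\<close> from the oscillating tail.\<close>

definition KB :: real where "KB = KI + (C + D) * (ln A + 8)"

lemma KI_nonneg: "0 \<le> KI"
  unfolding KI_def set_lebesgue_integral_def
      by (intro Bochner_Integration.integral_nonneg) (auto simp: k_nonneg split: split_indicator)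

lemma KB_nonneg: "0 \<le> KB"
  unfolding KB_def using KI_nonneg A_ge_1 C_pos D_nonneg by (intro add_nonneg_nonneg mult_nonneg_nonneg) auto

text \<open>The cut is at one wavelength, \<open>S = max A (1 / \<bar>w\<bar>)\<close>. Before
  \<open>S\<close> the phase is ignored and the mass grows like \<open>ln S\<close>; beyond
  \<open>S\<close> the mean value bound is \<open>O(1)\<close> because
  \<open>k S \<le> (C + D) / S\<close>. Replacing the logarithm by an inverse square root gives one
  formula for all \<open>w \<noteq> 0\<close>, uniform in \<open>T\<close>.\<close>

lemma norm_KT_le:
  assumes "w \<noteq> 0" shows "cmod (KT T w) \<le> KB + 2 * (C + D) / sqrt \<bar>w\<bar>"
proof -
  define S where "S = max A (1 / \<bar>w\<bar>)"
  have S: "A \<le> S" "1 / \<bar>w\<bar> \<le> S" "0 < S" using A_ge_1 by (auto simp: S_def)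
  have "ln (1 / \<bar>w\<bar>) \<le> 2 / sqrt \<bar>w\<bar>"
  proof -
    have "ln (1 / \<bar>w\<bar>) = 2 * ln (1 / sqrt \<bar>w\<bar>)"
      using assms by (simp add: ln_div ln_sqrt)
    also have "\<dots> \<le> 2 * (1 / sqrt \<bar>w\<bar>)" using assms ln_bound[of "1 / sqrt \<bar>w\<bar>"] by simp
    finally show ?thesis by simp
  qed
  then have lnS: "ln S \<le> ln A + 2 / sqrt \<bar>w\<bar>"
    unfolding S_def using A_ge_1 by (auto simp: max_def intro: add_increasing add_increasing2)
  have IS: "(LINT t:{0..S}|lborel. k t) \<le> KI + (C + D) * (ln A + 2 / sqrt \<bar>w\<bar>)"
    using integral_k_le[OF S(1)] mult_left_mono[OF lnS, of "C + D"] C_pos D_nonneg by linarith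
  have P: "8 * k S / \<bar>w\<bar> \<le> 8 * (C + D)"
  proof -
    have "k S * (1 / \<bar>w\<bar>) \<le> ((C + D) / S) * S"
      using k_le[OF S(1)] S C_pos D_nonneg by (intro mult_mono) (auto simp: k_nonneg)
    then show ?thesis using S by simp
  qed
  have "cmod (KT T w) \<le> (LINT t:{0..S}|lborel. k t) + 8 * (C + D)"
  proof (cases "T \<le> S")
    case True
    have "(LINT t:{0..T}|lborel. k t) \<le> (LINT t:{0..S}|lborel. k t)"
      unfolding set_lebesgue_integral_def
      using k_integrable[of 0] True
      by (intro integral_mono) (auto simp: set_integrable_def k_nonneg split: split_indicator)
    then have "cmod (KT T w) \<le> (LINT t:{0..S}|lborel. k t)"
      by (rule order_trans[OF norm_KT_le_integral])
    then show ?thesis using C_pos D_nonneg by (intro add_increasing2) auto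
  next
    case False
    then have "cmod (KT T w - KT S w) \<le> 8 * k S / \<bar>w\<bar>" using S assms by (intro norm_KT_diff_le) auto
    then show ?thesis using norm_triangle_sub[of "KT T w" "KT S w"] norm_KT_le_integral[of S w] P by linarith
  qed
  then show ?thesis using IS unfolding KB_def by (simp add: algebra_simps)
qed

lemma norm_KH_le:
  assumes "w \<noteq> 0" shows "cmod (KH w) \<le> KB + 2 * (C + D) / sqrt \<bar>w\<bar>"
  by (rule LIMSEQ_le_const2[OF tendsto_norm[OF KT_tendsto_seq[OF assms]]]) (use norm_KT_le[OF assms] in auto)

lemma KH_log_asymp:
  obtains B where "B > 0" "\<And>w. w \<noteq> 0 \<Longrightarrow> \<bar>w\<bar> \<le> 1 / A \<Longrightarrow> cmod (KH w - of_real (C * ln (1 / \<bar>w\<bar>))) \<le> B"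
proof
  \<comment> \<open>\<open>KI\<close> is for \<open>[0, A]\<close>, \<open>C * ln A\<close> for the
    lower end of the logarithmic integral, \<open>8 * (C + D)\<close> for the tail beyond
    \<open>S\<close>, another \<open>C + D\<close> for the phase on \<open>[A, S]\<close>, and
    \<open>D / b\<close> for the deviation of \<open>k\<close> from \<open>C / t\<close>.\<close>
  let ?B = "KI + C * ln A + 9 * (C + D) + D / b"
  have "0 \<le> C * ln A" "0 \<le> D / b" using C_pos A_ge_1 D_nonneg b_pos by simp_all
  then show "0 < ?B" using KI_nonneg C_pos D_nonneg
    by (intro add_pos_nonneg[OF add_nonneg_pos]) auto
  fix w :: real assume w: "w \<noteq> 0" "\<bar>w\<bar> \<le> 1 / A"
  define S where "S = 1 / \<bar>w\<bar>"
  have S: "A \<le> S" "0 < S" "0 < A" "0 \<le> A" "S * \<bar>w\<bar> = 1" using w A_ge_1 by (auto simp: S_def field_simps)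
  let ?e = "\<lambda>t. complex_of_real (k t) * iexp (t * w) - of_real (k t)"
  have i1: "set_integrable lborel {A..S} (\<lambda>t. of_real (k t) * iexp (t * w))"
      by (rule k_iexp_integrable[OF S(4)])
  have ik: "set_integrable lborel {A..S} k" by (rule k_integrable[OF S(4)])
  have i2: "set_integrable lborel {A..S} (\<lambda>t. complex_of_real (k t))"
    by (rule set_integrable_bound[OF ik]) (auto simp: set_borel_measurable_def)
  have i3: "set_integrable lborel {A..S} (\<lambda>t. C * (1 / t))"
    using set_integral_inverse_ivl(1)[OF S(3,1)] by (rule set_integrable_mult_right) 
  have "KT S w = KT A w + (LINT t:{A..S}|lborel. of_real (k t) * iexp (t * w))"
    using KT_diff[OF S(4,1), of w] by (simp add: algebra_simps)
  also have "(LINT t:{A..S}|lborel. of_real (k t) * iexp (t * w))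
    = (LINT t:{A..S}|lborel. ?e t) + of_real (LINT t:{A..S}|lborel. k t)"
    by (subst set_integral_diff(2)[OF i1 i2]) (simp add: set_integral_complex_of_real)
  also have "(LINT t:{A..S}|lborel. k t) = (LINT t:{A..S}|lborel. k t - C * (1 / t)) + C * (ln S - ln A)"
    by (subst set_integral_diff(2)[OF ik i3])
       (simp only: set_integral_mult_right set_integral_inverse_ivl(2)[OF S(3,1)] diff_add_cancel)
  finally have decomp: "KH w - of_real (C * ln S) = (KH w - KT S w) + KT A w
     + (LINT t:{A..S}|lborel. ?e t)
     + of_real (LINT t:{A..S}|lborel. k t - C * (1 / t)) - of_real (C * ln A)"
    by (simp add: algebra_simps)
  have n1: "cmod (KH w - KT S w) \<le> 8 * (C + D)"
  proof -
    have "8 * k S / \<bar>w\<bar> = 8 * (k S * S)" using w by (simp add: S_def)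
    also have "k S * S \<le> C + D" using k_le[OF S(1)] S(2) by (simp add: pos_le_divide_eq)
    finally show ?thesis using norm_KH_KT_le[OF S(1) w(1)] by linarith
  qed
  have n2: "cmod (KT A w) \<le> KI" using norm_KT_le_integral[of A w] by (simp add: KI_def)
  \<comment> \<open>The bound \<open>t * \<bar>w\<bar>\<close> for the phase error cancels the decay
    \<open>1 / t\<close> of \<open>k\<close>; the remaining constant
    \<open>(C + D) * \<bar>w\<bar>\<close> is integrated over a length of at most
    \<open>S = 1 / \<bar>w\<bar>\<close>.\<close>
  have n3: "cmod (LINT t:{A..S}|lborel. ?e t) \<le> C + D"
  proof -
    have "cmod (LINT t:{A..S}|lborel. ?e t) \<le> (LINT t:{A..S}|lborel. (C + D) * \<bar>w\<bar>)"
    proof (rule norm_set_integral_le)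
      show "set_integrable lborel {A..S} ?e"
        by (rule set_integral_diff(1)[OF i1 i2])
      show "set_integrable lborel {A..S} (\<lambda>t. (C + D) * \<bar>w\<bar>)" by (rule set_integrable_const_ivl)
      fix t assume t: "t \<in> {A..S}"
      have "cmod (of_real (k t) * iexp (t * w) - of_real (k t)) = k t * cmod (iexp (t * w) - 1)"
      proof -
        have "of_real (k t) * iexp (t * w) - of_real (k t) = of_real (k t) * (iexp (t * w) - 1)"
            by (simp add: algebra_simps)
        then show ?thesis by (simp only: norm_mult norm_of_real) (simp add: k_nonneg)
      qed
      also have "\<dots> \<le> ((C + D) / t) * (t * \<bar>w\<bar>)"
        using k_le[of t] t S iexp_approx1[of "t * w" 0] C_pos D_nonneg
        by (intro mult_mono) (auto simp: abs_mult)
      also have "\<dots> = (C + D) * \<bar>w\<bar>" using t S by simp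
      finally show "cmod (of_real (k t) * iexp (t * w) - of_real (k t)) \<le> (C + D) * \<bar>w\<bar>" .
    qed
    also have "\<dots> = (S - A) * ((C + D) * \<bar>w\<bar>)" using S by (subst set_integral_const) auto
    also have "\<dots> \<le> S * ((C + D) * \<bar>w\<bar>)" using S C_pos D_nonneg by (intro mult_right_mono) auto
    also have "\<dots> = (C + D) * (S * \<bar>w\<bar>)" by simp
    finally show ?thesis by (simp only: S mult_1_right)
  qed
  \<comment> \<open>Here the rate of convergence of \<open>t * k t\<close> enters: a power
    \<open>b > 0\<close> makes \<open>k t - C / t\<close> integrable at infinity, so the error stays
    bounded as \<open>S\<close> grows.\<close>
  have n4: "\<bar>LINT t:{A..S}|lborel. k t - C * (1 / t)\<bar> \<le> D / b"
  proof -
    have hb: "has_bochner_integral lborel (\<lambda>t. D * t powr (- b - 1) * indicator {A..S} t)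
       ((- D / b * S powr (- b)) - (- D / b * A powr (- b)))"
      using S b_pos
      by (intro has_bochner_integral_FTC_Icc_real) (auto intro!: derivative_eq_intros continuous_intros)
    have "norm (LINT t:{A..S}|lborel. k t - C * (1 / t)) \<le> (LINT t:{A..S}|lborel. D * t powr (- b - 1))"
    proof (rule norm_set_integral_le)
      show "set_integrable lborel {A..S} (\<lambda>t. k t - C * (1 / t))" by (rule set_integral_diff(1)[OF ik i3])
      show "set_integrable lborel {A..S} (\<lambda>t. D * t powr (- b - 1))"
        using hb by (auto simp: set_integrable_def has_bochner_integral_iff mult.commute)
      fix t assume t: "t \<in> {A..S}"
      have "\<bar>t * k t - C\<bar> / t \<le> D * t powr (- b) / t" using t S k_asymp[of t] by (intro divide_right_mono) auto
      moreover have "\<bar>t * k t - C\<bar> / t = \<bar>k t - C * (1 / t)\<bar>"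
      proof -
        have "t > 0" using t S by auto
        then have "\<bar>t * k t - C\<bar> / t = \<bar>(t * k t - C) / t\<bar>" by (simp add: abs_divide)
        also have "(t * k t - C) / t = k t - C * (1 / t)" using \<open>t > 0\<close> by (simp add: diff_divide_distrib)
        finally show ?thesis .
      qed
      ultimately show "norm (k t - C * (1 / t)) \<le> D * t powr (- b - 1)"
        using t S by (simp add: powr_diff)
    qed
    also have "\<dots> = (- D / b * S powr (- b)) - (- D / b * A powr (- b))"
      using has_bochner_integral_integral_eq[OF hb]
      by (simp only: set_lebesgue_integral_def real_scaleR_def mult.commute)
    also have "\<dots> \<le> D / b * A powr (- b)" using D_nonneg b_pos by simp
    also have "\<dots> \<le> D / b * 1"
      using D_nonneg b_pos A_ge_1 by (intro mult_left_mono) (auto simp: powr_minus_divide ge_one_powr_ge_zero)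
    finally show ?thesis by simp
  qed
  have n5: "cmod (of_real (C * ln A)) = C * ln A" using C_pos A_ge_1 by (simp add: norm_mult)
  have tri: "cmod (x1 + x2 + x3 + x4 - x5) \<le> cmod x1 + cmod x2 + cmod x3 + cmod x4 + cmod x5" for x1 x2 x3 x4 x5
    by (smt (verit) norm_triangle_ineq norm_triangle_ineq4)
  have "cmod (KH w - of_real (C * ln S)) \<le> 8 * (C + D) + KI + (C + D) + D / b + C * ln A"
    unfolding decomp by (rule order_trans[OF tri]) (use n1 n2 n3 n4 n5 in simp)
  then show "cmod (KH w - of_real (C * ln (1 / \<bar>w\<bar>))) \<le> ?B"
    by (simp add: S_def)
qed

end

section \<open>Integrability of weights with an inverse square root singularity\<close>

lemma integrable_lborel_if_nonneg_has_integral: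
  fixes f :: "real \<Rightarrow> real"
  assumes [measurable]: "f \<in> borel_measurable borel" "S \<in> sets borel"
    and "\<And>x. x \<in> S \<Longrightarrow> 0 \<le> f x" "f integrable_on S"
  shows "set_integrable lborel S f"
proof -
  have "set_integrable lebesgue S f"
    using assms(3,4) by (intro nonnegative_absolutely_integrable_1)
  then show ?thesis
    unfolding set_integrable_def by (rule integrable_completion[THEN iffD1, rotated]) measurable
qed

lemma integrable_even_extension:
  fixes f :: "real \<Rightarrow> real"
  assumes S: "set_integrable lborel S f" "S \<subseteq> {0..}" "S \<in> sets borel"
    and [measurable]: "f \<in> borel_measurable borel"
  shows "integrable lborel (\<lambda>x. indicator S \<bar>x\<bar> * f \<bar>x\<bar>)"
proof -
  let ?g = "\<lambda>x. indicator S x * f x"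
  note [measurable] = S(3)
  have 1: "integrable lborel ?g" using S(1) by (simp add: set_integrable_def)
  have 2: "integrable lborel (\<lambda>x. ?g (0 + (-1) * x))"
    by (rule lborel_integrable_real_affine[OF 1]) simp
  show ?thesis
  proof (rule Bochner_Integration.integrable_bound[OF Bochner_Integration.integrable_add[OF
      integrable_norm[OF 1] integrable_norm[OF 2]]])
    show "AE x in lborel. norm (indicator S \<bar>x\<bar> * f \<bar>x\<bar>) \<le> norm (norm (?g x) + norm (?g (0 + (-1) * x)))"
      by (auto simp: abs_if)
  qed measurable
qed

text \<open>This is the majorant that \<open>norm_KT_le\<close> yields against a function of Cauchy
  decay; it dominates all truncations in \<open>KH_pairing\<close>.\<close>

lemma integrable_inverse_sqrt_cauchy:
  "integrable lborel (\<lambda>w::real. (B + B' / sqrt \<bar>w\<bar>) * (c / (1 + w\<^sup>2)))"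
proof -
  have "set_integrable lborel {0..1::real} (\<lambda>x. x powr (- 1 / 2))"
    by (rule integrable_lborel_if_nonneg_has_integral) (auto intro: integrable_on_powr_from_0)
  then have "integrable lborel (\<lambda>x::real. indicator {0..1} \<bar>x\<bar> * \<bar>x\<bar> powr (- 1 / 2))"
    by (rule integrable_even_extension) auto
  then have i: "integrable lborel (\<lambda>x::real. 1 / (1 + x\<^sup>2) + indicator {0..1} \<bar>x\<bar> * \<bar>x\<bar> powr (- 1 / 2))"
    by (intro Bochner_Integration.integrable_add integrable_cauchy)
  have "integrable lborel (\<lambda>w::real. 1 / sqrt \<bar>w\<bar> * (1 / (1 + w\<^sup>2)))"
  proof (rule Bochner_Integration.integrable_bound[OF i])
    show "AE w in lborel. norm (1 / sqrt \<bar>w\<bar> * (1 / (1 + w\<^sup>2)))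
        \<le> norm (1 / (1 + w\<^sup>2) + indicator {0..1} \<bar>w\<bar> * \<bar>w\<bar> powr (- 1 / 2))" for w :: real
    proof (rule AE_I2)
      fix w :: real
      have p: "0 < 1 + w\<^sup>2" by (simp add: add_pos_nonneg)
      have "1 / sqrt \<bar>w\<bar> * (1 / (1 + w\<^sup>2)) \<le> 1 / (1 + w\<^sup>2) + indicator {0..1} \<bar>w\<bar> * \<bar>w\<bar> powr (- 1 / 2)"
      proof (cases "\<bar>w\<bar> \<le> 1")
        case True
        have "1 / sqrt \<bar>w\<bar> * (1 / (1 + w\<^sup>2)) \<le> 1 / sqrt \<bar>w\<bar> * 1"
          by (intro mult_left_mono) (auto simp: p)
        moreover have "\<bar>w\<bar> powr (- 1 / 2) = 1 / sqrt \<bar>w\<bar>"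
          by (cases "w = 0") (auto simp: powr_minus_divide powr_half_sqrt)
        ultimately show ?thesis using True p by (simp add: add_increasing)
      next
        case False
        then have "1 / sqrt \<bar>w\<bar> * (1 / (1 + w\<^sup>2)) \<le> 1 * (1 / (1 + w\<^sup>2))"
          using p by (intro mult_right_mono) auto
        then show ?thesis using False by simp
      qed
      moreover have "0 \<le> 1 / sqrt \<bar>w\<bar> * (1 / (1 + w\<^sup>2))" using p by simp
      ultimately show "norm (1 / sqrt \<bar>w\<bar> * (1 / (1 + w\<^sup>2)))
        \<le> norm (1 / (1 + w\<^sup>2) + indicator {0..1} \<bar>w\<bar> * \<bar>w\<bar> powr (- 1 / 2))" by simp
    qed
  qed measurable
  from integrable_mult_right[OF this, of "B' * c"]
  have "integrable lborel (\<lambda>w::real. B * c / (1 + w\<^sup>2) + (B' * c) * (1 / sqrt \<bar>w\<bar> * (1 / (1 + w\<^sup>2))))"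
    by (intro Bochner_Integration.integrable_add integrable_cauchy)
  moreover have "B * c / (1 + w\<^sup>2) + (B' * c) * (1 / sqrt \<bar>w\<bar> * (1 / (1 + w\<^sup>2)))
     = (B + B' / sqrt \<bar>w\<bar>) * (c / (1 + w\<^sup>2))" for w :: real
    by (simp add: distrib_right add_divide_distrib)
  ultimately show ?thesis by (simp only:)
qed

section \<open>Pairing the transform of the kernel with test functions\<close>

context decaying_kernel
begin

lemma KT_pairing:
  assumes \<Psi>: "integrable lborel \<Psi>"
  shows "(LINT u:{0..T}|lborel. of_real (k u) * (LINT w|lborel. iexp (u * w) * \<Psi> w))
       = (LINT w|lborel. KT T w * \<Psi> w)"
proof -
  have [measurable]: "\<Psi> \<in> borel_measurable borel" using \<Psi> by auto
  let ?f = "\<lambda>u w. indicator {0..T} u *\<^sub>R (of_real (k u) * (iexp (u * w) * \<Psi> w))"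
  have i: "integrable (lborel \<Otimes>\<^sub>M lborel) (\<lambda>(u, w). ?f u w)"
  proof (rule lborel_pair.Fubini_integrable)
    have "integrable lborel (\<lambda>u. (indicator {0..T} u * k u) * (LINT w|lborel. cmod (\<Psi> w)))"
      using k_integrable[of 0 T] by (intro integrable_mult_left) (simp add: set_integrable_def)
    also have "(\<lambda>u. (indicator {0..T} u * k u) * (LINT w|lborel. cmod (\<Psi> w)))
       = (\<lambda>u. LINT w|lborel. norm (case (u, w) of (u, w) \<Rightarrow> ?f u w))"
      by (rule ext) (simp add: norm_mult k_nonneg mult.assoc)
    finally show "integrable lborel (\<lambda>u. LINT w|lborel. norm (case (u, w) of (u, w) \<Rightarrow> ?f u w))" .
    show "AE u in lborel. integrable lborel (\<lambda>w. case (u, w) of (u, w) \<Rightarrow> ?f u w)"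
      using integrable_iexp_mult(1)[OF \<Psi>] by simp
  qed simp
  have "(LINT u:{0..T}|lborel. of_real (k u) * (LINT w|lborel. iexp (u * w) * \<Psi> w))
     = (LINT u|lborel. LINT w|lborel. ?f u w)"
    by (simp only: set_lebesgue_integral_def integral_mult_right_zero integral_scaleR_right)
  also have "\<dots> = (LINT w|lborel. LINT u|lborel. ?f u w)"
    by (rule lborel_pair.Fubini_integral[OF i, symmetric])
  also have "\<dots> = (LINT w|lborel. LINT u|lborel. (indicator {0..T} u *\<^sub>R (of_real (k u) * iexp (u * w))) * \<Psi> w)"
    by (simp add: mult_ac)
  also have "\<dots> = (LINT w|lborel. KT T w * \<Psi> w)"
    by (simp only: integral_mult_left_zero KT_def set_lebesgue_integral_def)
  finally show ?thesis .
qed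

text \<open>On \<open>[0, A]\<close> the kernel may be unbounded but is integrable, while the weight
  is bounded; beyond \<open>A\<close> the kernel is at most \<open>k A\<close> and the weight is
  integrable.\<close>

lemma k_cauchy_integrable: "integrable lborel (\<lambda>u. k u * (c / (1 + u\<^sup>2)))"
proof -
  have 1: "integrable lborel (\<lambda>u. indicator {0..A} u * k u * \<bar>c\<bar>)"
    using k_integrable_A by (intro integrable_mult_left) (simp add: set_integrable_def)
  have 2: "integrable lborel (\<lambda>u. k A * \<bar>c\<bar> / (1 + u\<^sup>2))" by (rule integrable_cauchy)
  show ?thesis
  proof (rule Bochner_Integration.integrable_bound[OF Bochner_Integration.integrable_add[OF 1 2]])
    show "AE u in lborel. norm (k u * (c / (1 + u\<^sup>2))) \<le> norm (indicator {0..A} u * k u * \<bar>c\<bar>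
        + k A * \<bar>c\<bar> / (1 + u\<^sup>2))"
    proof (rule AE_I2)
      fix u :: real
      have p: "0 < 1 + u\<^sup>2" by (simp add: add_pos_nonneg)
      have n: "norm (k u * (c / (1 + u\<^sup>2))) = k u * (\<bar>c\<bar> / (1 + u\<^sup>2))"
        using p by (simp add: abs_mult k_nonneg)
      have "k u * (\<bar>c\<bar> / (1 + u\<^sup>2)) \<le> indicator {0..A} u * k u * \<bar>c\<bar> + k A * \<bar>c\<bar> / (1 + u\<^sup>2)"
      proof (cases "u \<in> {0..A}")
        case True
        have "k u * (\<bar>c\<bar> / (1 + u\<^sup>2)) \<le> k u * \<bar>c\<bar>"
          using p by (intro mult_left_mono) (auto simp: k_nonneg divide_le_eq mult_le_cancel_left1)
        then show ?thesis using True p by (simp add: k_nonneg add_increasing2)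
      next
        case False
        have "k u \<le> k A" using False k_neg[of u] k_antimono[of A u] k_nonneg[of A] by (cases "u < 0") auto
        then have "k u * (\<bar>c\<bar> / (1 + u\<^sup>2)) \<le> k A * (\<bar>c\<bar> / (1 + u\<^sup>2))"
          using p by (intro mult_right_mono) auto
        then show ?thesis using False by simp
      qed
      then show "norm (k u * (c / (1 + u\<^sup>2))) \<le> norm (indicator {0..A} u * k u * \<bar>c\<bar> + k A * \<bar>c\<bar> / (1 + u\<^sup>2))"
        unfolding n unfolding real_norm_def by (rule order_trans[OF _ abs_ge_self])
    qed
  qed measurable
qed

lemma KH_mult_integrable:
  assumes [measurable]: "\<Psi> \<in> borel_measurable borel" and \<Psi>: "\<And>w. cmod (\<Psi> w) \<le> c / (1 + w\<^sup>2)"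
  shows "integrable lborel (\<lambda>w. KH w * \<Psi> w)"
proof (rule Bochner_Integration.integrable_bound[OF integrable_inverse_sqrt_cauchy])
  show "AE w in lborel. norm (KH w * \<Psi> w) \<le> norm ((KB + (2 * (C + D)) / sqrt \<bar>w\<bar>) * (c / (1 + w\<^sup>2)))"
    using AE_lborel_singleton[of 0]
  proof eventually_elim
    case (elim w)
    have "norm (KH w * \<Psi> w) \<le> (KB + (2 * (C + D)) / sqrt \<bar>w\<bar>) * (c / (1 + w\<^sup>2))"
      unfolding norm_mult using norm_KH_le[OF elim] \<Psi>[of w] order_trans[OF norm_ge_zero norm_KH_le[OF elim]]
      by (intro mult_mono) auto
    then show ?case unfolding real_norm_def by (rule order_trans[OF _ abs_ge_self])
  qed
qed measurable

text \<open>The improper integral \<open>\<integral>\<^sub>0\<^sup>\<infinity> k G\<close> is a limit of absolutely convergent truncations, for which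
  Fubini applies; the bound \<open>O(1 + |w|\<^sup>-\<^sup>1\<^sup>/\<^sup>2)\<close>, uniform in the truncation, dominates the other side.\<close>

lemma KH_pairing:
  assumes [measurable]: "\<Psi> \<in> borel_measurable borel" and \<Psi>: "\<And>w. cmod (\<Psi> w) \<le> c / (1 + w\<^sup>2)"
    and G: "\<And>u. G u = (LINT w|lborel. iexp (u * w) * \<Psi> w)" and G': "\<And>u. cmod (G u) \<le> c' / (1 + u\<^sup>2)"
  shows "(LINT u|lborel. of_real (k u) * G u) = (LINT w|lborel. KH w * \<Psi> w)"
proof (rule tendsto_unique[OF trivial_limit_sequentially])
  have \<Psi>_int: "integrable lborel \<Psi>" by (rule integrable_cauchy_bound[OF assms(1) \<Psi>])
  have [measurable]: "G \<in> borel_measurable borel" unfolding G by measurable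
  have eq: "(LINT u|lborel. indicator {0..real n} u *\<^sub>R (of_real (k u) * G u))
      = (LINT w|lborel. KT (real n) w * \<Psi> w)" for n
    using KT_pairing[OF \<Psi>_int, of "real n"] by (simp only: set_lebesgue_integral_def G)
  show "(\<lambda>n. LINT w|lborel. KT (real n) w * \<Psi> w) \<longlonglongrightarrow> (LINT u|lborel. of_real (k u) * G u)"
    unfolding eq[symmetric]
  proof (rule integral_dominated_convergence)
    show "integrable lborel (\<lambda>u. k u * (c' / (1 + u\<^sup>2)))" by (rule k_cauchy_integrable)
    show "AE u in lborel. (\<lambda>n. indicator {0..real n} u *\<^sub>R (of_real (k u) * G u)) \<longlonglongrightarrow> of_real (k u) * G u"
    proof (rule AE_I2)
      fix u :: real
      obtain N where N: "u \<le> real N" using real_arch_simple by blast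
      have "\<forall>\<^sub>F n in sequentially. indicator {0..real n} u *\<^sub>R (of_real (k u) * G u) = of_real (k u) * G u"
        using eventually_ge_at_top[of N] by eventually_elim (use N k_neg[of u] in \<open>auto split: split_indicator\<close>)
      then show "(\<lambda>n. indicator {0..real n} u *\<^sub>R (of_real (k u) * G u)) \<longlonglongrightarrow> of_real (k u) * G u"
        by (rule tendsto_eventually)
    qed
    show "AE u in lborel. norm (indicator {0..real n} u *\<^sub>R (of_real (k u) * G u)) \<le> k u * (c' / (1
        + u\<^sup>2))" for n
    proof (rule AE_I2)
      fix u
      have "norm (indicator {0..real n} u *\<^sub>R (of_real (k u) * G u)) \<le> k u * cmod (G u)"
        by (auto simp: norm_mult k_nonneg split: split_indicator)
      also have "\<dots> \<le> k u * (c' / (1 + u\<^sup>2))" by (intro mult_left_mono G' k_nonneg)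
      finally show "norm (indicator {0..real n} u *\<^sub>R (of_real (k u) * G u)) \<le> k u * (c' / (1 + u\<^sup>2))" .
    qed
  qed measurable
  show "(\<lambda>n. LINT w|lborel. KT (real n) w * \<Psi> w) \<longlonglongrightarrow> (LINT w|lborel. KH w * \<Psi> w)"
  proof (rule integral_dominated_convergence)
    show "integrable lborel (\<lambda>w. (KB + 2 * (C + D) / sqrt \<bar>w\<bar>) * (c / (1 + w\<^sup>2)))"
      by (rule integrable_inverse_sqrt_cauchy)
    show "AE w in lborel. (\<lambda>n. KT (real n) w * \<Psi> w) \<longlonglongrightarrow> KH w * \<Psi> w"
      using AE_lborel_singleton[of 0] by eventually_elim (intro tendsto_intros KT_tendsto_seq)
    show "AE w in lborel. norm (KT (real n) w * \<Psi> w) \<le> (KB + 2 * (C + D) / sqrt \<bar>w\<bar>) * (c / (1 + w\<^sup>2))" for n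
      using AE_lborel_singleton[of 0]
    proof eventually_elim
      case (elim w)
      show ?case
        unfolding norm_mult using norm_KT_le[OF elim] \<Psi>[of w] order_trans[OF norm_ge_zero norm_KT_le[OF elim]]
        by (intro mult_mono) auto
    qed
  qed measurable
qed

end

text \<open>Since \<open>u\<^sup>2 \<le> 2 * s\<^sup>2 + 2 * t\<^sup>2\<close>, one of the two
  factors must already be as small as the weight at the separation \<open>u\<close>. Integrated,
  this shows that Cauchy decay survives convolution.\<close>

lemma cauchy_mult_le:
  fixes s t u :: real
  assumes "\<bar>u\<bar> = \<bar>t - s\<bar>"
  shows "1 / (1 + s\<^sup>2) * (1 / (1 + t\<^sup>2)) \<le> 2 / (1 + u\<^sup>2) * (1 / (1 + s\<^sup>2) + 1 / (1 + t\<^sup>2))"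
proof -
  have p: "0 < 1 + s\<^sup>2" "0 < 1 + t\<^sup>2" "0 < 1 + u\<^sup>2" by (simp_all add: add_pos_nonneg)
  have "u\<^sup>2 = (t - s)\<^sup>2" using assms by (metis power2_abs)
  moreover have "0 \<le> (t + s)\<^sup>2" by simp
  ultimately have "1 + u\<^sup>2 \<le> 2 * ((1 + t\<^sup>2) + (1 + s\<^sup>2))" by (simp add: power2_eq_square algebra_simps)
  then have "1 / ((1 + s\<^sup>2) * (1 + t\<^sup>2)) \<le> 2 * ((1 + t\<^sup>2) + (1 + s\<^sup>2)) / (1 + u\<^sup>2) / ((1 + s\<^sup>2) * (1 + t\<^sup>2))"
    using p by (intro divide_right_mono) auto
  also have "\<dots> = 2 / (1 + u\<^sup>2) * (1 / (1 + s\<^sup>2) + 1 / (1 + t\<^sup>2))"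
    using p by (simp add: add_frac_eq)
  finally show ?thesis by simp
qed

lemma integral_cauchy_shift:
  assumes "\<bar>\<sigma>\<bar> = (1::real)"
  shows "integrable lborel (\<lambda>t. 1 / (1 + (a + \<sigma> * t)\<^sup>2))"
    and "(LINT t|lborel. 1 / (1 + (a + \<sigma> * t)\<^sup>2)) = (LINT t|lborel. 1 / (1 + t\<^sup>2))"
proof -
  have "\<sigma> \<noteq> 0" using assms by auto
  then show "integrable lborel (\<lambda>t. 1 / (1 + (a + \<sigma> * t)\<^sup>2))"
    using lborel_integrable_real_affine[OF integrable_cauchy[of 1], of \<sigma> a] by simp
  show "(LINT t|lborel. 1 / (1 + (a + \<sigma> * t)\<^sup>2)) = (LINT t|lborel. 1 / (1 + t\<^sup>2))"
    using lborel_integral_real_affine[of \<sigma> "\<lambda>t. 1 / (1 + t\<^sup>2)" a] assms \<open>\<sigma> \<noteq> 0\<close> by simp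
qed

lemma fourier_shift:
  assumes [measurable]: "f \<in> borel_measurable borel"
  shows "fourier (\<lambda>t. f (t - a)) w = iexp (a * w) * fourier f w"
proof -
  have "fourier (\<lambda>t. f (t - a)) w = (LINT t|lborel. iexp (t * w) * f (t - a))"
    by (rule fourier_lborel) measurable
  also have "\<dots> = (LINT t|lborel. iexp ((a + 1 * t) * w) * f (a + 1 * t - a))"
    by (subst lborel_integral_real_affine[of 1 _ a]) simp_all
  also have "\<dots> = (LINT t|lborel. iexp (a * w) * (iexp (t * w) * f t))"
    by (simp add: distrib_left distrib_right exp_add mult.assoc)
  finally show ?thesis by (simp only: integral_mult_right_zero fourier_lborel[OF assms])
qed

lemma convolution_decay:
  assumes [measurable]: "f \<in> borel_measurable borel" "g \<in> borel_measurable borel"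
    and f: "\<And>t. cmod (f t) \<le> c / (1 + t\<^sup>2)" and g: "\<And>t. cmod (g t) \<le> d / (1 + t\<^sup>2)" and \<sigma>: "\<bar>\<sigma>\<bar> = 1"
  shows "integrable lborel (\<lambda>t. f (t - \<sigma> * u) * g t)"
    and "(LINT t|lborel. cmod (f (t - \<sigma> * u) * g t)) \<le> (4 * c * d * (LINT t|lborel. 1 / (1 + t\<^sup>2))) / (1 + u\<^sup>2)"
proof -
  have c: "0 \<le> c" "0 \<le> d" using order_trans[OF norm_ge_zero f[of 0]] order_trans[OF norm_ge_zero g[of 0]]
      by simp_all
  let ?b = "\<lambda>t. c * d * (2 / (1 + u\<^sup>2) * (1 / (1 + (t - \<sigma> * u)\<^sup>2) + 1 / (1 + t\<^sup>2)))"
  have b: "cmod (f (t - \<sigma> * u) * g t) \<le> ?b t" for t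
  proof -
    have "cmod (f (t - \<sigma> * u) * g t) \<le> (c / (1 + (t - \<sigma> * u)\<^sup>2)) * (d / (1 + t\<^sup>2))"
      unfolding norm_mult by (intro mult_mono f g divide_nonneg_nonneg c) auto
    also have "\<dots> = c * d * (1 / (1 + (t - \<sigma> * u)\<^sup>2) * (1 / (1 + t\<^sup>2)))" by simp
    also have "\<dots> \<le> ?b t"
      using c by (intro mult_left_mono cauchy_mult_le) (auto simp: abs_mult \<sigma>)
    finally show ?thesis .
  qed
  have i1: "integrable lborel (\<lambda>t. 1 / (1 + (t - \<sigma> * u)\<^sup>2))"
    and e1: "(LINT t|lborel. 1 / (1 + (t - \<sigma> * u)\<^sup>2)) = (LINT t|lborel. 1 / (1 + t\<^sup>2))"
    using integral_cauchy_shift[of 1 "- (\<sigma> * u)"] by simp_all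
  have ib: "integrable lborel ?b"
    by (intro integrable_mult_right Bochner_Integration.integrable_add i1 integrable_cauchy)
  show i: "integrable lborel (\<lambda>t. f (t - \<sigma> * u) * g t)"
  proof (rule Bochner_Integration.integrable_bound[OF ib])
    show "AE t in lborel. norm (f (t - \<sigma> * u) * g t) \<le> norm (?b t)"
      unfolding real_norm_def by (intro AE_I2 order_trans[OF b abs_ge_self])
  qed measurable
  have "(LINT t|lborel. cmod (f (t - \<sigma> * u) * g t)) \<le> (LINT t|lborel. ?b t)"
    by (intro integral_mono integrable_norm i ib b)
  also have "\<dots> = c * d * (2 / (1 + u\<^sup>2) * ((LINT t|lborel. 1 / (1 + t\<^sup>2)) + (LINT t|lborel. 1 / (1 + t\<^sup>2))))"
    by (simp only: integral_mult_right_zero Bochner_Integration.integral_add[OF i1 integrable_cauchy] e1)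
  finally show "(LINT t|lborel. cmod (f (t - \<sigma> * u) * g t)) \<le> (4 * c * d * (LINT t|lborel. 1 / (1
      + t\<^sup>2))) / (1 + u\<^sup>2)"
    by (simp add: algebra_simps)
qed

section \<open>Fourier transform of convolutions with the kernel\<close>

context decaying_kernel
begin

text \<open>The sign \<sigma> treats the convolution of the equation and its reflected adjoint in
  one proof; the substitution \<open>w\<close> to \<open>\<sigma> * w\<close> reduces both to
  \<open>KH_pairing\<close>.\<close>

lemma KH_pairing_signed:
  assumes [measurable]: "\<Psi> \<in> borel_measurable borel" and \<Psi>: "\<And>w. cmod (\<Psi> w) \<le> c / (1 + w\<^sup>2)"
    and G: "\<And>u. G u = (LINT w|lborel. iexp (\<sigma> * u * w) * \<Psi> w)" and G': "\<And>u. cmod (G u) \<le> c' / (1 + u\<^sup>2)"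
    and \<sigma>: "\<bar>\<sigma>\<bar> = 1"
  shows "(LINT u|lborel. of_real (k u) * G u) = (LINT w|lborel. KH (\<sigma> * w) * \<Psi> w)"
    and "integrable lborel (\<lambda>w. KH (\<sigma> * w) * \<Psi> w)"
proof -
  have \<sigma>\<sigma>: "\<sigma> * \<sigma> = 1" "\<sigma> \<noteq> 0" "\<sigma> * (\<sigma> * x) = x" for x using \<sigma> by (auto simp: abs_if split: if_splits)
  have e: "\<sigma> * u * (\<sigma> * w) = u * w" for u w
  proof -
    have "\<sigma> * u * (\<sigma> * w) = (\<sigma> * \<sigma>) * (u * w)" by (simp only: mult_ac)
    then show ?thesis by (simp only: \<sigma>\<sigma>(1) mult_1)
  qed
  have sq: "(\<sigma> * w)\<^sup>2 = w\<^sup>2" for w using \<sigma>\<sigma>(1) by (simp add: power_mult_distrib power2_eq_square)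
  have R: "(LINT w|lborel. F (\<sigma> * w)) = (LINT w|lborel. F w)" for F :: "real \<Rightarrow> complex"
    using lborel_integral_real_affine[OF \<sigma>\<sigma>(2), of F 0] \<sigma> by simp
  have *: "(LINT u|lborel. of_real (k u) * G u) = (LINT w|lborel. KH w * \<Psi> (\<sigma> * w))"
  proof (rule KH_pairing[OF _ _ _ G'])
    show "cmod (\<Psi> (\<sigma> * w)) \<le> c / (1 + w\<^sup>2)" for w
      using \<Psi>[of "\<sigma> * w"] by (simp only: sq)
    show "G u = (LINT w|lborel. iexp (u * w) * \<Psi> (\<sigma> * w))" for u
      using R[of "\<lambda>w. iexp (\<sigma> * u * w) * \<Psi> w"] by (simp only: G e)
  qed measurable
  also have "\<dots> = (LINT w|lborel. KH (\<sigma> * w) * \<Psi> w)"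
    using R[of "\<lambda>w. KH (\<sigma> * w) * \<Psi> w"] by (simp add: \<sigma>\<sigma>)
  finally show "(LINT u|lborel. of_real (k u) * G u) = (LINT w|lborel. KH (\<sigma> * w) * \<Psi> w)" .
  have "integrable lborel (\<lambda>w. KH w * \<Psi> (\<sigma> * w))"
  proof (rule KH_mult_integrable)
    show "cmod (\<Psi> (\<sigma> * w)) \<le> c / (1 + w\<^sup>2)" for w
      using \<Psi>[of "\<sigma> * w"] by (simp only: sq)
  qed measurable
  from lborel_integrable_real_affine[OF this \<sigma>\<sigma>(2), of 0]
  show "integrable lborel (\<lambda>w. KH (\<sigma> * w) * \<Psi> w)" by (simp add: \<sigma>\<sigma>)
qed

text \<open>\<open>\<sigma> = 1\<close> is the causal convolution with the kernel, and
  \<open>\<sigma> = - 1\<close> is the one that looks into the future, as in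
  \<open>gle_adjoint\<close>.\<close>

definition kconv :: "real \<Rightarrow> (real \<Rightarrow> complex) \<Rightarrow> real \<Rightarrow> complex" where
  "kconv \<sigma> \<phi> t = (LINT u|lborel. of_real (k u) * \<phi> (t - \<sigma> * u))"

lemma kconv_borel [measurable]:
  assumes [measurable]: "\<phi> \<in> borel_measurable borel"
  shows "kconv \<sigma> \<phi> \<in> borel_measurable borel"
  unfolding kconv_def[abs_def] by measurable

text \<open>Boundedness makes the convolution a tempered distribution. For test functions of nonzero
  mean it decays only like \<open>1 / \<bar>t\<bar>\<close> on one side, so it is not integrable.
  The bound is uniform in \<open>t\<close> because the mass of a Cauchy weight is translation
  invariant.\<close>

lemma kconv_bounded:
  assumes \<phi>: "schwartz \<phi>" and \<sigma>: "\<bar>\<sigma>\<bar> = 1"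
  obtains B where "\<And>t. cmod (kconv \<sigma> \<phi> t) \<le> B"
proof -
  note [measurable] = schwartz_borel[OF \<phi>]
  obtain c where c: "0 \<le> c" "\<And>t. cmod (\<phi> t) \<le> c / (1 + t\<^sup>2)" using schwartz_decay[OF \<phi>] by blast
  let ?b = "\<lambda>t u. indicator {0..A} u * k u * c + k A * c * (1 / (1 + (t + (- \<sigma>) * u)\<^sup>2))"
  have i1: "integrable lborel (\<lambda>u. indicator {0..A} u * k u)" using k_integrable_A
      by (simp add: set_integrable_def)
  note i2 = integral_cauchy_shift[of "- \<sigma>", simplified abs_minus_cancel, OF \<sigma>]
  have ib: "integrable lborel (?b t)" for t
    by (intro Bochner_Integration.integrable_add integrable_mult_left integrable_mult_right i1 i2)
  have b: "cmod (of_real (k u) * \<phi> (t - \<sigma> * u)) \<le> ?b t u" for t u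
  proof -
    have p: "0 < 1 + (t - \<sigma> * u)\<^sup>2" by (simp add: add_pos_nonneg)
    have "cmod (of_real (k u) * \<phi> (t - \<sigma> * u)) \<le> k u * (c / (1 + (t - \<sigma> * u)\<^sup>2))"
      by (simp only: norm_mult norm_of_real abs_of_nonneg k_nonneg mult_left_mono c)
    also have "\<dots> \<le> ?b t u"
    proof (cases "u \<in> {0..A}")
      case True
      have "k u * (c / (1 + (t - \<sigma> * u)\<^sup>2)) \<le> k u * c"
        using p c by (intro mult_left_mono) (auto simp: k_nonneg divide_le_eq mult_le_cancel_left1)
      then show ?thesis using True c by (simp add: k_nonneg add_increasing2)
    next
      case False
      have "k u \<le> k A" using False k_neg[of u] k_antimono[of A u] k_nonneg[of A] by (cases "u < 0") auto
      then have "k u * (c / (1 + (t - \<sigma> * u)\<^sup>2)) \<le> k A * (c / (1 + (t - \<sigma> * u)\<^sup>2))"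
        using p c by (intro mult_right_mono) auto
      then show ?thesis using False by simp
    qed
    finally show ?thesis .
  qed
  have "cmod (kconv \<sigma> \<phi> t) \<le> KI * c + k A * c * (LINT t|lborel. 1 / (1 + t\<^sup>2))" for t
  proof -
    have "cmod (kconv \<sigma> \<phi> t) \<le> (LINT u|lborel. ?b t u)"
      unfolding kconv_def
    proof (rule Bochner_Integration.integral_norm_bound_integral[OF _ ib b])
      show "integrable lborel (\<lambda>u. of_real (k u) * \<phi> (t - \<sigma> * u))"
        by (rule Bochner_Integration.integrable_bound[OF ib[of t]])
           (measurable, intro AE_I2, unfold real_norm_def, rule order_trans[OF b abs_ge_self])
    qed
    also have "\<dots> = (LINT u|lborel. indicator {0..A} u * k u) * c + k A * c * (LINT t|lborel. 1 / (1 + t\<^sup>2))"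
      by (subst Bochner_Integration.integral_add)
         (intro integrable_mult_left integrable_mult_right i1 i2 | simp only: integral_mult_left_zero
             integral_mult_right_zero i2)+
    finally show ?thesis by (simp add: KI_def set_lebesgue_integral_def)
  qed
  then show ?thesis by (rule that)
qed

text \<open>Fubini moves the kernel outside and leaves the correlation \<open>G\<close> of \<phi>
  with the transform of \<psi>. The multiplication formula rewrites \<open>G\<close> as the
  transform of \<open>fourier \<phi> * \<psi>\<close>, and \<open>convolution_decay\<close> gives
  the decay that pairing with the non-integrable kernel requires.\<close>

lemma fourier_kconv_pairing:
  assumes \<phi>: "schwartz \<phi>" and \<psi>: "schwartz \<psi>" and \<sigma>: "\<bar>\<sigma>\<bar> = 1"
  shows "(LINT t|lborel. kconv \<sigma> \<phi> t * fourier \<psi> t) = (LINT w|lborel. KH (\<sigma> * w) * fourier \<phi> w * \<psi> w)"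
    and "integrable lborel (\<lambda>w. KH (\<sigma> * w) * fourier \<phi> w * \<psi> w)"
proof -
  note [measurable] = schwartz_borel[OF \<phi>] schwartz_borel[OF \<psi>]
  obtain c where c: "\<And>t. cmod (\<phi> t) \<le> c / (1 + t\<^sup>2)" using schwartz_decay[OF \<phi>] by blast
  obtain d where d: "\<And>t. cmod (fourier \<psi> t) \<le> d / (1 + t\<^sup>2)" using schwartz_decay[OF schwartz_fourier[OF \<psi>]]
      by blast
  obtain e where e: "0 \<le> e" "\<And>t. cmod (\<psi> t) \<le> e / (1 + t\<^sup>2)" using schwartz_decay[OF \<psi>] by blast
  define G where "G = (\<lambda>u. LINT t|lborel. \<phi> (t - \<sigma> * u) * fourier \<psi> t)"
  define c' where "c' = 4 * c * d * (LINT t|lborel. 1 / (1 + t\<^sup>2))"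
  note decay = convolution_decay[OF _ _ c d \<sigma>, folded c'_def, simplified]
  have G': "cmod (G u) \<le> c' / (1 + u\<^sup>2)" for u
    unfolding G_def by (rule order_trans[OF integral_norm_bound decay(2)])
  have Geq: "G u = (LINT w|lborel. iexp (\<sigma> * u * w) * (fourier \<phi> w * \<psi> w))" for u
  proof -
    have "integrable lborel (\<lambda>t. \<phi> (t - \<sigma> * u))"
      using lborel_integrable_real_affine[OF schwartz_integrable[OF \<phi>], of 1 "- \<sigma> * u"] by simp
    then have "G u = (LINT w|lborel. fourier (\<lambda>t. \<phi> (t - \<sigma> * u)) w * \<psi> w)"
      unfolding G_def by (rule fourier_multiplication_formula(1)[OF _ schwartz_integrable[OF \<psi>]])
    then show ?thesis by (simp only: fourier_shift[OF schwartz_borel[OF \<phi>]] mult.assoc)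
  qed
  define L where "L = (LINT t|lborel. cmod (\<phi> t))"
  have \<Psi>: "cmod (fourier \<phi> w * \<psi> w) \<le> (L * e) / (1 + w\<^sup>2)" for w
  proof -
    have "cmod (fourier \<phi> w * \<psi> w) \<le> L * (e / (1 + w\<^sup>2))"
      unfolding norm_mult L_def
      by (intro mult_mono norm_fourier_le schwartz_integrable[OF \<phi>] e(2)) simp_all
    then show ?thesis by simp
  qed
  let ?f = "\<lambda>u t. of_real (k u) * (\<phi> (t - \<sigma> * u) * fourier \<psi> t)"
  let ?n = "\<lambda>u. LINT t|lborel. norm (case (u, t) of (u, t) \<Rightarrow> ?f u t)"
  have i: "integrable (lborel \<Otimes>\<^sub>M lborel) (\<lambda>(u, t). ?f u t)"
  proof (rule lborel_pair.Fubini_integrable)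
    show "integrable lborel (\<lambda>u. LINT t|lborel. norm (case (u, t) of (u, t) \<Rightarrow> ?f u t))"
    proof (rule Bochner_Integration.integrable_bound[OF k_cauchy_integrable[of c']])
      show "AE u in lborel. norm (?n u) \<le> norm (k u * (c' / (1 + u\<^sup>2)))"
      proof (rule AE_I2)
        fix u
        have "?n u = k u * (LINT t|lborel. cmod (\<phi> (t - \<sigma> * u) * fourier \<psi> t))"
          by (simp add: norm_mult[of "of_real _"] k_nonneg)
        also have "\<dots> \<le> k u * (c' / (1 + u\<^sup>2))" by (intro mult_left_mono decay k_nonneg)
        finally have le: "?n u \<le> k u * (c' / (1 + u\<^sup>2))" .
        show "norm (?n u) \<le> norm (k u * (c' / (1 + u\<^sup>2)))"
          unfolding real_norm_def
          by (subst abs_of_nonneg, rule Bochner_Integration.integral_nonneg, simp, rule order_trans[OF le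
              abs_ge_self])
      qed
    qed measurable
    show "AE u in lborel. integrable lborel (\<lambda>t. case (u, t) of (u, t) \<Rightarrow> ?f u t)"
      using decay(1) by simp
  qed simp
  have "(LINT t|lborel. kconv \<sigma> \<phi> t * fourier \<psi> t)
      = (LINT t|lborel. LINT u|lborel. (of_real (k u) * \<phi> (t - \<sigma> * u)) * fourier \<psi> t)"
    by (simp only: kconv_def integral_mult_left_zero)
  also have "\<dots> = (LINT t|lborel. LINT u|lborel. ?f u t)" by (simp only: mult.assoc)
  also have "\<dots> = (LINT u|lborel. LINT t|lborel. ?f u t)" by (rule lborel_pair.Fubini_integral[OF i])
  also have "\<dots> = (LINT u|lborel. of_real (k u) * G u)"
    by (simp only: integral_mult_right_zero G_def)
  also have "\<dots> = (LINT w|lborel. KH (\<sigma> * w) * (fourier \<phi> w * \<psi> w))"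
    by (rule KH_pairing_signed(1)[OF _ \<Psi> Geq G' \<sigma>]) measurable
  finally show "(LINT t|lborel. kconv \<sigma> \<phi> t * fourier \<psi> t) = (LINT w|lborel. KH (\<sigma> * w) * fourier \<phi> w * \<psi> w)"
    by (simp only: mult.assoc)
  have "integrable lborel (\<lambda>w. KH (\<sigma> * w) * (fourier \<phi> w * \<psi> w))"
    by (rule KH_pairing_signed(2)[OF _ \<Psi> Geq G' \<sigma>]) measurable
  then show "integrable lborel (\<lambda>w. KH (\<sigma> * w) * fourier \<phi> w * \<psi> w)"
    by (simp only: mult.assoc)
qed

lemma fourier_is_fun_kconv:
  assumes \<phi>: "schwartz \<phi>" and \<sigma>: "\<bar>\<sigma>\<bar> = 1"
  shows "fourier_is_fun (dist_of (kconv \<sigma> \<phi>)) (\<lambda>w. KH (\<sigma> * w) * fourier \<phi> w)"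
proof -
  note [measurable] = schwartz_borel[OF \<phi>]
  show ?thesis
  proof (rule fourier_is_funI)
    show "kconv \<sigma> \<phi> \<in> borel_measurable borel" "(\<lambda>w. KH (\<sigma> * w) * fourier \<phi> w) \<in> borel_measurable borel"
      by measurable
  qed (rule fourier_kconv_pairing[OF \<phi> _ \<sigma>], assumption)+
qed

end

section \<open>The spectral density of the weak solution\<close>

lemma fourier_is_fun_pairing:
  assumes "fourier_is_fun (dist_of g) h" and [measurable]: "g \<in> borel_measurable borel" and \<psi>: "schwartz \<psi>"
  shows "(LINT t|lborel. g t * fourier \<psi> t) = (LINT w|lborel. h w * \<psi> w)"
    and "integrable lborel (\<lambda>w. h w * \<psi> w)"
proof -
  have [measurable]: "h \<in> borel_measurable borel" using assms(1) by (simp add: fourier_is_fun_def)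
  note [measurable] = schwartz_borel[OF \<psi>]
  have "fourier_dist (dist_of g) \<psi> = dist_of h \<psi>" using assms(1) by (simp add: fourier_is_fun_def)
  then show "(LINT t|lborel. g t * fourier \<psi> t) = (LINT w|lborel. h w * \<psi> w)"
    by (simp add: fourier_dist_def \<psi> dist_of_lborel schwartz_fourier)
  have "integrable lebesgue (\<lambda>w. h w * \<psi> w)" using assms(1) \<psi> by (simp add: fourier_is_fun_def)
  then show "integrable lborel (\<lambda>w. h w * \<psi> w)"
    by (rule integrable_completion[THEN iffD1, rotated]) measurable
qed

lemma fourier_is_fun_lincomb:
  assumes 1: "fourier_is_fun (dist_of g1) h1" "g1 \<in> borel_measurable borel" "\<And>t. cmod (g1 t) \<le> B1"
    and 2: "fourier_is_fun (dist_of g2) h2" "g2 \<in> borel_measurable borel" "\<And>t. cmod (g2 t) \<le> B2"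
  shows "fourier_is_fun (dist_of (\<lambda>t. a * g1 t + b * g2 t)) (\<lambda>w. a * h1 w + b * h2 w)"
proof (rule fourier_is_funI)
  have [measurable]: "h1 \<in> borel_measurable borel" "h2 \<in> borel_measurable borel"
    using 1 2 by (simp_all add: fourier_is_fun_def)
  note [measurable] = 1(2) 2(2)
  show "(\<lambda>t. a * g1 t + b * g2 t) \<in> borel_measurable borel"
    "(\<lambda>w. a * h1 w + b * h2 w) \<in> borel_measurable borel" by measurable
  fix \<psi> assume \<psi>: "schwartz \<psi>"
  note p1 = fourier_is_fun_pairing[OF 1(1,2) \<psi>] and p2 = fourier_is_fun_pairing[OF 2(1,2) \<psi>]
  note i1 = integrable_bounded_mult_schwartz[OF 1(2,3) schwartz_fourier[OF \<psi>]]
  note i2 = integrable_bounded_mult_schwartz[OF 2(2,3) schwartz_fourier[OF \<psi>]]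
  show "integrable lborel (\<lambda>w. (a * h1 w + b * h2 w) * \<psi> w)"
    using p1(2) p2(2) by (simp add: distrib_right mult.assoc)
  show "(LINT t|lborel. (a * g1 t + b * g2 t) * fourier \<psi> t) = (LINT w|lborel. (a * h1 w + b * h2 w) * \<psi> w)"
    using p1 p2 i1 i2 by (simp add: distrib_right mult.assoc)
qed

lemma schwartz_mult_poly_weight:
  assumes "schwartz f" shows "schwartz (\<lambda>t. of_real ((1 + t\<^sup>2) ^ n) * f t)"
proof (induction n)
  case (Suc n)
  let ?g = "\<lambda>t. of_real ((1 + t\<^sup>2) ^ n) * f t"
  have "schwartz (\<lambda>t. ?g t + of_real t * (of_real t * ?g t))"
    by (intro schwartz_add schwartz_mult_id Suc)
  also have "(\<lambda>t. ?g t + of_real t * (of_real t * ?g t)) = (\<lambda>t. of_real ((1 + t\<^sup>2) ^ Suc n) * f t)"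
    by (rule ext) (simp add: algebra_simps power2_eq_square)
  finally show ?case .
qed (simp add: assms)

lemma schwartz_sq_decay:
  assumes "schwartz f"
  obtains C where "\<And>t. (cmod (f t))\<^sup>2 \<le> C * (1 + t\<^sup>2) powi (- (k::int))"
proof -
  \<comment> \<open>The exponent is an arbitrary integer. If it is negative then
    \<open>n = 0\<close>, and the weight \<open>w powi (- k)\<close> is at least 1 because
    \<open>1 \<le> w\<close>.\<close>
  define n where "n = nat k"
  obtain C where C: "0 \<le> C" "\<And>t. cmod (of_real ((1 + t\<^sup>2) ^ n) * f t) \<le> C / (1 + t\<^sup>2)"
    using schwartz_decay[OF schwartz_mult_poly_weight[OF assms, of n]] by blast
  have "(cmod (f t))\<^sup>2 \<le> C\<^sup>2 * (1 + t\<^sup>2) powi (- k)" for t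
  proof -
    define w where "w = 1 + t\<^sup>2"
    have w: "1 \<le> w" by (simp add: w_def)
    have wn: "1 \<le> w ^ n" using w by simp
    have "w ^ n * cmod (f t) \<le> C / w" using C(2)[of t] w
        by (simp add: w_def norm_mult norm_power flip: of_real_power)
    also have "\<dots> \<le> C" using w C(1) by (simp add: divide_le_eq mult_le_cancel_left1)
    finally have le: "cmod (f t) \<le> C / w ^ n" using w by (simp add: pos_le_divide_eq mult.commute)
    have "(cmod (f t))\<^sup>2 \<le> (C / w ^ n)\<^sup>2" by (intro power_mono le) simp
    also have "\<dots> = C\<^sup>2 * (1 / (w ^ n * w ^ n))" by (simp add: power2_eq_square)
    also have "\<dots> \<le> C\<^sup>2 * (1 / (w ^ n))" using wn w
        by (intro mult_left_mono divide_left_mono) (auto simp: mult_le_cancel_left1)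
    also have "1 / w ^ n \<le> w powi (- k)"
    proof (cases "0 \<le> k")
      case True
      then show ?thesis by (simp add: n_def power_int_def inverse_eq_divide power_one_over)
    next
      case False
      then have "w powi (- k) = w ^ nat (- k)" by (simp add: power_int_def)
      then show ?thesis using False w by (simp add: n_def)
    qed
    finally show ?thesis by (simp add: w_def mult_left_mono)
  qed
  then show ?thesis by (rule that)
qed

lemma spectral_measure_schwartz:
  assumes \<nu>: "spectral_measure \<nu>" and f: "schwartz f"
  shows "integrable \<nu> (\<lambda>w. (cmod (f w))\<^sup>2)"
proof (rule integrableI_bounded)
  have s: "sets \<nu> = sets borel" using \<nu> by (simp add: spectral_measure_def)
  note [measurable_cong] = s
  note [measurable] = schwartz_borel[OF f]
  show "(\<lambda>w. (cmod (f w))\<^sup>2) \<in> borel_measurable \<nu>" by measurable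
  obtain k :: int where k: "(\<integral>\<^sup>+ x. ennreal ((1 + x\<^sup>2) powi (- k)) \<partial>\<nu>) < \<infinity>"
    using \<nu> by (auto simp: spectral_measure_def)
  obtain C where C: "\<And>t. (cmod (f t))\<^sup>2 \<le> C * (1 + t\<^sup>2) powi (- k)" 
    using schwartz_sq_decay[OF f, of k] by blast
  have "(\<integral>\<^sup>+w. ennreal (norm ((cmod (f w))\<^sup>2)) \<partial>\<nu>) \<le> (\<integral>\<^sup>+w. ennreal \<bar>C\<bar> * ennreal ((1 + w\<^sup>2) powi (- k)) \<partial>\<nu>)"
  proof (rule nn_integral_mono)
    fix w
    have "(cmod (f w))\<^sup>2 \<le> \<bar>C\<bar> * (1 + w\<^sup>2) powi (- k)"
      by (rule order_trans[OF C mult_right_mono[OF abs_ge_self]]) (simp add: zero_le_power_int)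
    then show "ennreal (norm ((cmod (f w))\<^sup>2)) \<le> ennreal \<bar>C\<bar> * ennreal ((1 + w\<^sup>2) powi (- k))"
      by (simp flip: ennreal_mult' add: ennreal_leI)
  qed
  also have "\<dots> = ennreal \<bar>C\<bar> * (\<integral>\<^sup>+w. ennreal ((1 + w\<^sup>2) powi (- k)) \<partial>\<nu>)"
    unfolding power_int_def by (rule nn_integral_cmult) measurable
  also have "\<dots> < \<infinity>" using k by (simp add: ennreal_mult_less_top)
  finally show "(\<integral>\<^sup>+w. ennreal (norm ((cmod (f w))\<^sup>2)) \<partial>\<nu>) < \<infinity>" .
qed

text \<open>Peetre's inequality: a translation by \<open>x\<close> costs only the factor
  \<open>2 * (1 + x\<^sup>2)\<close>. It reduces to the nonnegativity of
  \<open>(2 * x - t)\<^sup>2\<close> and \<open>x\<^sup>2 * (x - t)\<^sup>2\<close>.\<close>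

lemma cauchy_shift_le:
  fixes x t :: real shows "1 / (1 + (x - t)\<^sup>2) \<le> 2 * (1 + x\<^sup>2) / (1 + t\<^sup>2)"
proof -
  have p: "0 < 1 + (x - t)\<^sup>2" "0 < 1 + t\<^sup>2" by (simp_all add: add_pos_nonneg)
  have "0 \<le> (2 * x - t)\<^sup>2" "0 \<le> x\<^sup>2 * (x - t)\<^sup>2" by simp_all
  then have "1 + t\<^sup>2 \<le> 2 * (1 + x\<^sup>2) * (1 + (x - t)\<^sup>2)" by (simp add: power2_eq_square algebra_simps)
  then show ?thesis using p by (simp add: divide_le_eq le_divide_eq)
qed

lemma exp_neg_le_inverse: "0 \<le> y \<Longrightarrow> exp (- y) \<le> 1 / (1 + y)" for y :: real
  using exp_ge_add_one_self[of y] by (simp add: exp_minus divide_inverse)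

text \<open>Separates the two-sided kernel \<open>K\<close>, which is only Lebesgue measurable and
  may be infinite at 0, from its one-sided Borel version \<open>k\<close>. \<open>Re_KH_pos\<close>
  is the positivity of the cosine transform, expressed through \<open>KH\<close>.\<close>

locale gle_kernel = decaying_kernel +
  fixes K :: "real \<Rightarrow> ereal" and m \<beta> :: real
  assumes K_measurable: "(\<lambda>t. real_of_ereal (K t)) \<in> borel_measurable lebesgue"
    and K_even: "K (- t) = K t"
    and k_eq_K: "AE t in lborel. 0 \<le> t \<longrightarrow> k t = real_of_ereal (K t)"
    and m_pos: "0 < m" and \<beta>_pos: "0 < \<beta>"
    and Re_KH_pos: "\<omega> \<noteq> 0 \<Longrightarrow> 0 < Re (KH \<omega>)"
begin

lemma conv_K_plus:
  assumes [measurable]: "\<phi> \<in> borel_measurable borel"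
  shows "conv (K_plus K) \<phi> = kconv 1 \<phi>"
proof
  fix t
  have [measurable]: "\<phi> \<in> borel_measurable lebesgue" by (rule measurable_completion) simp
  note [measurable] = K_measurable
  have "conv (K_plus K) \<phi> t = (LINT u|lebesgue. of_real (k u) * \<phi> (t - u))"
    unfolding conv_def
  proof (rule integral_cong_AE)
    show "AE u in lebesgue. K_plus K u * \<phi> (t - u) = of_real (k u) * \<phi> (t - u)"
      using AE_completion[OF k_eq_K] by eventually_elim (auto simp: K_plus_def k_neg)
    show "(\<lambda>u. of_real (k u) * \<phi> (t - u)) \<in> borel_measurable lebesgue"
      by (rule measurable_completion) simp
    have m: "(\<lambda>u. \<phi> (t - u)) \<in> borel_measurable lebesgue" by (rule measurable_completion) simp
    have "{t::real. 0 \<le> t} \<in> sets lebesgue"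
      using sets_completionI_sets[of "{0..}" "lborel::real measure"] by (simp add: atLeast_def)
    then have "K_plus K \<in> borel_measurable lebesgue"
      unfolding K_plus_def
      by (intro measurable_If borel_measurable_of_real K_measurable) simp_all
    then show "(\<lambda>u. K_plus K u * \<phi> (t - u)) \<in> borel_measurable lebesgue"
      using m by measurable
  qed
  also have "\<dots> = kconv 1 \<phi> t"
    unfolding kconv_def by (subst integral_completion) simp_all
  finally show "conv (K_plus K) \<phi> t = kconv 1 \<phi> t" .
qed

lemma gle_adjoint_eq:
  assumes [measurable]: "\<phi> \<in> borel_measurable borel"
  shows "gle_adjoint m \<beta> K \<phi> = (\<lambda>t. of_real (- m) * vderiv \<phi> t + of_real \<beta> * kconv (- 1) \<phi> t)"
proof
  fix t
  have "reflect \<phi> \<in> borel_measurable borel" unfolding reflect_def[abs_def] by measurable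
  then have "reflect (conv (K_plus K) (reflect \<phi>)) t = kconv 1 (reflect \<phi>) (- t)"
    by (simp add: conv_K_plus reflect_def)
  also have "\<dots> = kconv (- 1) \<phi> t" by (simp add: kconv_def reflect_def add.commute)
  finally show "gle_adjoint m \<beta> K \<phi> t = of_real (- m) * vderiv \<phi> t + of_real \<beta> * kconv (- 1) \<phi> t"
    by (simp add: gle_adjoint_def)
qed

text \<open>The term \<open>- m * vderiv \<phi>\<close> contributes
  \<open>\<i> * m * \<omega>\<close>, and the reflected convolution evaluates \<open>KH\<close> at
  the negative frequency. The spelling \<open>- 1 * \<omega>\<close> matches
  \<open>\<sigma> * w\<close> at \<open>\<sigma> = - 1\<close>.\<close>

definition gle_symbol :: "real \<Rightarrow> complex" where
  "gle_symbol \<omega> = \<i> * of_real (m * \<omega>) + of_real \<beta> * KH (- 1 * \<omega>)"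

lemma gle_symbol_borel [measurable]: "gle_symbol \<in> borel_measurable borel"
  unfolding gle_symbol_def[abs_def] by measurable

lemma Re_gle_symbol: "w \<noteq> 0 \<Longrightarrow> Re (gle_symbol w) = \<beta> * Re (KH w)"
  and Im_gle_symbol: "w \<noteq> 0 \<Longrightarrow> Im (gle_symbol w) = m * w - \<beta> * Im (KH w)"
  by (simp_all add: gle_symbol_def KH_uminus)

lemma gle_symbol_nonzero: "w \<noteq> 0 \<Longrightarrow> gle_symbol w \<noteq> 0"
  using Re_gle_symbol[of w] Re_KH_pos[of w] \<beta>_pos
      by (metis less_numeral_extra(3) mult_pos_pos zero_complex.simps(1))

lemma fourier_is_fun_gle_adjoint:
  assumes \<phi>: "schwartz \<phi>"
  shows "fourier_is_fun (dist_of (gle_adjoint m \<beta> K \<phi>)) (\<lambda>\<omega>. gle_symbol \<omega> * fourier \<phi> \<omega>)"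
    and "tempered_distribution (dist_of (gle_adjoint m \<beta> K \<phi>))"
proof -
  note \<phi>' = schwartz_vderiv[OF \<phi>]
  note [measurable] = schwartz_borel[OF \<phi>] schwartz_borel[OF \<phi>']
  obtain B1 where "\<And>t. cmod (vderiv \<phi> t) \<le> B1 / (1 + t\<^sup>2)" "0 \<le> B1" using schwartz_decay[OF \<phi>'] by blast
  then have B1: "\<And>t. cmod (vderiv \<phi> t) \<le> B1"
    by (meson order_trans divide_left_mono[of 1 _ B1, simplified] add_increasing2 le_add_same_cancel1
        mult_pos_pos zero_le_power2 zero_less_one add_pos_nonneg)
  obtain B2 where B2: "\<And>t. cmod (kconv (- 1) \<phi> t) \<le> B2" by (rule kconv_bounded[OF \<phi>, of "- 1"]) auto
  have f1: "fourier_is_fun (dist_of (vderiv \<phi>)) (fourier (vderiv \<phi>))"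
    by (rule fourier_is_fun_integrable[OF schwartz_integrable[OF \<phi>']])
  have f2: "fourier_is_fun (dist_of (kconv (- 1) \<phi>)) (\<lambda>w. KH (- 1 * w) * fourier \<phi> w)"
    by (rule fourier_is_fun_kconv[OF \<phi>]) simp
  have "fourier_is_fun (dist_of (gle_adjoint m \<beta> K \<phi>))
      (\<lambda>\<omega>. of_real (- m) * fourier (vderiv \<phi>) \<omega> + of_real \<beta> * (KH (- 1 * \<omega>) * fourier \<phi> \<omega>))"
    unfolding gle_adjoint_eq[OF schwartz_borel[OF \<phi>]]
    by (rule fourier_is_fun_lincomb[OF f1 _ B1 f2 _ B2]) measurable
  also have "(\<lambda>\<omega>. of_real (- m) * fourier (vderiv \<phi>) \<omega> + of_real \<beta> * (KH (- 1 * \<omega>) * fourier \<phi> \<omega>))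
      = (\<lambda>\<omega>. gle_symbol \<omega> * fourier \<phi> \<omega>)"
    by (rule ext) (simp add: fourier_vderiv[OF \<phi>] gle_symbol_def algebra_simps)
  finally show "fourier_is_fun (dist_of (gle_adjoint m \<beta> K \<phi>)) (\<lambda>\<omega>. gle_symbol \<omega> * fourier \<phi> \<omega>)" .
  show "tempered_distribution (dist_of (gle_adjoint m \<beta> K \<phi>))"
    unfolding gle_adjoint_eq[OF schwartz_borel[OF \<phi>]]
  proof (rule tempered_dist_of_bounded)
    show "cmod (of_real (- m) * vderiv \<phi> t + of_real \<beta> * kconv (- 1) \<phi> t) \<le> m * B1 + \<beta> * B2" for t
    proof (rule norm_triangle_le)
      show "cmod (of_real (- m) * vderiv \<phi> t) + cmod (of_real \<beta> * kconv (- 1) \<phi> t) \<le> m * B1 + \<beta> * B2"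
        using B1[of t] B2[of t] m_pos \<beta>_pos by (simp add: norm_mult add_mono)
    qed
  qed measurable
qed

text \<open>Puts the tested equation into \<open>Dom \<nu>\<close>. The domain condition in the
  definition of a weak solution concerns the causal convolution, with multiplier
  \<open>KH w\<close>, whereas the adjoint has \<open>KH (- w)\<close>; the two are conjugate and
  have equal modulus. The derivative term is a Schwartz function and thus square integrable for
  \<nu>.\<close>

lemma gle_symbol_mult_fourier_square_integrable:
  assumes \<nu>: "spectral_measure \<nu>" and dom: "dist_of (conv (K_plus K) \<phi>) \<in> Dom \<nu>" and \<phi>: "schwartz \<phi>"
  shows "integrable \<nu> (\<lambda>w. (cmod (gle_symbol w * fourier \<phi> w))\<^sup>2)"
proof -
  have s: "sets \<nu> = sets borel" and ac: "absolutely_continuous lborel \<nu>" using \<nu>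
      by (simp_all add: spectral_measure_def)
  note [measurable_cong] = s
  note \<phi>' = schwartz_vderiv[OF \<phi>]
  note [measurable] = schwartz_borel[OF \<phi>]
  \<comment> \<open>Absolute continuity turns Lebesgue null sets, namely the ambiguity of the
    representative \<open>h\<close> and the frequency 0, into \<nu>-null sets.\<close>
  have ae: "AE x in \<nu>. P x" if "AE x in lborel. P x" for P
    by (rule absolutely_continuous_AE[OF _ ac that]) (simp add: s)
  obtain h where h: "fourier_is_fun (dist_of (kconv 1 \<phi>)) h" "integrable \<nu> (\<lambda>w. (cmod (h w))\<^sup>2)"
    using dom by (auto simp: Dom_def conv_K_plus)
  have [measurable]: "h \<in> borel_measurable borel" using h by (simp add: fourier_is_fun_def)
  have "AE w in \<nu>. h w = KH (1 * w) * fourier \<phi> w"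
    by (intro ae fourier_is_fun_unique[OF h(1) fourier_is_fun_kconv[OF \<phi>]]) simp
  moreover have "AE w in \<nu>. w \<noteq> 0" by (rule ae[OF AE_lborel_singleton])
  ultimately have le: "AE w in \<nu>. norm ((cmod (gle_symbol w * fourier \<phi> w))\<^sup>2)
     \<le> norm (2 * m\<^sup>2 * (cmod (fourier (vderiv \<phi>) w))\<^sup>2 + 2 * \<beta>\<^sup>2 * (cmod (h w))\<^sup>2)"
  proof eventually_elim
    case (elim w)
    have "cmod (gle_symbol w * fourier \<phi> w) \<le> m * cmod (fourier (vderiv \<phi>) w) + \<beta> * cmod (h w)"
    proof -
      have "gle_symbol w * fourier \<phi> w = - of_real m * fourier (vderiv \<phi>) w
          + of_real \<beta> * (KH (- w) * fourier \<phi> w)"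
        by (simp add: gle_symbol_def fourier_vderiv[OF \<phi>] algebra_simps)
      also have "cmod \<dots> \<le> cmod (- of_real m * fourier (vderiv \<phi>) w)
          + cmod (of_real \<beta> * (KH (- w) * fourier \<phi> w))"
        by (rule norm_triangle_ineq)
      also have "\<dots> = m * cmod (fourier (vderiv \<phi>) w) + \<beta> * cmod (h w)"
        using elim m_pos \<beta>_pos by (simp add: norm_mult KH_uminus)
      finally show ?thesis .
    qed
    then have "(cmod (gle_symbol w * fourier \<phi> w))\<^sup>2 \<le> (m * cmod (fourier (vderiv \<phi>) w) + \<beta> * cmod (h w))\<^sup>2"
      by (intro power_mono) auto
    also have "\<dots> \<le> 2 * m\<^sup>2 * (cmod (fourier (vderiv \<phi>) w))\<^sup>2 + 2 * \<beta>\<^sup>2 * (cmod (h w))\<^sup>2"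
      using sum_squares_bound[of "m * cmod (fourier (vderiv \<phi>) w)" "\<beta> * cmod (h w)"]
      by (simp add: power2_sum power_mult_distrib)
    finally show ?case by simp
  qed
  show ?thesis
  proof (rule Bochner_Integration.integrable_bound[OF _ _ le])
    show "integrable \<nu> (\<lambda>w. 2 * m\<^sup>2 * (cmod (fourier (vderiv \<phi>) w))\<^sup>2 + 2 * \<beta>\<^sup>2 * (cmod (h w))\<^sup>2)"
      by (intro Bochner_Integration.integrable_add integrable_mult_right spectral_measure_schwartz[OF \<nu>
          schwartz_fourier[OF \<phi>']] h(2))
  qed measurable
qed

text \<open>Evenness splits \<open>K\<close> into \<open>k\<close> and its reflection. Their
  pairings with the Gaussian produce \<open>KH (- w)\<close> and \<open>KH w\<close>, whose sum is
  twice the real part.\<close>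

lemma integral_K_gaussian:
  "(LINT t|lebesgue. of_real (real_of_ereal (K t)) * of_real (sqrt pi * exp (- (x - t)\<^sup>2 / 4)))
    = (LINT w|lborel. of_real (2 * Re (KH w)) * (iexp (x * w) * of_real (exp (- w\<^sup>2))))"
proof -
  define G :: "real \<Rightarrow> complex" where "G = (\<lambda>t. of_real (sqrt pi * exp (- (x - t)\<^sup>2 / 4)))"
  define \<Psi> where "\<Psi> = (\<lambda>w. iexp (x * w) * complex_of_real (exp (- w\<^sup>2)))"
  have [measurable]: "G \<in> borel_measurable borel" "\<Psi> \<in> borel_measurable borel" by (simp_all add: G_def \<Psi>_def)
  have \<Psi>: "cmod (\<Psi> w) \<le> 1 / (1 + w\<^sup>2)" for w
    using exp_neg_le_inverse[of "w\<^sup>2"] by (simp add: \<Psi>_def norm_mult)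
  define c where "c = sqrt pi * (4 * (2 * (1 + x\<^sup>2)))"
  have G': "cmod (G t) \<le> c / (1 + t\<^sup>2)" for t
  proof -
    have "exp (- (x - t)\<^sup>2 / 4) \<le> 1 / (1 + (x - t)\<^sup>2 / 4)" using exp_neg_le_inverse[of "(x - t)\<^sup>2 / 4"] by simp
    also have "\<dots> \<le> 4 * (1 / (1 + (x - t)\<^sup>2))"
      by (simp add: divide_simps add_pos_nonneg)
    also have "\<dots> \<le> 4 * (2 * (1 + x\<^sup>2) / (1 + t\<^sup>2))" by (intro mult_left_mono cauchy_shift_le) simp
    finally have "sqrt pi * exp (- (x - t)\<^sup>2 / 4) \<le> sqrt pi * (4 * (2 * (1 + x\<^sup>2) / (1 + t\<^sup>2)))"
      by (rule mult_left_mono) simp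
    then show ?thesis by (simp add: G_def c_def norm_mult)
  qed
  have Geq: "G u = (LINT w|lborel. iexp (- 1 * u * w) * \<Psi> w)" for u
  proof -
    have "(LINT w|lborel. iexp (- 1 * u * w) * \<Psi> w)
        = (LINT w|lborel. iexp (w * (x - u)) * of_real (exp (- w\<^sup>2)))"
      by (intro Bochner_Integration.integral_cong refl) (simp add: \<Psi>_def algebra_simps flip: exp_add)
    then show ?thesis using has_bochner_integral_integral_eq[OF has_bochner_integral_iexp_gaussian'[of "x - u"]]
      by (simp add: G_def)
  qed
  have i: "integrable lborel (\<lambda>u. of_real (k u) * F u)"
    if [measurable]: "F \<in> borel_measurable borel" and F: "\<And>u. cmod (F u) \<le> c / (1 + u\<^sup>2)" for F
  proof (rule Bochner_Integration.integrable_bound[OF k_cauchy_integrable[of c]])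
    show "AE u in lborel. norm (of_real (k u) * F u) \<le> norm (k u * (c / (1 + u\<^sup>2)))"
    proof (rule AE_I2)
      fix u
      have "norm (of_real (k u) * F u) \<le> k u * (c / (1 + u\<^sup>2))"
        using mult_left_mono[OF F[of u] k_nonneg[of u]] by (simp add: norm_mult k_nonneg)
      then show "norm (of_real (k u) * F u) \<le> norm (k u * (c / (1 + u\<^sup>2)))"
        unfolding real_norm_def by (rule order_trans[OF _ abs_ge_self])
    qed
  qed measurable
  have G'': "cmod (G (- u)) \<le> c / (1 + u\<^sup>2)" for u using G'[of "- u"] by simp
  have Geq': "G (- u) = (LINT w|lborel. iexp (1 * u * w) * \<Psi> w)" for u using Geq[of "- u"] by simp
  have iR: "integrable lborel (\<lambda>u. of_real (k (- u)) * G u)"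
    using lborel_integrable_real_affine[OF i[OF _ G''], of "- 1" 0] by simp
  have eR: "(LINT u|lborel. of_real (k (- u)) * G u) = (LINT u|lborel. of_real (k u) * G (- u))"
    using lborel_integral_real_affine[of "- 1" "\<lambda>u. of_real (k u) * G (- u)" 0] by simp
  \<comment> \<open>At \<open>t = 0\<close> the two halves overlap and \<open>k\<close> would be
    counted twice; that point is discarded as a null set.\<close>
  have ae: "AE t in lborel. k t + k (- t) = real_of_ereal (K t)"
  proof -
    have "AE t in lborel. 0 \<le> - t \<longrightarrow> k (- t) = real_of_ereal (K (- t))"
    proof -
      have "AE t in distr lborel borel uminus. 0 \<le> t \<longrightarrow> k t = real_of_ereal (K t)"
        using k_eq_K by (simp only: lborel_distr_uminus)
      from AE_distrD[OF _ this] show ?thesis by simp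
    qed
    with k_eq_K AE_lborel_singleton[of 0] show ?thesis
    proof eventually_elim
      case (elim t)
      then show ?case using k_neg[of t] k_neg[of "- t"] by (cases "0 \<le> t") (auto simp: K_even)
    qed
  qed
  have "(LINT t|lebesgue. of_real (real_of_ereal (K t)) * G t) = (LINT t|lebesgue. of_real (k t) * G t
      + of_real (k (- t)) * G t)"
  proof (rule integral_cong_AE)
    note [measurable] = K_measurable
    have [measurable]: "G \<in> borel_measurable lebesgue" by (rule measurable_completion) simp
    show "(\<lambda>t. of_real (real_of_ereal (K t)) * G t) \<in> borel_measurable lebesgue" by measurable
    show "(\<lambda>t. of_real (k t) * G t + of_real (k (- t)) * G t) \<in> borel_measurable lebesgue"
      by (rule measurable_completion) simp
    show "AE t in lebesgue. of_real (real_of_ereal (K t)) * G t = of_real (k t) * G t + of_real (k (- t)) * G t"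
      using AE_completion[OF ae] by eventually_elim (simp flip: distrib_right of_real_add)
  qed
  also have "\<dots> = (LINT t|lborel. of_real (k t) * G t + of_real (k (- t)) * G t)"
    by (rule integral_completion) simp
  also have "\<dots> = (LINT t|lborel. of_real (k t) * G t) + (LINT t|lborel. of_real (k t) * G (- t))"
    by (subst Bochner_Integration.integral_add[OF i[OF _ G'] iR]) (simp_all only: eR \<open>G \<in> _\<close>)
  also have "\<dots> = (LINT w|lborel. KH (- 1 * w) * \<Psi> w) + (LINT w|lborel. KH (1 * w) * \<Psi> w)"
    by (subst KH_pairing_signed(1)[OF _ \<Psi> Geq G'], simp, simp,
        subst KH_pairing_signed(1)[OF _ \<Psi> Geq' G''], simp_all)
  also have "\<dots> = (LINT w|lborel. KH (- 1 * w) * \<Psi> w + KH (1 * w) * \<Psi> w)"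
    by (rule Bochner_Integration.integral_add[symmetric])
       (rule KH_pairing_signed(2)[OF _ \<Psi> Geq G'], simp, simp,
        rule KH_pairing_signed(2)[OF _ \<Psi> Geq' G''], simp, simp)
  also have "\<dots> = (LINT w|lborel. of_real (2 * Re (KH w)) * \<Psi> w)"
  proof (rule integral_cong_AE)
    show "AE w in lborel. KH (- 1 * w) * \<Psi> w + KH (1 * w) * \<Psi> w = of_real (2 * Re (KH w)) * \<Psi> w"
      using AE_lborel_singleton[of 0]
    proof eventually_elim
      case (elim w)
      have "KH (- 1 * w) + KH (1 * w) = of_real (2 * Re (KH w))"
        using elim complex_add_cnj[of "KH w"] by (simp add: KH_uminus add.commute)
      then show ?case by (simp only: distrib_right[symmetric])
    qed
  qed measurable
  finally show ?thesis by (simp only: G_def \<Psi>_def)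
qed

end

section \<open>Asymptotics of Fejer-type integrals\<close>

text \<open>\<open>t\<^sup>2 * fejer (t * w)\<close> is the squared modulus of the transform of the
  indicator of \<open>[0, t]\<close>. Division by zero makes the value at 0 equal to 0, while the
  continuous extension would be 1.\<close>

definition fejer :: "real \<Rightarrow> real" where
  "fejer x = 2 * (1 - cos x) / x\<^sup>2"

lemma fejer_borel [measurable]: "fejer \<in> borel_measurable borel"
  unfolding fejer_def[abs_def] by measurable

lemma fejer_nonneg: "0 \<le> fejer x"
  by (simp add: fejer_def)

lemma fejer_le_1: "fejer x \<le> 1"
proof -
  have "1 - cos x = 2 * (sin (x / 2))\<^sup>2" using cos_double_sin[of "x / 2"] by simp
  moreover have "(sin (x / 2))\<^sup>2 \<le> (x / 2)\<^sup>2"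
    using abs_sin_x_le_abs_x[of "x / 2"] by (simp only: abs_le_square_iff)
  ultimately have "2 * (1 - cos x) \<le> x\<^sup>2" by (simp add: power2_eq_square)
  then show ?thesis by (auto simp: fejer_def divide_le_eq)
qed

lemma fejer_le_inverse_square: "fejer x \<le> 4 / x\<^sup>2"
proof -
  have "1 - cos x \<le> 2" using cos_ge_minus_one[of x] by linarith
  then have "2 * (1 - cos x) \<le> 4" by (rule order_trans[OF mult_left_mono]) simp_all
  then show ?thesis unfolding fejer_def by (rule divide_right_mono) simp
qed

text \<open>Integration by parts gives the antiderivative \<open>Si x - (1 - cos x) / x\<close>,
  which runs from 0 to \<open>pi / 2\<close> on the half line. Evenness and the factor 2 in
  \<open>fejer\<close> each double the value.\<close>

lemma has_bochner_integral_fejer: "has_bochner_integral lborel fejer (2 * pi)"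
proof -
  let ?f = "\<lambda>x::real. (1 - cos x) / x\<^sup>2" and ?F = "\<lambda>x::real. Si x - (1 - cos x) / x"
  have D: "DERIV ?F x :> ?f x" if "0 < x" for x
    using that by (auto intro!: derivative_eq_intros DERIV_Si[THEN DERIV_cong] simp: power2_eq_square
        field_simps)
  have C: "isCont ?f x" if "0 < x" for x using that by (intro continuous_intros) auto
  have "(Si \<longlongrightarrow> Si 0) (at_right 0)"
    using isCont_Si[of 0] by (simp add: isCont_def filterlim_at_split)
  moreover have "Si 0 = 0" by (simp add: Si_def zero_ereal_def)
  moreover have "((\<lambda>x::real. (1 - cos x) / x) \<longlongrightarrow> 0) (at_right 0)" by real_asymp
  ultimately have L0: "(?F \<longlongrightarrow> 0 - 0) (at_right 0)" by (intro tendsto_diff) auto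
  have "((\<lambda>x::real. (1 - cos x) / x) \<longlongrightarrow> 0) at_top"
  proof (rule Lim_null_comparison)
    show "\<forall>\<^sub>F x in at_top. norm ((1 - cos x) / x) \<le> 2 / x"
      using eventually_gt_at_top[of "0::real"]
      by eventually_elim (use cos_ge_minus_one in \<open>auto simp: divide_right_mono intro!: divide_right_mono\<close>)
    show "((\<lambda>x::real. 2 / x) \<longlongrightarrow> 0) at_top" by real_asymp
  qed
  then have L1: "(?F \<longlongrightarrow> pi / 2 - 0) at_top" by (intro tendsto_diff Si_at_top)
  have FTC: "set_integrable lborel (einterval 0 \<infinity>) ?f" "(LBINT x=0..\<infinity>. ?f x) = (pi / 2 - 0) - (0 - 0)"
  proof -
    have L0': "((?F \<circ> real_of_ereal) \<longlongrightarrow> 0 - 0) (at_right 0)"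
      using L0 by (simp only: zero_ereal_def ereal_tendsto_simps)
    have L1': "((?F \<circ> real_of_ereal) \<longlongrightarrow> pi / 2 - 0) (at_left \<infinity>)"
      using L1 by (simp only: ereal_tendsto_simps)
    show "set_integrable lborel (einterval 0 \<infinity>) ?f" "(LBINT x=0..\<infinity>. ?f x) = (pi / 2 - 0) - (0 - 0)"
      by (rule interval_integral_FTC_nonneg[OF _ _ _ _ L0' L1'];
          use D C in \<open>simp add: zero_ereal_def\<close>)+
  qed
  have "has_bochner_integral lborel (\<lambda>x. indicator {0..} x *\<^sub>R ?f x) (pi / 2)"
  proof -
    have "(\<lambda>x. indicator {0..} x *\<^sub>R ?f x) = (\<lambda>x. indicator (einterval 0 \<infinity>) x *\<^sub>R ?f x)"
      by (rule ext) (auto simp: einterval_def zero_ereal_def split: split_indicator)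
    then show ?thesis using FTC
      by (simp add: has_bochner_integral_iff set_integrable_def interval_lebesgue_integral_def
          set_lebesgue_integral_def)
  qed
  from has_bochner_integral_even_function[OF this]
  have "has_bochner_integral lborel ?f pi" by simp
  from has_bochner_integral_mult_right[OF this, of 2]
  show ?thesis by (simp add: fejer_def[abs_def])
qed

lemma abs_ln_le_inverse_sqrt:
  fixes x :: real assumes "0 < x" "x \<le> 1" shows "\<bar>ln x\<bar> \<le> 2 * x powr (- 1 / 2)"
proof -
  have p: "x powr (- 1 / 2) > 0" using assms by simp
  have "\<bar>ln x\<bar> = - ln x" using assms by simp
  also have "\<dots> = 2 * ln (x powr (- 1 / 2))" using assms by (simp add: ln_powr)
  also have "\<dots> \<le> 2 * x powr (- 1 / 2)" using ln_bound[OF p] by simp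
  finally show ?thesis .
qed

lemma ln_le_sqrt:
  fixes x :: real assumes "1 \<le> x" shows "\<bar>ln x\<bar> \<le> 2 * x powr (1 / 2)"
proof -
  have p: "x powr (1 / 2) > 0" using assms by simp
  have "\<bar>ln x\<bar> = 2 * ln (x powr (1 / 2))" using assms by (simp add: ln_powr)
  also have "\<dots> \<le> 2 * x powr (1 / 2)" using ln_bound[OF p] by simp
  finally show ?thesis .
qed

lemma integrable_even_powr_tail: "integrable lborel (\<lambda>x::real. indicator {1..} \<bar>x\<bar> * \<bar>x\<bar> powr (- 3 / 2))"
proof (rule integrable_even_extension)
  show "set_integrable lborel {1::real..} (\<lambda>x. x powr (- 3 / 2))"
    by (rule integrable_lborel_if_nonneg_has_integral)
       (auto intro!: has_integral_integrable[OF has_integral_powr_to_inf])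
qed auto

lemma integrable_fejer_ln: "integrable lborel (\<lambda>x. fejer x * (1 + \<bar>ln \<bar>x\<bar>\<bar>))"
proof -
  have 1: "integrable lborel (\<lambda>x::real. indicator {0..1} \<bar>x\<bar> * \<bar>x\<bar> powr (- 1 / 2))"
    by (rule integrable_even_extension)
       (auto intro!: integrable_lborel_if_nonneg_has_integral integrable_on_powr_from_0)
  \<comment> \<open>Up to 1 the kernel is at most 1 and
    \<open>1 + \<bar>ln y\<bar> \<le> 3 * y powr (- 1 / 2)\<close>; beyond 1 the product is at most
    \<open>4 / y\<^sup>2\<close> times \<open>3 * y powr (1 / 2)\<close>.\<close>
  let ?b = "\<lambda>x::real. 3 * (indicator {0..1} \<bar>x\<bar> * \<bar>x\<bar> powr (- 1 / 2))
      + 12 * (indicator {1..} \<bar>x\<bar> * \<bar>x\<bar> powr (- 3 / 2))"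
  have b: "integrable lborel ?b"
    by (intro Bochner_Integration.integrable_add integrable_mult_right 1 integrable_even_powr_tail)
  show ?thesis
  proof (rule Bochner_Integration.integrable_bound[OF b])
    show "AE x in lborel. norm (fejer x * (1 + \<bar>ln \<bar>x\<bar>\<bar>)) \<le> norm (?b x)"
      using AE_lborel_singleton[of 0]
    proof eventually_elim
      case (elim x)
      define y where "y = \<bar>x\<bar>"
      have y: "0 < y" using elim by (simp add: y_def)
      have "fejer x * (1 + \<bar>ln y\<bar>) \<le> ?b x"
      proof (cases "y \<le> 1")
        case True
        have "1 \<le> y powr (- 1 / 2)" using y True by (simp add: powr_minus_divide powr_le1)
        then have "1 + \<bar>ln y\<bar> \<le> 3 * y powr (- 1 / 2)" using abs_ln_le_inverse_sqrt[OF y True] by linarith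
        then have "fejer x * (1 + \<bar>ln y\<bar>) \<le> 1 * (3 * y powr (- 1 / 2))"
          by (intro mult_mono fejer_le_1) (auto simp: fejer_nonneg)
        then show ?thesis using True y by (simp add: add_increasing2 flip: y_def)
      next
        case False
        have "1 \<le> y powr (1 / 2)" using False by (simp add: ge_one_powr_ge_zero)
        then have "1 + \<bar>ln y\<bar> \<le> 3 * y powr (1 / 2)" using ln_le_sqrt[of y] False by linarith
        moreover have "fejer x \<le> 4 * y powr (- 2)"
          using fejer_le_inverse_square[of x] y by (simp add: y_def powr_minus powr_numeral divide_inverse)
        ultimately have "fejer x * (1 + \<bar>ln y\<bar>) \<le> (4 * y powr (- 2)) * (3 * y powr (1 / 2))"
          by (intro mult_mono) (auto simp: fejer_nonneg)
        also have "\<dots> = 12 * (y powr (- 2) * y powr (1 / 2))" by simp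
        also have "y powr (- 2) * y powr (1 / 2) = y powr (- 3 / 2)"
          by (subst powr_add[symmetric]) simp
        finally show ?thesis using False by (simp add: add_increasing flip: y_def)
      qed
      moreover have "0 \<le> fejer x * (1 + \<bar>ln y\<bar>)" by (simp add: fejer_nonneg)
      ultimately show ?case by (simp add: y_def)
    qed
  qed measurable
qed

text \<open>After the substitution \<open>x = t w\<close>, the density is within \<open>O((1 + \<bar>ln \<bar>x\<bar>\<bar>) / ln\<^sup>2 t)\<close> of
  \<open>c / ln t\<close> as long as \<open>\<bar>x\<bar> < sqrt t\<close>; the range \<open>\<bar>x\<bar> \<ge> sqrt t\<close> contributes less by the decay of the Fejer kernel. On compact
  frequency sets away from 0 no pointwise bound on \<open>r\<close> is needed, only its integrability.\<close>

theorem fejer_integral_asymp: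
  fixes r :: "real \<Rightarrow> real" and c \<delta> R C2 Cr :: real
  assumes [measurable]: "r \<in> borel_measurable borel" and r0: "\<And>w. 0 \<le> r w"
    and c: "0 \<le> c" and \<delta>: "0 < \<delta>" "\<delta> \<le> exp (- 1)"
    and small: "\<And>w. w \<noteq> 0 \<Longrightarrow> \<bar>w\<bar> \<le> \<delta> \<Longrightarrow> \<bar>r w - c / ln (1 / \<bar>w\<bar>)\<bar> \<le> C2 / (ln (1 / \<bar>w\<bar>))\<^sup>2"
    and large: "\<And>w. R \<le> \<bar>w\<bar> \<Longrightarrow> r w \<le> Cr" and Cr: "0 \<le> Cr" and C2: "0 \<le> C2"
    and mid: "integrable lborel (\<lambda>w. indicator {-R..R} w * r w)"
  shows "\<forall>\<^sub>F t in at_top. integrable lborel (\<lambda>w. r w * (t\<^sup>2 * fejer (t * w)))"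
    and "(\<lambda>t. \<bar>(LINT w|lborel. r w * (t\<^sup>2 * fejer (t * w))) / (t / ln t) - 2 * pi * c\<bar>) \<in> O(\<lambda>t. inverse \<bar>ln t\<bar>)"
proof -
  let ?I = "\<lambda>t. LINT w|lborel. r w * (t\<^sup>2 * fejer (t * w))"
  \<comment> \<open>For \<open>\<bar>x\<bar> < sqrt t\<close> the logarithm \<open>L\<close> at
    frequency \<open>x / t\<close> is at least \<open>ln t / 2\<close>. Squaring turns
    \<open>C2\<close> into \<open>4 * C2\<close>, and the comparison of \<open>c / L\<close> with
    \<open>c / ln t\<close> contributes \<open>2 * c\<close>.\<close>
  define E where "E = 4 * C2 + 2 * c"
  \<comment> \<open>A crude bound on the deviation of \<open>r\<close> from \<open>c / ln t\<close>
    at frequencies at most \<delta> or at least \<open>R\<close>, used where the Fejer kernel itself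
    is small.\<close>
  define E' where "E' = 2 * c + C2 + Cr"
  define J where "J = (LINT x|lborel. fejer x * (1 + \<bar>ln \<bar>x\<bar>\<bar>))"
  define Z where "Z = (LINT x|lborel. indicator {1..} \<bar>x\<bar> * \<bar>x\<bar> powr (- 3 / 2) :: real)"
  define \<rho> where "\<rho> = (LINT w|lborel. indicator {-R..R} w * r w)"
  have EE: "0 \<le> E" "0 \<le> E'" using c C2 Cr by (simp_all add: E_def E'_def)
  \<comment> \<open>\<open>exp 1 \<le> t\<close> ensures \<open>1 \<le> ln t\<close>;
    \<open>1 / \<delta>\<^sup>2 \<le> t\<close> ensures that \<open>\<bar>x\<bar> < sqrt t\<close>
    forces the frequency \<open>x / t\<close> below \<delta>.\<close>
  define T where "T = max (exp 1) (1 / \<delta>\<^sup>2)"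
  \<comment> \<open>One summand each for the central range, for
    \<open>\<bar>x\<bar> \<ge> sqrt t\<close>, and for the frequencies between \<delta> and
    \<open>R\<close>. The form \<open>0 + (1 / t) * x\<close> is that of the affine substitution
    rule.\<close>
  define bd where "bd = (\<lambda>t x. E / (ln t)\<^sup>2 * (fejer x * (1 + \<bar>ln \<bar>x\<bar>\<bar>))
      + 4 * E' * t powr (- 1 / 4) * (indicator {1..} \<bar>x\<bar> * \<bar>x\<bar> powr (- 3 / 2))
      + 4 / (\<delta>\<^sup>2 * t\<^sup>2) * (indicator {-R..R} (0 + (1 / t) * x) * r (0 + (1 / t) * x)))"
  let ?V = "\<lambda>t. E / (ln t)\<^sup>2 * J + 4 * E' * t powr (- 1 / 4) * Z + 4 / (\<delta>\<^sup>2 * t\<^sup>2) * (t * \<rho>)"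
  let ?T = "\<lambda>t x. 4 * E' * t powr (- 1 / 4) * (indicator {1..} \<bar>x\<bar> * \<bar>x\<bar> powr (- 3 / 2))"
  let ?M = "\<lambda>t w. 4 / (\<delta>\<^sup>2 * t\<^sup>2) * (indicator {-R..R} w * r w)"
  have main: "integrable lborel (\<lambda>w. r w * (t\<^sup>2 * fejer (t * w))) \<and>
      \<bar>?I t / (t / ln t) - 2 * pi * c\<bar>
        \<le> ln t * ?V t"
    if t: "T \<le> t" for t
  proof -
    have te: "exp 1 \<le> t" and t\<delta>: "1 / \<delta>\<^sup>2 \<le> t" using t by (simp_all add: T_def)
    have t0: "0 < t" using te exp_gt_zero less_le_trans by blast
    have "1 \<le> exp (1::real)" by simp
    then have t1: "1 \<le> t" using te by (rule order_trans)
    have lt: "1 \<le> ln t" using te t0 by (simp add: ln_ge_iff)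
    then have "t \<noteq> 1" by auto
    have sq\<delta>: "1 / sqrt t \<le> \<delta>"
    proof -
      have "1 / \<delta> \<le> sqrt t" using t\<delta> \<delta>(1) real_le_rsqrt[of "1 / \<delta>" t] by (simp add: power_divide)
      then show ?thesis using \<delta>(1) t0 by (simp add: divide_le_eq mult.commute)
    qed
    have bd_int: "integrable lborel (bd t)" and bd_val: "(LINT x|lborel. bd t x) = ?V t"
    proof -
      have i3: "integrable lborel (\<lambda>x. indicator {-R..R} (0 + (1 / t) * x) * r (0 + (1 / t) * x))"
        by (rule lborel_integrable_real_affine[OF mid]) (use t0 in simp)
      have "\<rho> = \<bar>1 / t\<bar> *\<^sub>R (LINT x|lborel. indicator {-R..R} (0 + (1 / t) * x) * r (0 + (1 / t) * x))"
        unfolding \<rho>_def by (rule lborel_integral_real_affine) (use t0 in simp)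
      then have v3: "(LINT x|lborel. indicator {-R..R} (0 + (1 / t) * x) * r (0 + (1 / t) * x)) = t * \<rho>"
        using t0 by simp
      show "integrable lborel (bd t)" unfolding bd_def
        by (intro Bochner_Integration.integrable_add integrable_mult_right i3 integrable_fejer_ln
            integrable_even_powr_tail)
      show "(LINT x|lborel. bd t x) = ?V t"
        unfolding bd_def
        by (subst Bochner_Integration.integral_add, (intro Bochner_Integration.integrable_add
            integrable_mult_right i3 integrable_fejer_ln integrable_even_powr_tail)+,
            subst Bochner_Integration.integral_add, (intro Bochner_Integration.integrable_add
                integrable_mult_right i3 integrable_fejer_ln integrable_even_powr_tail)+,
            simp only: integral_mult_right_zero v3 J_def Z_def)
    qed
    have bound: "\<bar>fejer x * (r (0 + (1 / t) * x) - c / ln t)\<bar> \<le> bd t x" if x: "x \<noteq> 0" for x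
    proof -
      define w where "w = 0 + (1 / t) * x"
      define L where "L = ln (1 / \<bar>w\<bar>)"
      have w: "w \<noteq> 0" "\<bar>w\<bar> = \<bar>x\<bar> / t" using x t0 by (simp_all add: w_def abs_mult)
      have L: "L = ln t - ln \<bar>x\<bar>" unfolding L_def w(2) using x t0 by (simp add: ln_div)
      have p1: "0 \<le> E / (ln t)\<^sup>2 * (fejer x * (1 + \<bar>ln \<bar>x\<bar>\<bar>))" using EE by (simp add: fejer_nonneg)
      have p2: "0 \<le> ?T t x" using EE by simp
      have p3: "0 \<le> ?M t w" using r0 by simp
      have cl: "c / ln t \<le> c" "0 \<le> c / ln t" using c lt by (simp_all add: divide_le_eq mult_le_cancel_left1)
      have small_bound: "L \<ge> 1" if "\<bar>w\<bar> \<le> \<delta>"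
      proof -
        have "\<bar>w\<bar> \<le> exp (- 1)" using that \<delta>(2) by linarith
        then have "ln \<bar>w\<bar> \<le> ln (exp (- 1))" using w(1) by (subst ln_le_cancel_iff) auto
        then show ?thesis using w(1) by (simp add: L_def ln_div)
      qed
      show ?thesis
      proof (cases "\<bar>x\<bar> < sqrt t")
        case True
        have "\<bar>x\<bar> / t \<le> sqrt t / t" using True t0 by (intro divide_right_mono) auto
        also have "\<dots> = 1 / sqrt t" using t0 sqrt_divide_self_eq[of t] by (simp add: inverse_eq_divide)
        finally have w\<delta>: "\<bar>w\<bar> \<le> \<delta>" using sq\<delta> w(2) by linarith
        have "ln \<bar>x\<bar> \<le> ln (sqrt t)" using True x t0 by (subst ln_le_cancel_iff) auto
        then have Lt: "ln t / 2 \<le> L" using t0 by (simp add: L ln_sqrt)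
        have L0: "0 < L" using Lt lt by linarith
        have "\<bar>r w - c / L\<bar> \<le> C2 / L\<^sup>2" using small[OF w(1) w\<delta>] by (simp add: L_def)
        also have "\<dots> \<le> C2 / (ln t / 2)\<^sup>2"
          using Lt lt C2 by (intro divide_left_mono power_mono mult_pos_pos zero_less_power) auto
        also have "\<dots> = 4 * C2 / (ln t)\<^sup>2" by (simp add: power_divide)
        finally have e1: "\<bar>r w - c / L\<bar> \<le> 4 * C2 / (ln t)\<^sup>2" .
        have "\<bar>c / L - c / ln t\<bar> = \<bar>c * (ln t - L) / (L * ln t)\<bar>"
          using L0 lt by (simp add: field_simps)
        also have "\<dots> = c * \<bar>ln \<bar>x\<bar>\<bar> / (L * ln t)" using L0 lt c by (simp add: L abs_mult)
        also have "\<dots> \<le> c * \<bar>ln \<bar>x\<bar>\<bar> / ((ln t / 2) * ln t)"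
          using Lt lt c L0 by (intro divide_left_mono mult_right_mono mult_pos_pos mult_nonneg_nonneg) auto
        also have "\<dots> = 2 * c * \<bar>ln \<bar>x\<bar>\<bar> / (ln t)\<^sup>2" by (simp add: power2_eq_square)
        finally have e2: "\<bar>c / L - c / ln t\<bar> \<le> 2 * c * \<bar>ln \<bar>x\<bar>\<bar> / (ln t)\<^sup>2" .
        have "\<bar>r w - c / ln t\<bar> \<le> 4 * C2 / (ln t)\<^sup>2 + 2 * c * \<bar>ln \<bar>x\<bar>\<bar> / (ln t)\<^sup>2" using e1 e2 by linarith
        also have "\<dots> = (4 * C2 + 2 * c * \<bar>ln \<bar>x\<bar>\<bar>) / (ln t)\<^sup>2" by (simp add: add_divide_distrib)
        also have "\<dots> \<le> (E * (1 + \<bar>ln \<bar>x\<bar>\<bar>)) / (ln t)\<^sup>2"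
          using c C2 by (intro divide_right_mono) (auto simp: E_def algebra_simps)
        finally have "fejer x * \<bar>r w - c / ln t\<bar> \<le> fejer x * ((E * (1 + \<bar>ln \<bar>x\<bar>\<bar>)) / (ln t)\<^sup>2)"
          by (rule mult_left_mono) (rule fejer_nonneg)
        also have "\<dots> = E / (ln t)\<^sup>2 * (fejer x * (1 + \<bar>ln \<bar>x\<bar>\<bar>))" by simp
        finally have "\<bar>fejer x * (r w - c / ln t)\<bar> \<le> E / (ln t)\<^sup>2 * (fejer x * (1 + \<bar>ln \<bar>x\<bar>\<bar>))"
          by (simp only: abs_mult abs_of_nonneg[OF fejer_nonneg])
        then show ?thesis unfolding bd_def w_def[symmetric] using p2 p3 by linarith
      next
        case False
        have x1: "1 \<le> \<bar>x\<bar>" using False t1 by (smt (verit) real_sqrt_ge_1_iff)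
        have xt: "t powr (1 / 2) \<le> \<bar>x\<bar>" using False t0 by (simp add: powr_half_sqrt)
        \<comment> \<open>Half a power of \<open>\<bar>x\<bar>\<close> is spent on the small factor
          \<open>t powr (- 1 / 4)\<close>; the remaining \<open>\<bar>x\<bar> powr (- 3 / 2)\<close>
          is still integrable at infinity.\<close>
        have "4 / x\<^sup>2 = 4 * (\<bar>x\<bar> powr (- 1 / 2) * \<bar>x\<bar> powr (- 3 / 2))"
        proof -
          have "\<bar>x\<bar> powr (- 1 / 2) * \<bar>x\<bar> powr (- 3 / 2) = \<bar>x\<bar> powr (- 2)"
            by (subst powr_add[symmetric]) simp
          also have "\<dots> = 1 / x\<^sup>2" using x1 by (simp add: powr_minus powr_numeral divide_inverse)
          finally show ?thesis by simp
        qed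
        also have "\<bar>x\<bar> powr (- 1 / 2) \<le> (t powr (1 / 2)) powr (- 1 / 2)"
          using xt t0 by (intro powr_mono2') auto
        also have "(t powr (1 / 2)) powr (- 1 / 2) = t powr (- 1 / 4)" by (simp add: powr_powr)
        finally have q2: "4 / x\<^sup>2 \<le> 4 * (t powr (- 1 / 4) * \<bar>x\<bar> powr (- 3 / 2))" by (simp add: mult_right_mono)
        have gen: "fejer x * y \<le> ?T t x" if "0 \<le> y" "y \<le> E'" for y
        proof -
          have "fejer x * y \<le> (4 * (t powr (- 1 / 4) * \<bar>x\<bar> powr (- 3 / 2))) * E'"
            using order_trans[OF fejer_le_inverse_square q2] that by (intro mult_mono) auto
          then show ?thesis using x1 by (simp add: mult_ac)
        qed
        have "fejer x * \<bar>r w - c / ln t\<bar> \<le> ?T t x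
            + ?M t w"
        proof -
          \<comment> \<open>No order between \<delta> and \<open>R\<close> is assumed; if
            \<open>R \<le> \<delta>\<close> the middle case is empty.\<close>
          consider "\<bar>w\<bar> \<le> \<delta>" | "\<delta> < \<bar>w\<bar>" "\<bar>w\<bar> \<le> R" | "R \<le> \<bar>w\<bar>" by linarith
          then show ?thesis
          proof cases
            case 1
            note L1 = small_bound[OF 1]
            have "\<bar>r w - c / L\<bar> \<le> C2 / L\<^sup>2" using small[OF w(1) 1] by (simp add: L_def)
            moreover have "C2 / L\<^sup>2 \<le> C2" "0 \<le> c / L" "c / L \<le> c"
              using L1 C2 c by (simp_all add: divide_le_eq mult_le_cancel_left1)
            ultimately have "\<bar>r w - c / ln t\<bar> \<le> E'" using cl r0[of w] Cr C2 unfolding E'_def by linarith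
            from gen[OF _ this] show ?thesis using p3 by simp
          next
            case 2
            have "fejer x * \<bar>r w - c / ln t\<bar> \<le> fejer x * (c + r w)"
              using cl r0[of w] by (intro mult_left_mono fejer_nonneg) linarith
            also have "\<dots> = fejer x * c + fejer x * r w" by (simp add: distrib_left)
            also have "\<dots> \<le> ?T t x + 4 / (\<delta>\<^sup>2 * t\<^sup>2) * r w"
            proof (rule add_mono)
              show "fejer x * c \<le> ?T t x"
                using c C2 Cr by (intro gen) (auto simp: E'_def)
              have "\<delta> * t \<le> \<bar>x\<bar>" using 2(1) t0 w(2) by (simp add: field_simps)
              then have "(\<delta> * t)\<^sup>2 \<le> \<bar>x\<bar>\<^sup>2" using \<delta>(1) t0 by (intro power_mono) auto
              then have "4 / x\<^sup>2 \<le> 4 / (\<delta>\<^sup>2 * t\<^sup>2)"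
                using \<delta>(1) t0 x by (intro divide_left_mono) (auto simp: power_mult_distrib)
              then show "fejer x * r w \<le> 4 / (\<delta>\<^sup>2 * t\<^sup>2) * r w"
                using fejer_le_inverse_square[of x] r0 by (intro mult_right_mono) auto
            qed
            finally show ?thesis using 2 by (simp add: abs_le_iff)
          next
            case 3
            have "\<bar>r w - c / ln t\<bar> \<le> E'" using large[OF 3] cl r0[of w] c C2 unfolding E'_def by linarith
            from gen[OF _ this] show ?thesis using p3 by simp
          qed
        qed
        then have "\<bar>fejer x * (r w - c / ln t)\<bar> \<le> ?T t x
            + ?M t w"
          by (simp only: abs_mult abs_of_nonneg[OF fejer_nonneg])
        then show ?thesis unfolding bd_def w_def[symmetric] using p1 by linarith
      qed
    qed
    let ?d = "\<lambda>x. fejer x * (r (0 + (1 / t) * x) - c / ln t)"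
    have d_int: "integrable lborel ?d"
    proof (rule Bochner_Integration.integrable_bound[OF bd_int])
      show "AE x in lborel. norm (?d x) \<le> norm (bd t x)"
        unfolding real_norm_def using AE_lborel_singleton[of 0]
        by eventually_elim (rule order_trans[OF bound abs_ge_self])
    qed measurable
    note fi = has_bochner_integral_fejer[unfolded has_bochner_integral_iff]
    have sum_eq: "fejer x * r (0 + (1 / t) * x) = ?d x + c / ln t * fejer x" for x by (simp add: algebra_simps)
    have f_int: "integrable lborel (\<lambda>x. fejer x * r (0 + (1 / t) * x))"
      unfolding sum_eq using d_int fi by (intro Bochner_Integration.integrable_add integrable_mult_right) auto
    have f_val: "(LINT x|lborel. fejer x * r (0 + (1 / t) * x)) = (LINT x|lborel. ?d x) + c / ln t * (2 * pi)"
      unfolding sum_eq using fi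
      by (subst Bochner_Integration.integral_add[OF d_int integrable_mult_right]) simp_all
    have d_le: "\<bar>LINT x|lborel. ?d x\<bar> \<le> (LINT x|lborel. bd t x)"
    proof -
      have "\<bar>LINT x|lborel. ?d x\<bar> \<le> (LINT x|lborel. \<bar>?d x\<bar>)" by (rule integral_abs_bound)
      also have "\<dots> \<le> (LINT x|lborel. bd t x)"
      proof (rule integral_mono_AE)
        show "AE x in lborel. \<bar>?d x\<bar> \<le> bd t x"
          using AE_lborel_singleton[of 0] by eventually_elim (rule bound)
      qed (use d_int bd_int in auto)
      finally show ?thesis .
    qed
    have orig: "r w * (t\<^sup>2 * fejer (t * w)) = t\<^sup>2 * (fejer (0 + t * w) * r (0 + (1 / t) * (0 + t * w)))" for w
      using t0 by simp
    have "integrable lborel (\<lambda>w. r w * (t\<^sup>2 * fejer (t * w)))"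
      unfolding orig by (intro integrable_mult_right lborel_integrable_real_affine[OF f_int]) (use t0 in simp)
    moreover have "?I t = t * (LINT x|lborel. fejer x * r (0 + (1 / t) * x))"
    proof -
      have "(LINT x|lborel. fejer x * r (0 + (1 / t) * x)) = \<bar>t\<bar> *\<^sub>R (LINT w|lborel. fejer (0
          + t * w) * r (0 + (1 / t) * (0 + t * w)))"
        by (rule lborel_integral_real_affine) (use t0 in simp)
      then show ?thesis unfolding orig integral_mult_right_zero using t0 by (simp add: power2_eq_square)
    qed
    then have "?I t / (t / ln t) - 2 * pi * c = ln t * (LINT x|lborel. ?d x)"
      unfolding f_val using t0 \<open>t \<noteq> 1\<close> by (simp add: field_simps)
    moreover have "\<bar>ln t * (LINT x|lborel. ?d x)\<bar> \<le> ln t * ?V t"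
      unfolding abs_mult using lt d_le bd_val by (intro mult_mono) auto
    ultimately show ?thesis by simp
  qed
  show "\<forall>\<^sub>F t in at_top. integrable lborel (\<lambda>w. r w * (t\<^sup>2 * fejer (t * w)))"
    using eventually_ge_at_top[of T] by eventually_elim (use main in blast)
  have "(\<lambda>t. \<bar>?I t / (t / ln t) - 2 * pi * c\<bar>)
      \<in> O(\<lambda>t. ln t * ?V t)"
  proof (rule bigoI[of _ 1])
    show "\<forall>\<^sub>F t in at_top. norm \<bar>?I t / (t / ln t) - 2 * pi * c\<bar>
      \<le> 1 * norm (ln t * ?V t)"
      using eventually_ge_at_top[of T]
    proof eventually_elim
      case (elim t)
      then show ?case using main[OF elim] by (simp only: real_norm_def mult_1 abs_idempotent) (meson
          abs_ge_self order_trans)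
    qed
  qed
  also have "(\<lambda>t::real. ln t * ?V t)
     \<in> O(\<lambda>t. inverse \<bar>ln t\<bar>)"
  proof -
    \<comment> \<open>After multiplication by \<open>ln t\<close> the central term is of exact order
      \<open>1 / ln t\<close> and fixes the rate; the other two gain powers of
      \<open>t\<close>.\<close>
    have a: "(\<lambda>t::real. ln t * (E / (ln t)\<^sup>2 * J)) \<in> O(\<lambda>t. inverse \<bar>ln t\<bar>)"
    proof (rule bigoI[of _ "\<bar>E * J\<bar>"])
      show "\<forall>\<^sub>F t in at_top. norm (ln t * (E / (ln t)\<^sup>2 * J)) \<le> \<bar>E * J\<bar> * norm (inverse \<bar>ln t\<bar> :: real)"
      proof (intro always_eventually allI)
        fix t :: real
        show "norm (ln t * (E / (ln t)\<^sup>2 * J)) \<le> \<bar>E * J\<bar> * norm (inverse \<bar>ln t\<bar> :: real)"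
          by (cases "ln t = 0") (simp_all add: abs_mult power2_eq_square field_simps)
      qed
    qed
    have b: "(\<lambda>t::real. ln t * t powr (- 1 / 4)) \<in> O(\<lambda>t. inverse \<bar>ln t\<bar>)" by real_asymp
    have d: "(\<lambda>t::real. ln t / t) \<in> O(\<lambda>t. inverse \<bar>ln t\<bar>)" by real_asymp
    have "(\<lambda>t::real. ln t * (E / (ln t)\<^sup>2 * J) + 4 * E' * Z * (ln t * t powr (- 1 / 4))
        + 4 * \<rho> / \<delta>\<^sup>2 * (ln t / t)) \<in> O(\<lambda>t. inverse \<bar>ln t\<bar>)"
      by (intro sum_in_bigo a) (use b d in \<open>simp_all only: cmult_in_bigo_iff simp_thms\<close>)
    moreover have "\<forall>\<^sub>F t::real in at_top. ln t * (E / (ln t)\<^sup>2 * J) + 4 * E' * Z * (ln t * t powr (- 1 / 4))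
        + 4 * \<rho> / \<delta>\<^sup>2 * (ln t / t)
       = ln t * ?V t"
      using eventually_gt_at_top[of 0] by eventually_elim (simp add: algebra_simps power2_eq_square)
    ultimately show ?thesis by (rule landau_o.big.in_cong[THEN iffD1, rotated])
  qed
  finally show "(\<lambda>t. \<bar>?I t / (t / ln t) - 2 * pi * c\<bar>) \<in> O(\<lambda>t. inverse \<bar>ln t\<bar>)" .
qed

section \<open>The mean-square displacement\<close>

lemma norm_iexp_minus_1_sq: "(cmod (iexp y - 1))\<^sup>2 = 2 * (1 - cos y)"
proof -
  have "(cmod (iexp y - 1))\<^sup>2 = (cos y - 1)\<^sup>2 + (sin y)\<^sup>2"
    by (simp only: iexp_eq_cos_sin cmod_power2) simp
  also have "\<dots> = 2 * (1 - cos y)"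
    using sin_cos_squared_add[of y] by (simp add: power2_eq_square algebra_simps)
  finally show ?thesis .
qed

lemma integrable_indicator_ivl: "integrable lborel (indicator {a..b::real} :: real \<Rightarrow> complex)"
proof -
  have "(indicator {a..b} :: real \<Rightarrow> complex) = (\<lambda>x. indicator {a..b} x *\<^sub>R 1)"
    by (rule ext) (simp split: split_indicator)
  then show ?thesis using set_integrable_const_ivl[of a b "1::complex"]
    by (simp only: set_integrable_def)
qed

lemma norm_fourier_indicator_sq:
  assumes t: "0 \<le> t" and w: "w \<noteq> 0"
  shows "(cmod (fourier (indicator {0..t}) w))\<^sup>2 = t\<^sup>2 * fejer (t * w)"
proof -
  have "(LINT s|lborel. indicator {0..t} s *\<^sub>R iexp (s * w)) = iexp (t * w) / (\<i> * w) - iexp (0 * w) / (\<i> * w)"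
  proof (rule integral_FTC_Icc[OF t])
    fix x
    have "((\<lambda>z. exp (\<i> * of_real w * z) / (\<i> * w)) has_field_derivative iexp (x * w)) (at (of_real x))"
      using w by (auto intro!: derivative_eq_intros simp: mult_ac)
    from has_vector_derivative_real_field[OF this]
    show "((\<lambda>s. iexp (s * w) / (\<i> * w)) has_vector_derivative iexp (x * w)) (at x within {0..t})"
      by (simp add: mult_ac has_vector_derivative_at_within)
  qed (intro continuous_intros)
  moreover have "iexp (s * w) * indicator {0..t} s = indicator {0..t} s *\<^sub>R iexp (s * w)" for s
    by (simp split: split_indicator)
  moreover have "fourier (indicator {0..t}) w = (LINT s|lborel. iexp (s * w) * indicator {0..t} s)"
    by (rule fourier_lborel) measurable
  ultimately have "fourier (indicator {0..t}) w = iexp (t * w) / (\<i> * w) - iexp (0 * w) / (\<i> * w)"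
    by (simp only:)
  then have "fourier (indicator {0..t}) w = (iexp (t * w) - 1) / (\<i> * w)"
    by (simp add: diff_divide_distrib)
  then have "(cmod (fourier (indicator {0..t}) w))\<^sup>2 = (cmod (iexp (t * w) - 1))\<^sup>2 / w\<^sup>2"
    by (simp only: norm_divide power_divide norm_mult norm_of_real) simp
  also have "\<dots> = t\<^sup>2 * fejer (t * w)"
    unfolding norm_iexp_minus_1_sq using w by (cases "t = 0") (simp_all add: fejer_def power_mult_distrib)
  finally show ?thesis .
qed

context gle_kernel
begin

text \<open>The value at 0, where \<open>KH\<close> is arbitrary, is set to 0 so that nonnegativity
  holds everywhere.\<close>

definition spec_density :: "real \<Rightarrow> real" where
  "spec_density \<omega> = (if \<omega> = 0 then 0 else \<beta> * Re (KH \<omega>) / (pi * (cmod (gle_symbol \<omega>))\<^sup>2))"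

lemma spec_density_borel [measurable]: "spec_density \<in> borel_measurable borel"
  unfolding spec_density_def[abs_def] by measurable

lemma spec_density_nonneg: "0 \<le> spec_density w"
  using Re_KH_pos[of w] \<beta>_pos
  by (cases "w = 0") (simp_all add: spec_density_def zero_le_divide_iff zero_le_mult_iff less_imp_le)

text \<open>The weights make both sides finite measures, and the hypothesis says that their characteristic
  functions agree.\<close>

lemma spectral_density_unique:
  assumes \<nu>: "spectral_measure \<nu>"
    and int: "integrable \<nu> (\<lambda>w. (cmod (gle_symbol w))\<^sup>2 * exp (- w\<^sup>2))"
    and eq: "\<And>x. (LINT w|\<nu>. of_real (2 * pi * ((cmod (gle_symbol w))\<^sup>2 * exp (- w\<^sup>2))) * iexp (x * w))
       = of_real \<beta> * (LINT w|lborel. of_real (2 * Re (KH w)) * (iexp (x * w) * of_real (exp (- w\<^sup>2))))"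
  shows "\<nu> = density lborel spec_density"
proof -
  have s: "sets \<nu> = sets borel" and ac: "absolutely_continuous lborel \<nu>" using \<nu>
      by (simp_all add: spectral_measure_def)
  note [measurable_cong] = s
  have ae: "AE w in \<nu>. w \<noteq> 0"
    by (rule absolutely_continuous_AE[OF _ ac AE_lborel_singleton]) (simp add: s)
  define W1 where "W1 = (\<lambda>w. 2 * pi * ((cmod (gle_symbol w))\<^sup>2 * exp (- w\<^sup>2)))"
  \<comment> \<open>The cut at 0 matters only at \<open>w = 0\<close>, where the sign of
    \<open>Re (KH w)\<close> is unknown.\<close>
  define W2 where "W2 = (\<lambda>w. max 0 (2 * \<beta> * Re (KH w) * exp (- w\<^sup>2)))"
  have [measurable]: "W1 \<in> borel_measurable borel" "W2 \<in> borel_measurable borel"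
      by (simp_all add: W1_def W2_def)
  have W1_0: "0 \<le> W1 w" and W2_0: "0 \<le> W2 w" for w by (simp_all add: W1_def W2_def)
  have W1_int: "integrable \<nu> W1" unfolding W1_def using int by (rule integrable_mult_right)
  have W2_AE: "AE w in lborel. W2 w = 2 * \<beta> * Re (KH w) * exp (- w\<^sup>2)"
    using AE_lborel_singleton[of 0] by eventually_elim (use Re_KH_pos \<beta>_pos in \<open>simp add: W2_def less_imp_le\<close>)
  have W2_int: "integrable lborel W2"
  proof -
    have "integrable lborel (\<lambda>w. KH w * of_real (exp (- w\<^sup>2)))"
      by (rule KH_mult_integrable[where c = 1]) (use exp_neg_le_inverse in auto)
    then have "integrable lborel (\<lambda>w. max 0 (2 * \<beta> * Re (KH w * of_real (exp (- w\<^sup>2)))))"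
      by (intro integrable_max integrable_mult_right integrable_Re) auto
    then show ?thesis by (simp add: W2_def mult.assoc)
  qed
  have fin: "finite_measure (density \<mu> W)" if "integrable \<mu> W" "\<And>w. 0 \<le> W w" "sets \<mu> = sets borel" for \<mu>
      and W :: "real \<Rightarrow> real"
  proof (rule finite_measureI)
    have "emeasure (density \<mu> W) (space (density \<mu> W)) = (\<integral>\<^sup>+w. ennreal (W w) \<partial>\<mu>)"
      using that by (subst emeasure_density) (auto intro!: nn_integral_cong)
    also have "\<dots> = ennreal (LINT w|\<mu>. W w)" using that by (intro nn_integral_eq_integral) auto
    finally show "emeasure (density \<mu> W) (space (density \<mu> W)) \<noteq> \<infinity>" by simp
  qed
  have M_eq: "density \<nu> W1 = density lborel W2"
  proof (rule finite_measure_eqI_char)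
    show "finite_measure (density \<nu> W1)" "finite_measure (density lborel W2)"
      by (intro fin W1_int W2_int W1_0 W2_0; simp add: s)+
    fix x
    have "char (density \<nu> W1) x = (LINT w|\<nu>. of_real (W1 w) * iexp (x * w))"
      unfolding char_def by (subst integral_density) (auto simp: W1_0 scaleR_conv_of_real)
    also have "\<dots> = (LINT w|lborel. of_real \<beta> * (of_real (2 * Re (KH w)) * (iexp (x * w) * of_real (exp (-
        w\<^sup>2)))))"
      using eq[of x] by (simp only: W1_def integral_mult_right_zero)
    also have "\<dots> = (LINT w|lborel. W2 w *\<^sub>R iexp (x * w))"
    proof (rule integral_cong_AE)
      show "AE w in lborel. of_real \<beta> * (of_real (2 * Re (KH w)) * (iexp (x * w) * of_real (exp (- w\<^sup>2))))
          = W2 w *\<^sub>R iexp (x * w)"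
        using W2_AE by eventually_elim (simp add: scaleR_conv_of_real mult_ac)
    qed measurable
    also have "\<dots> = char (density lborel W2) x"
      unfolding char_def by (subst integral_density) (auto simp: W2_0)
    finally show "char (density \<nu> W1) x = char (density lborel W2) x" .
  qed (simp_all add: s)
  \<comment> \<open>The weight \<open>W1\<close> can be divided out again: the multiplier has no
    zero away from 0, and \<nu> does not charge the point 0.\<close>
  have "\<nu> = density \<nu> (\<lambda>_. 1)" by (simp add: density_1)
  also have "\<dots> = density \<nu> (\<lambda>w. ennreal (W1 w) * ennreal (1 / W1 w))"
  proof (rule density_cong)
    show "AE w in \<nu>. 1 = ennreal (W1 w) * ennreal (1 / W1 w)"
      using ae
    proof eventually_elim
      case (elim w)
      then have "0 < W1 w" using gle_symbol_nonzero by (simp add: W1_def)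
      then show ?case by (simp flip: ennreal_mult)
    qed
  qed measurable
  also have "\<dots> = density (density \<nu> W1) (\<lambda>w. ennreal (1 / W1 w))"
    by (rule density_density_eq[symmetric]) measurable
  also have "\<dots> = density lborel (\<lambda>w. ennreal (W2 w) * ennreal (1 / W1 w))"
    unfolding M_eq by (rule density_density_eq) measurable
  also have "\<dots> = density lborel spec_density"
  proof (rule density_cong)
    show "AE w in lborel. ennreal (W2 w) * ennreal (1 / W1 w) = ennreal (spec_density w)"
      using W2_AE AE_lborel_singleton[of 0]
    proof eventually_elim
      case (elim w)
      then have "W2 w * (1 / W1 w) = spec_density w"
        using gle_symbol_nonzero[of w] by (simp add: W1_def spec_density_def field_simps)
      then show ?case using W1_0[of w] W2_0[of w] by (simp flip: ennreal_mult)
    qed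
  qed measurable
  finally show ?thesis .
qed

text \<open>The weak equation is tested with \<open>exp (- (t - x)\<^sup>2 / 2)\<close> against \<open>exp (- t\<^sup>2 / 2)\<close>: the translation by \<open>x\<close>
  becomes the phase of a characteristic function, and all convolutions are explicit.\<close>

lemma weak_solution_spectral_density:
  assumes noise: "noise N K F" and sol: "weak_solution m \<beta> K N F M V"
  shows "spectral_operator M (density lborel spec_density) V"
proof -
  obtain \<nu> where op: "spectral_operator M \<nu> V"
    and dom: "\<And>\<phi>. schwartz \<phi> \<Longrightarrow> dist_of (conv (K_plus K) \<phi>) \<in> Dom \<nu>"
    and eqn: "\<And>\<phi> \<psi>. schwartz \<phi> \<Longrightarrow> schwartz \<psi> \<Longrightarrow>
       cov M (V (dist_of (gle_adjoint m \<beta> K \<phi>))) (V (dist_of (gle_adjoint m \<beta> K \<psi>))) =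
       cov N (\<lambda>w. of_real (sqrt \<beta>) * F \<phi> w) (\<lambda>w. of_real (sqrt \<beta>) * F \<psi> w)"
    using sol unfolding weak_solution_def by blast
  have \<nu>: "spectral_measure \<nu>" using op by (simp add: spectral_operator_def)
  have s: "sets \<nu> = sets borel" using \<nu> by (simp_all add: spectral_measure_def)
  note [measurable_cong] = s
  define \<phi> :: "real \<Rightarrow> real \<Rightarrow> complex" where "\<phi> = (\<lambda>x t. of_real (exp (- (t - x)\<^sup>2 / 2)))"
  have \<phi>: "schwartz (\<phi> x)" for x unfolding \<phi>_def by (rule schwartz_shifted_gaussian)
  have F\<phi>: "fourier (\<phi> x) \<omega> = of_real (sqrt (2 * pi)) * iexp (x * \<omega>) * of_real (exp (- \<omega>\<^sup>2 / 2))" for x \<omega>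
    unfolding \<phi>_def by (rule fourier_shifted_gaussian)
  have sqint: "integrable \<nu> (\<lambda>\<omega>. (cmod (gle_symbol \<omega> * fourier (\<phi> x) \<omega>))\<^sup>2)" for x
    by (rule gle_symbol_mult_fourier_square_integrable[OF \<nu> dom[OF \<phi>] \<phi>])
  \<comment> \<open>The covariance formula for \<open>V\<close> holds only on the domain, so this
    membership has to precede any use of the equation.\<close>
  have inDom: "dist_of (gle_adjoint m \<beta> K (\<phi> x)) \<in> Dom \<nu>" for x
    using fourier_is_fun_gle_adjoint[OF \<phi>] sqint unfolding Dom_def by blast
  have gauss2: "exp (- \<omega>\<^sup>2 / 2) * exp (- \<omega>\<^sup>2 / 2) = exp (- \<omega>\<^sup>2)" for \<omega> :: real by (simp flip: exp_add)
  have pi2: "sqrt (2 * pi) * sqrt (2 * pi) = 2 * pi" by simp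
  \<comment> \<open>The two Gaussian transforms supply the factor \<open>2 * pi\<close> and the
    weight \<open>exp (- \<omega>\<^sup>2)\<close>; the translation survives as the phase
    alone.\<close>
  have prod: "gle_symbol \<omega> * fourier (\<phi> x) \<omega> * cnj (gle_symbol \<omega> * fourier (\<phi> 0) \<omega>)
      = of_real (2 * pi * ((cmod (gle_symbol \<omega>))\<^sup>2 * exp (- \<omega>\<^sup>2))) * iexp (x * \<omega>)" for x \<omega>
  proof -
    define a g where "a = complex_of_real (sqrt (2 * pi))" and "g = complex_of_real (exp (- \<omega>\<^sup>2 / 2))"
    have a2: "a * a = of_real (2 * pi)" unfolding a_def of_real_mult[symmetric] pi2 ..
    have g2: "g * g = of_real (exp (- \<omega>\<^sup>2))" unfolding g_def of_real_mult[symmetric] gauss2 ..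
    have "cnj (fourier (\<phi> 0) \<omega>) = a * g" unfolding F\<phi> by (simp add: a_def g_def)
    moreover have "fourier (\<phi> x) \<omega> = a * iexp (x * \<omega>) * g" unfolding F\<phi> a_def g_def ..
    ultimately have "gle_symbol \<omega> * fourier (\<phi> x) \<omega> * cnj (gle_symbol \<omega> * fourier (\<phi> 0) \<omega>)
      = (gle_symbol \<omega> * cnj (gle_symbol \<omega>)) * (a * a) * (g * g) * iexp (x * \<omega>)"
      by (simp only: complex_cnj_mult mult_ac)
    then show ?thesis unfolding a2 g2 complex_norm_square[symmetric] by (simp only: of_real_mult mult_ac)
  qed
  have "\<nu> = density lborel spec_density"
  proof (rule spectral_density_unique[OF \<nu>])
    have "integrable \<nu> (\<lambda>\<omega>. (1 / (2 * pi)) * (cmod (gle_symbol \<omega> * fourier (\<phi> 0) \<omega>))\<^sup>2)"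
      using sqint by (rule integrable_mult_right)
    also have "(\<lambda>\<omega>. (1 / (2 * pi)) * (cmod (gle_symbol \<omega> * fourier (\<phi> 0) \<omega>))\<^sup>2)
        = (\<lambda>\<omega>. (cmod (gle_symbol \<omega>))\<^sup>2 * exp (- \<omega>\<^sup>2))"
    proof
      fix \<omega>
      have "complex_of_real ((cmod (gle_symbol \<omega> * fourier (\<phi> 0) \<omega>))\<^sup>2)
          = of_real (2 * pi * ((cmod (gle_symbol \<omega>))\<^sup>2 * exp (- \<omega>\<^sup>2)))"
        using prod[of \<omega> 0] by (simp only: complex_norm_square) simp
      then have "(cmod (gle_symbol \<omega> * fourier (\<phi> 0) \<omega>))\<^sup>2 = 2 * pi * ((cmod (gle_symbol \<omega>))\<^sup>2 * exp (- \<omega>\<^sup>2))"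
        by (simp only: of_real_eq_iff)
      then show "(1 / (2 * pi)) * (cmod (gle_symbol \<omega> * fourier (\<phi> 0) \<omega>))\<^sup>2
          = (cmod (gle_symbol \<omega>))\<^sup>2 * exp (- \<omega>\<^sup>2)" by simp
    qed
    finally show "integrable \<nu> (\<lambda>\<omega>. (cmod (gle_symbol \<omega>))\<^sup>2 * exp (- \<omega>\<^sup>2))" .
    fix x
    have conv_eq: "conv (\<phi> x) (\<lambda>s. cnj (\<phi> 0 (- s))) t = of_real (sqrt pi * exp (- (x - t)\<^sup>2 / 4))" for t
    proof -
      have "conv (\<phi> x) (\<lambda>s. cnj (\<phi> 0 (- s))) t
          = (LINT u|lebesgue. complex_of_real (exp (- (u - x)\<^sup>2 / 2) * exp (- (u - t)\<^sup>2 / 2)))"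
        by (simp add: conv_def \<phi>_def power2_commute[of t])
      also have "\<dots> = (LINT u|lborel. complex_of_real (exp (- (u - x)\<^sup>2 / 2) * exp (- (u - t)\<^sup>2 / 2)))"
        by (rule integral_completion) measurable
      finally show ?thesis by (simp only: integral_gaussian_product)
    qed
    have "(LINT \<omega>|\<nu>. of_real (2 * pi * ((cmod (gle_symbol \<omega>))\<^sup>2 * exp (- \<omega>\<^sup>2))) * iexp (x * \<omega>))
      = (LINT \<omega>|\<nu>. gle_symbol \<omega> * fourier (\<phi> x) \<omega> * cnj (gle_symbol \<omega> * fourier (\<phi> 0) \<omega>))"
      by (simp only: prod)
    also have "\<dots> = cov M (V (dist_of (gle_adjoint m \<beta> K (\<phi> x)))) (V (dist_of (gle_adjoint m \<beta> K (\<phi> 0))))"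
      using op inDom[of x] inDom[of 0] fourier_is_fun_gle_adjoint(1)[OF \<phi>, of x]
          fourier_is_fun_gle_adjoint(1)[OF \<phi>, of 0]
      unfolding spectral_operator_def by simp
    also have "\<dots> = cov N (\<lambda>w. of_real (sqrt \<beta>) * F (\<phi> x) w) (\<lambda>w. of_real (sqrt \<beta>) * F (\<phi> 0) w)"
      by (rule eqn[OF \<phi> \<phi>])
    also have "\<dots> = (LINT w|N. of_real \<beta> * (F (\<phi> x) w * cnj (F (\<phi> 0) w)))"
    proof -
      have "of_real (sqrt \<beta>) * of_real (sqrt \<beta>) = complex_of_real \<beta>"
        using \<beta>_pos by (simp flip: of_real_mult)
      then have "of_real (sqrt \<beta>) * a * cnj (of_real (sqrt \<beta>) * b) = of_real \<beta> * (a * cnj b)" for a b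
        by (simp add: mult_ac)
      then show ?thesis by (simp only: cov_def)
    qed
    also have "\<dots> = of_real \<beta> * cov N (F (\<phi> x)) (F (\<phi> 0))"
      by (simp only: cov_def integral_mult_right_zero)
    also have "cov N (F (\<phi> x)) (F (\<phi> 0))
        = (LINT t|lebesgue. of_real (real_of_ereal (K t)) * conv (\<phi> x) (\<lambda>s. cnj (\<phi> 0 (- s))) t)"
      using noise \<phi> by (simp add: noise_def)
    also have "\<dots> = (LINT \<omega>|lborel. of_real (2 * Re (KH \<omega>)) * (iexp (x * \<omega>) * of_real (exp (- \<omega>\<^sup>2))))"
      unfolding conv_eq by (rule integral_K_gaussian)
    finally show "(LINT \<omega>|\<nu>. of_real (2 * pi * ((cmod (gle_symbol \<omega>))\<^sup>2 * exp (- \<omega>\<^sup>2))) * iexp (x * \<omega>))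
       = of_real \<beta> * (LINT \<omega>|lborel. of_real (2 * Re (KH \<omega>)) * (iexp (x * \<omega>) * of_real (exp (- \<omega>\<^sup>2))))" .
  qed
  then show ?thesis using op by simp
qed

text \<open>The assumption \<open>int\<close> is what puts the indicator of \<open>[0, t]\<close>
  into the domain; the asymptotic lemma for Fejer integrals supplies it for large
  \<open>t\<close>.\<close>

lemma msd_eq:
  assumes op: "spectral_operator M (density lborel spec_density) V" and t: "0 \<le> t"
    and int: "integrable lborel (\<lambda>\<omega>. spec_density \<omega> * (t\<^sup>2 * fejer (t * \<omega>)))"
  shows "msd M V t = (LINT \<omega>|lborel. spec_density \<omega> * (t\<^sup>2 * fejer (t * \<omega>)))"
proof -
  let ?\<nu> = "density lborel spec_density"
  let ?g = "indicator {0..t} :: real \<Rightarrow> complex"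
  have [measurable]: "fourier ?g \<in> borel_measurable borel" by (rule fourier_borel) measurable
  have ae: "AE \<omega> in lborel. spec_density \<omega> * (cmod (fourier ?g \<omega>))\<^sup>2 = spec_density \<omega> * (t\<^sup>2 * fejer (t * \<omega>))"
    using AE_lborel_singleton[of 0] by eventually_elim (simp add: norm_fourier_indicator_sq[OF t])
  have i: "integrable ?\<nu> (\<lambda>\<omega>. (cmod (fourier ?g \<omega>))\<^sup>2)"
    by (subst integrable_density) (use int ae in \<open>auto simp: spec_density_nonneg intro: integrable_cong_AE_imp\<close>)
  have v: "(LINT \<omega>|?\<nu>. (cmod (fourier ?g \<omega>))\<^sup>2) = (LINT \<omega>|lborel. spec_density \<omega> * (t\<^sup>2 * fejer (t * \<omega>)))"
    by (subst integral_density) (use ae in \<open>auto simp: spec_density_nonneg intro!: integral_cong_AE\<close>)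
  have f: "fourier_is_fun (dist_of ?g) (fourier ?g)"
    by (rule fourier_is_fun_integrable[OF integrable_indicator_ivl])
  have "tempered_distribution (dist_of ?g)"
    by (rule tempered_dist_of_bounded[where B = 1]) (auto split: split_indicator)
  then have "dist_of ?g \<in> Dom ?\<nu>" using f i by (auto simp: Dom_def)
  then have "cov M (V (dist_of ?g)) (V (dist_of ?g)) = (LINT \<omega>|?\<nu>. fourier ?g \<omega> * cnj (fourier ?g \<omega>))"
    using op f unfolding spectral_operator_def by blast
  then have "complex_of_real (LINT w|M. (cmod (V (dist_of ?g) w))\<^sup>2)
      = of_real (LINT \<omega>|?\<nu>. (cmod (fourier ?g \<omega>))\<^sup>2)"
    by (simp only: cov_def complex_norm_square[symmetric] integral_complex_of_real)
  then show ?thesis by (simp only: of_real_eq_iff msd_def position_def v)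
qed

text \<open>Inertia dominates: the transform of the kernel is bounded for
  \<open>\<bar>w\<bar> \<ge> 1\<close>, while the imaginary part of the multiplier contains
  \<open>m * w\<close>.\<close>

lemma spec_density_large: "\<exists>R Cr. 0 \<le> Cr \<and> (\<forall>w. R \<le> \<bar>w\<bar> \<longrightarrow> spec_density w \<le> Cr)"
proof -
  define X where "X = KB + 2 * (C + D)"
  have X: "0 \<le> X" using KB_nonneg C_pos D_nonneg by (simp add: X_def)
  \<comment> \<open>Chosen to give \<open>m * \<bar>w\<bar> \<ge> 1 + \<beta> * X\<close>, hence a
    multiplier of modulus at least 1.\<close>
  define R where "R = max 1 ((1 + \<beta> * X) / m)"
  have "spec_density w \<le> \<beta> * X / pi" if w: "R \<le> \<bar>w\<bar>" for w
  proof -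
    have w1: "1 \<le> \<bar>w\<bar>" "(1 + \<beta> * X) / m \<le> \<bar>w\<bar>" using w by (simp_all add: R_def)
    then have "w \<noteq> 0" by auto
    have "1 \<le> sqrt \<bar>w\<bar>" using w1 by simp
    then have "2 * (C + D) / sqrt \<bar>w\<bar> \<le> 2 * (C + D)"
      using C_pos D_nonneg by (simp add: divide_le_eq mult_le_cancel_left1)
    then have KX: "cmod (KH w) \<le> X" using norm_KH_le[OF \<open>w \<noteq> 0\<close>] unfolding X_def by (rule_tac order_trans) auto
    have "1 + \<beta> * X \<le> m * \<bar>w\<bar>" using w1(2) m_pos by (simp add: divide_le_eq mult.commute)
    moreover have "\<bar>\<beta> * Im (KH w)\<bar> \<le> \<beta> * X"
      using order_trans[OF abs_Im_le_cmod KX] \<beta>_pos by (simp add: abs_mult)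
    moreover have "\<bar>m * w\<bar> = m * \<bar>w\<bar>" using m_pos by (simp add: abs_mult)
    ultimately have "1 \<le> \<bar>m * w - \<beta> * Im (KH w)\<bar>" by linarith
    then have "1 \<le> cmod (gle_symbol w)" using abs_Im_le_cmod[of "gle_symbol w"] Im_gle_symbol[OF \<open>w \<noteq> 0\<close>]
        by simp
    then have S1: "1 \<le> (cmod (gle_symbol w))\<^sup>2" by (simp add: one_le_power)
    have "spec_density w = (\<beta> * Re (KH w) / pi) / (cmod (gle_symbol w))\<^sup>2" using \<open>w \<noteq> 0\<close>
        by (simp add: spec_density_def)
    also have "\<dots> \<le> (\<beta> * Re (KH w) / pi) / 1"
      using S1 Re_KH_pos[OF \<open>w \<noteq> 0\<close>] \<beta>_pos by (intro divide_left_mono) auto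
    also have "\<dots> \<le> \<beta> * X / pi"
      using order_trans[OF complex_Re_le_cmod KX] \<beta>_pos by (simp add: divide_right_mono)
    finally show ?thesis .
  qed
  moreover have "0 \<le> \<beta> * X / pi" using X \<beta>_pos by simp
  ultimately show ?thesis by blast
qed

text \<open>Two comparisons through \<open>1 / (pi * \<beta> * R)\<close>, where \<open>R\<close> is
  the real part of the transform. Dropping the bounded imaginary part of the multiplier costs
  \<open>O(1 / L ^ 3)\<close>; replacing \<open>R\<close> by \<open>C * L\<close> costs
  \<open>O(1 / L\<^sup>2)\<close>.\<close>

lemma spec_density_small:
  obtains \<delta> C2 where "0 < \<delta>" "\<delta> \<le> exp (- 1)" "0 \<le> C2"
    "\<And>w. w \<noteq> 0 \<Longrightarrow> \<bar>w\<bar> \<le> \<delta> \<Longrightarrow> \<bar>spec_density w - (1 / (pi * \<beta> * C)) / ln (1 / \<bar>w\<bar>)\<bar> \<le> C2 / (ln (1 / \<bar>w\<bar>))\<^sup>2"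
proof -
  obtain B where B: "0 < B" and KB: "\<And>w. w \<noteq> 0 \<Longrightarrow> \<bar>w\<bar> \<le> 1 / A \<Longrightarrow> cmod (KH w - of_real (C * ln (1 / \<bar>w\<bar>))) \<le> B"
    using KH_log_asymp by blast
  \<comment> \<open>The three constraints give \<open>1 \<le> L\<close>, then
    \<open>B \<le> C * L / 2\<close> and hence \<open>R \<ge> C * L / 2\<close>, and finally the
    range of validity of \<open>KH_log_asymp\<close>.\<close>
  define \<delta> where "\<delta> = min (exp (- max 1 (2 * B / C))) (1 / A)"
  define Q where "Q = m + \<beta> * B"
  define C2 where "C2 = 8 * Q\<^sup>2 / (pi * \<beta> ^ 3 * C ^ 3) + 2 * B / (pi * \<beta> * C\<^sup>2)"
  have \<delta>: "0 < \<delta>" "\<delta> \<le> exp (- 1)" "\<delta> \<le> 1 / A" "\<delta> \<le> exp (- (2 * B / C))"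
    using A_ge_1 by (auto simp: \<delta>_def min_le_iff_disj)
  have C2: "0 \<le> C2" using \<beta>_pos C_pos B by (simp add: C2_def)
  have "\<bar>spec_density w - (1 / (pi * \<beta> * C)) / ln (1 / \<bar>w\<bar>)\<bar> \<le> C2 / (ln (1 / \<bar>w\<bar>))\<^sup>2" if w: "w \<noteq> 0" "\<bar>w\<bar>
      \<le> \<delta>" for w
  proof -
    define L where "L = ln (1 / \<bar>w\<bar>)"
    define R where "R = Re (KH w)"
    define q where "q = m * w - \<beta> * Im (KH w)"
    have Lge: "y \<le> L" if "\<delta> \<le> exp (- y)" for y
    proof -
      have "ln \<bar>w\<bar> \<le> ln (exp (- y))" using w that by (subst ln_le_cancel_iff) auto
      then show ?thesis using w by (simp add: L_def ln_div)
    qed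
    have L1: "1 \<le> L" using Lge \<delta>(2) by simp
    have "2 * B / C \<le> L" using Lge \<delta>(4) by simp
    then have CL: "B \<le> C * L / 2" using C_pos by (simp add: field_simps)
    have KBo: "cmod (KH w - of_real (C * L)) \<le> B" using KB[OF w(1)] w(2) \<delta>(3) unfolding L_def by linarith
    have RB: "\<bar>R - C * L\<bar> \<le> B" using order_trans[OF abs_Re_le_cmod KBo] by (simp add: R_def)
    have IB: "\<bar>Im (KH w)\<bar> \<le> B" using order_trans[OF abs_Im_le_cmod KBo] by simp
    have RL: "C * L / 2 \<le> R" using RB CL by linarith
    have CL0: "0 < C * L" using C_pos L1 by simp
    have R0: "0 < R" using RL CL0 by linarith
    have qQ: "q\<^sup>2 \<le> Q\<^sup>2"
    proof -
      have "exp (- 1) \<le> (1::real)" by simp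
      then have "\<bar>w\<bar> \<le> 1" using w(2) \<delta>(2) by linarith
      then have "\<bar>m * w\<bar> \<le> m" using m_pos by (simp add: abs_mult mult_le_cancel_left1)
      moreover have "\<bar>\<beta> * Im (KH w)\<bar> \<le> \<beta> * B" using IB \<beta>_pos by (simp add: abs_mult)
      ultimately have "\<bar>q\<bar> \<le> \<bar>Q\<bar>" unfolding q_def Q_def by linarith
      then show ?thesis by (simp only: abs_le_square_iff)
    qed
    have S2: "(cmod (gle_symbol w))\<^sup>2 = \<beta>\<^sup>2 * R\<^sup>2 + q\<^sup>2"
      by (simp add: cmod_power2 Re_gle_symbol[OF w(1)] Im_gle_symbol[OF w(1)] R_def q_def power_mult_distrib)
    define W where "W = \<beta>\<^sup>2 * R\<^sup>2 + q\<^sup>2"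
    have W: "\<beta>\<^sup>2 * R\<^sup>2 \<le> W" "0 < \<beta>\<^sup>2 * R\<^sup>2" "0 < W"
      using \<beta>_pos R0 by (simp_all add: W_def add_pos_nonneg)
    have spec_density: "spec_density w = \<beta> * R / (pi * W)" using w(1)
        by (simp add: spec_density_def S2 W_def R_def)
    have "1 / (pi * \<beta> * R) - spec_density w = q\<^sup>2 / (pi * \<beta> * R * W)"
    proof -
      have "1 / (pi * \<beta> * R) - spec_density w = (W - \<beta>\<^sup>2 * R\<^sup>2) / (pi * \<beta> * R * W)"
        unfolding spec_density using W(3) R0 \<beta>_pos by (simp add: field_simps power2_eq_square)
      then show ?thesis by (simp add: W_def)
    qed
    also have "\<dots> \<le> Q\<^sup>2 / (pi * \<beta> * R * (\<beta>\<^sup>2 * R\<^sup>2))"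
      using W R0 \<beta>_pos qQ by (intro frac_le mult_left_mono) auto
    also have "\<dots> = Q\<^sup>2 / (pi * \<beta> ^ 3 * R ^ 3)" by (simp add: power2_eq_square power3_eq_cube mult_ac)
    also have "\<dots> \<le> Q\<^sup>2 / (pi * \<beta> ^ 3 * (C * L / 2) ^ 3)"
      using RL CL0 \<beta>_pos by (intro divide_left_mono mult_left_mono power_mono mult_pos_pos) auto
    also have "\<dots> = 8 * Q\<^sup>2 / (pi * \<beta> ^ 3 * C ^ 3) * (1 / L ^ 3)"
      using C_pos L1 by (simp add: power_divide power_mult_distrib mult_ac)
    also have "\<dots> \<le> 8 * Q\<^sup>2 / (pi * \<beta> ^ 3 * C ^ 3) * (1 / L\<^sup>2)"
      using L1 \<beta>_pos C_pos by (intro mult_left_mono divide_left_mono power_increasing) auto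
    finally have e1: "1 / (pi * \<beta> * R) - spec_density w \<le> 8 * Q\<^sup>2 / (pi * \<beta> ^ 3 * C ^ 3) * (1 / L\<^sup>2)" .
    have e0: "0 \<le> 1 / (pi * \<beta> * R) - spec_density w"
      using \<open>1 / (pi * \<beta> * R) - spec_density w = q\<^sup>2 / (pi * \<beta> * R * W)\<close> W R0 \<beta>_pos by simp
    have "\<bar>1 / (pi * \<beta> * R) - (1 / (pi * \<beta> * C)) / L\<bar> = \<bar>(C * L - R) / (pi * \<beta> * R * (C * L))\<bar>"
      using R0 CL0 \<beta>_pos C_pos L1 by (simp add: field_simps)
    also have "\<dots> = \<bar>R - C * L\<bar> / (pi * \<beta> * R * (C * L))"
      using R0 CL0 \<beta>_pos by (simp add: abs_divide abs_minus_commute)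
    also have "\<dots> \<le> B / (pi * \<beta> * (C * L / 2) * (C * L))"
      using RB RL CL0 \<beta>_pos R0 C_pos L1 by (intro frac_le mult_right_mono mult_left_mono mult_pos_pos) auto
    also have "\<dots> = 2 * B / (pi * \<beta> * C\<^sup>2) * (1 / L\<^sup>2)" by (simp add: power2_eq_square mult_ac)
    finally have e2: "\<bar>1 / (pi * \<beta> * R) - (1 / (pi * \<beta> * C)) / L\<bar> \<le> 2 * B / (pi * \<beta> * C\<^sup>2) * (1 / L\<^sup>2)" .
    have "C2 / L\<^sup>2 = 8 * Q\<^sup>2 / (pi * \<beta> ^ 3 * C ^ 3) * (1 / L\<^sup>2) + 2 * B / (pi * \<beta> * C\<^sup>2) * (1 / L\<^sup>2)"
      unfolding C2_def by (simp add: add_divide_distrib)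
    moreover have tri: "\<bar>z - y\<bar> \<le> u + v" if "0 \<le> x - z" "x - z \<le> u" "\<bar>x - y\<bar> \<le> v" for x y z u v :: real
      using that by linarith
    ultimately show ?thesis using tri[OF e0 e1 e2] unfolding L_def[symmetric] by (simp only:)
  qed
  then show ?thesis using that \<delta>(1,2) C2 by blast
qed

text \<open>The bound comes from the growth condition on the spectral measure and not from a lower
  bound on the transform: a Gaussian is integrable for the measure and is bounded below on
  \<open>[- R, R]\<close>.\<close>

lemma spec_density_locally_integrable:
  assumes \<nu>: "spectral_measure (density lborel spec_density)"
  shows "integrable lborel (\<lambda>w. indicator {-R..R} w * spec_density w)"
proof -
  have "integrable (density lborel spec_density) (\<lambda>w. (cmod (of_real (exp (- (w - 0)\<^sup>2 / 2))))\<^sup>2)"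
    by (rule spectral_measure_schwartz[OF \<nu> schwartz_shifted_gaussian])
  also have "(\<lambda>w::real. (cmod (of_real (exp (- (w - 0)\<^sup>2 / 2))))\<^sup>2) = (\<lambda>w. exp (- w\<^sup>2))"
    by (rule ext) (simp add: power2_eq_square flip: exp_add)
  finally have i: "integrable lborel (\<lambda>w. exp (R\<^sup>2) * (spec_density w * exp (- w\<^sup>2)))"
    by (subst (asm) integrable_density) (auto simp: spec_density_nonneg intro!: integrable_mult_right)
  show ?thesis
  proof (rule Bochner_Integration.integrable_bound[OF i])
    show "AE w in lborel. norm (indicator {-R..R} w * spec_density w)
        \<le> norm (exp (R\<^sup>2) * (spec_density w * exp (- w\<^sup>2)))"
    proof (rule AE_I2)
      fix w :: real
      show "norm (indicator {-R..R} w * spec_density w) \<le> norm (exp (R\<^sup>2) * (spec_density w * exp (- w\<^sup>2)))"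
      proof (cases "w \<in> {-R..R}")
        case True
        then have "\<bar>w\<bar> \<le> R" by auto
        then have "\<bar>w\<bar>\<^sup>2 \<le> R\<^sup>2" by (intro power_mono) auto
        then have "1 \<le> exp (R\<^sup>2) * exp (- w\<^sup>2)" by (simp flip: exp_add)
        then have "spec_density w * 1 \<le> spec_density w * (exp (R\<^sup>2) * exp (- w\<^sup>2))"
            by (intro mult_left_mono spec_density_nonneg)
        then show ?thesis using True spec_density_nonneg[of w] by (simp add: abs_mult mult_ac)
      qed simp
    qed
  qed measurable
qed

theorem msd_asymp:
  assumes "noise N K F" and "weak_solution m \<beta> K N F M V"
  shows "(\<lambda>t. \<bar>msd M V t / (t / ln t) - 2 / (\<beta> * C)\<bar>) \<in> O[at_top](\<lambda>t. inverse \<bar>ln t\<bar>)"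
proof -
  let ?I = "\<lambda>t. LINT w|lborel. spec_density w * (t\<^sup>2 * fejer (t * w))"
  have op: "spectral_operator M (density lborel spec_density) V"
    by (rule weak_solution_spectral_density[OF assms])
  then have sp: "spectral_measure (density lborel spec_density)" by (simp add: spectral_operator_def)
  obtain \<delta> C2 where small: "0 < \<delta>" "\<delta> \<le> exp (- 1)" "0 \<le> C2"
    "\<And>w. w \<noteq> 0 \<Longrightarrow> \<bar>w\<bar> \<le> \<delta> \<Longrightarrow> \<bar>spec_density w - (1 / (pi * \<beta> * C)) / ln (1 / \<bar>w\<bar>)\<bar> \<le> C2 / (ln (1 / \<bar>w\<bar>))\<^sup>2"
    using spec_density_small by blast
  obtain R Cr where large: "0 \<le> Cr" "\<And>w. R \<le> \<bar>w\<bar> \<Longrightarrow> spec_density w \<le> Cr" using spec_density_large by blast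
  have c: "0 \<le> 1 / (pi * \<beta> * C)" using \<beta>_pos C_pos by simp
  \<comment> \<open>The density coefficient \<open>1 / (pi * \<beta> * C)\<close> times the Fejer
    mass \<open>2 * pi\<close> is the constant \<open>2 / (\<beta> * C)\<close> of the
    theorem.\<close>
  have asymp: "\<forall>\<^sub>F t in at_top. integrable lborel (\<lambda>w. spec_density w * (t\<^sup>2 * fejer (t * w)))"
    "(\<lambda>t. \<bar>?I t / (t / ln t) - 2 * pi * (1 / (pi * \<beta> * C))\<bar>) \<in> O(\<lambda>t. inverse \<bar>ln t\<bar>)"
    by (rule fejer_integral_asymp[OF spec_density_borel spec_density_nonneg c small(1,2) _ _ large(1)
        small(3) spec_density_locally_integrable[OF sp]];
        rule small(4) large(2); assumption)+
  have "\<forall>\<^sub>F t in at_top. msd M V t = ?I t"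
    using asymp(1) eventually_ge_at_top[of 0] by eventually_elim (rule msd_eq[OF op])
  then have "\<forall>\<^sub>F t in at_top. \<bar>?I t / (t / ln t) - 2 * pi * (1 / (pi * \<beta> * C))\<bar>
      = \<bar>msd M V t / (t / ln t) - 2 / (\<beta> * C)\<bar>"
    by eventually_elim simp
  from landau_o.big.in_cong[OF this] asymp(2) show ?thesis by blast
qed

end

section \<open>Transfer from the given kernel to a Borel kernel on the half line\<close>

context decaying_kernel
begin

lemma Re_KT: "Re (KT T w) = (LINT t:{0..T}|lborel. k t * cos (t * w))"
proof -
  have "Re (KT T w) = (LINT t|lborel. Re (indicator {0..T} t *\<^sub>R (of_real (k t) * iexp (t * w))))"
    unfolding KT_def set_lebesgue_integral_def
    using k_iexp_integrable[of 0 T w, unfolded set_integrable_def]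
    by (intro integral_Re[symmetric]) simp_all
  also have "\<dots> = (LINT t:{0..T}|lborel. k t * cos (t * w))"
    unfolding set_lebesgue_integral_def
    by (intro Bochner_Integration.integral_cong refl) (simp only: iexp_eq_cos_sin, simp)
  finally show ?thesis .
qed

end

lemma lebesgue_measurable_if_locally_integrable:
  fixes f :: "real \<Rightarrow> real"
  assumes "\<And>a b. set_integrable lebesgue {a..b} f"
  shows "f \<in> borel_measurable lebesgue"
proof (rule borel_measurable_LIMSEQ_metric)
  show "(\<lambda>x. indicator {- real n..real n} x *\<^sub>R f x) \<in> borel_measurable lebesgue" for n
    using assms[of "- real n" "real n"] unfolding set_integrable_def by (rule borel_measurable_integrable)
  show "(\<lambda>n. indicator {- real n..real n} x *\<^sub>R f x) \<longlonglongrightarrow> f x" for x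
  proof -
    obtain N where N: "\<bar>x\<bar> \<le> real N" using real_arch_simple by blast
    have "\<forall>\<^sub>F n in sequentially. indicator {- real n..real n} x *\<^sub>R f x = f x"
      using eventually_ge_at_top[of N] by eventually_elim (use N in \<open>auto split: split_indicator\<close>)
    then show ?thesis by (rule tendsto_eventually)
  qed
qed

theorem theorem2p6:
  fixes K :: "real \<Rightarrow> ereal" and m \<beta> :: real
    and N :: "'v measure" and F :: "(real \<Rightarrow> complex) \<Rightarrow> 'v \<Rightarrow> complex"
    and M :: "'w measure" and V :: "functional \<Rightarrow> 'w \<Rightarrow> complex"
  assumes "kernel K" and "cond_Ia K" and "cond_Ib K" and "cond_Ic K" and "cond_V K"
    and "m > 0" and "\<beta> > 0"
    and "noise N K F"
    and "weak_solution m \<beta> K N F M V"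
  defines "C1 \<equiv> Lim at_top (\<lambda>t. t * real_of_ereal (K t))"
  shows "(\<lambda>t. \<bar>msd M V t / (t / ln t) - 2 / (\<beta> * C1)\<bar>) \<in> O[at_top](\<lambda>t. inverse \<bar>ln t\<bar>)"
proof -
  define \<kappa> where "\<kappa> = (\<lambda>t. real_of_ereal (K t))"
  have K_fin: "\<bar>K t\<bar> \<noteq> \<infinity>" if "t \<noteq> 0" for t using assms(1) that by (auto simp: kernel_def)
  have K\<kappa>: "K t = ereal (\<kappa> t)" if "t \<noteq> 0" for t using K_fin[OF that] by (simp add: \<kappa>_def ereal_real')
  have \<kappa>_pos: "0 < \<kappa> t" if "t \<noteq> 0" for t
  proof -
    have "0 < K t" using assms(2) that by (simp add: cond_Ia_def)
    then show ?thesis using K\<kappa>[OF that] by simp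
  qed
  have \<kappa>_int: "set_integrable lebesgue {a..b} \<kappa>" for a b using assms(2) by (simp add: cond_Ia_def \<kappa>_def)
  have \<kappa>_meas: "\<kappa> \<in> borel_measurable lebesgue" by (rule lebesgue_measurable_if_locally_integrable[OF \<kappa>_int])
  obtain A0 where A0: "antimono_on {A0..} K" using assms(3) by (auto simp: cond_Ib_def)
  obtain C b where C: "0 < C" and b: "0 < b" and O: "(\<lambda>t. \<bar>t * \<kappa> t - C\<bar>) \<in> O[at_top](\<lambda>t. t powr (- b))"
    using assms(5) by (auto simp: cond_V_def \<kappa>_def)
  obtain D where D: "0 < D" and ev: "\<forall>\<^sub>F t in at_top. norm \<bar>t * \<kappa> t - C\<bar> \<le> D * norm (t powr (- b))"
    using landau_o.bigE[OF O] by blast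
  obtain A1 where A1: "\<And>t. A1 \<le> t \<Longrightarrow> norm \<bar>t * \<kappa> t - C\<bar> \<le> D * norm (t powr (- b))"
    using ev by (auto simp: eventually_at_top_linorder)
  \<comment> \<open>The power rate already forces \<open>t * \<kappa> t\<close> to converge to
    \<open>C\<close>, so the limit in the theorem is the constant of the rate condition.\<close>
  have C1: "C1 = C"
  proof -
    have "((\<lambda>t. t * \<kappa> t - C) \<longlongrightarrow> 0) at_top"
    proof (rule Lim_null_comparison)
      show "\<forall>\<^sub>F t in at_top. norm (t * \<kappa> t - C) \<le> D * t powr (- b)"
        using eventually_ge_at_top[of A1] by eventually_elim (use A1 in force)
      have "((\<lambda>t. D * t powr (- b)) \<longlongrightarrow> D * 0) at_top"
        using b by (intro tendsto_mult tendsto_const tendsto_neg_powr filterlim_ident) simp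
      then show "((\<lambda>t. D * t powr (- b)) \<longlongrightarrow> 0) at_top" by simp
    qed
    then have "((\<lambda>t. t * \<kappa> t) \<longlongrightarrow> C) at_top" by (simp add: LIM_zero_iff)
    then show ?thesis unfolding C1_def \<kappa>_def by (intro tendsto_Lim) simp_all
  qed
  define A where "A = max 1 (max A0 A1)"
  have A: "1 \<le> A" "A0 \<le> A" "A1 \<le> A" by (simp_all add: A_def)
  have \<kappa>_anti: "\<kappa> t \<le> \<kappa> s" if "A \<le> s" "s \<le> t" for s t
  proof -
    have "K t \<le> K s" using A0 A that by (auto simp: monotone_on_def)
    moreover have "s \<noteq> 0" "t \<noteq> 0" using that A by auto
    ultimately show ?thesis by (simp add: K\<kappa>)
  qed
  obtain g where g [measurable]: "g \<in> borel_measurable lborel" and g_eq: "AE t in lborel. \<kappa> t = g t"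
    using completion_ex_borel_measurable_real[OF \<kappa>_meas] by blast
  \<comment> \<open>Below \<open>A\<close> a Borel representative is taken, with
    \<open>max 0\<close> repairing the sign on the null set where it may differ from \<kappa>. From
    \<open>A\<close> on the kernel itself is kept, since monotonicity and the rate are needed at
    every point.\<close>
  define k where "k = (\<lambda>t. if t < 0 then 0 else if t < A then max 0 (g t) else \<kappa> (max A t))"
  have k_eq: "AE t in lborel. 0 \<le> t \<longrightarrow> k t = \<kappa> t"
    using g_eq AE_lborel_singleton[of 0]
  proof eventually_elim
    case (elim t)
    then have "0 < g t" using \<kappa>_pos[of t] by simp
    with elim show ?case by (auto simp: k_def max_def)
  qed
  have [measurable]: "k \<in> borel_measurable borel"
  proof -
    \<comment> \<open>Monotone functions are Borel; freezing the argument at \<open>A\<close> makes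
      the negated kernel monotone on the whole line.\<close>
    have "(\<lambda>t. - \<kappa> (max A t)) \<in> borel_measurable borel"
      by (rule borel_measurable_mono) (auto simp: mono_def intro!: \<kappa>_anti)
    then have [measurable]: "(\<lambda>t. \<kappa> (max A t)) \<in> borel_measurable borel"
      using borel_measurable_uminus by fastforce
    have [measurable]: "g \<in> borel_measurable borel" using g by simp
    show ?thesis unfolding k_def by measurable
  qed
  have k_ind_eq: "AE t in lebesgue. indicator {0..T} t * k t * c t = indicator {0..T} t * \<kappa> t * c t" for T
      and c :: "real \<Rightarrow> real"
    using AE_completion[OF k_eq] by eventually_elim (auto split: split_indicator)
  interpret decaying_kernel k A C D b
  proof
    show "0 \<le> k t" for t using \<kappa>_pos[of "max A t"] A by (auto simp: k_def less_imp_le)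
    show "k t = 0" if "t < 0" for t using that by (simp add: k_def)
    show "set_integrable lborel {0..A} k"
    proof -
      have "integrable lebesgue (\<lambda>t. indicator {0..A} t * k t)"
      proof (rule integrable_cong_AE_imp)
        show "integrable lebesgue (\<lambda>t. indicator {0..A} t * \<kappa> t)" using \<kappa>_int[of 0 A]
            by (simp add: set_integrable_def)
        show "(\<lambda>t. indicator {0..A} t * k t) \<in> borel_measurable lebesgue"
            by (rule measurable_completion) measurable
        show "AE t in lebesgue. indicator {0..A} t * \<kappa> t = indicator {0..A} t * k t"
          using k_ind_eq[of A "\<lambda>_. 1"] by eventually_elim auto
      qed
      then show ?thesis unfolding set_integrable_def real_scaleR_def
        by (rule integrable_completion[THEN iffD1, rotated]) measurable
    qed
    show "k t \<le> k s" if "A \<le> s" "s \<le> t" for s t using that A \<kappa>_anti[OF that] by (simp add: k_def max_def)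
    show "\<bar>t * k t - C\<bar> \<le> D * t powr (- b)" if "A \<le> t" for t
      using A1[of t] that A by (simp add: k_def max_def)
  qed (use A C D b in auto)
  interpret gle_kernel k A C D b K m \<beta>
  proof
    show "(\<lambda>t. real_of_ereal (K t)) \<in> borel_measurable lebesgue" using \<kappa>_meas by (simp add: \<kappa>_def)
    show "K (- t) = K t" for t using assms(2) by (simp add: cond_Ia_def)
    show "AE t in lborel. 0 \<le> t \<longrightarrow> k t = real_of_ereal (K t)" using k_eq by (simp add: \<kappa>_def)
    show "0 < m" "0 < \<beta>" by fact+
    fix \<omega> :: real assume \<omega>: "\<omega> \<noteq> 0"
    obtain I where I: "has_K_cos K \<omega> I" "0 < I" using assms(4) \<omega> by (auto simp: cond_Ic_def)
    have "(LINT t:{0..T}|lebesgue. \<kappa> t * cos (t * \<omega>)) = Re (KT T \<omega>)" for T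
    proof -
      have "(LINT t:{0..T}|lebesgue. \<kappa> t * cos (t * \<omega>))
          = (LINT t|lebesgue. indicator {0..T} t * k t * cos (t * \<omega>))"
        unfolding set_lebesgue_integral_def real_scaleR_def mult.assoc[symmetric]
      proof (rule integral_cong_AE)
        have [measurable]: "(\<lambda>t. cos (t * \<omega>)) \<in> borel_measurable lebesgue"
            by (rule measurable_completion) measurable
        have "(\<lambda>t. indicator {0..T} t * \<kappa> t) \<in> borel_measurable lebesgue"
          using borel_measurable_integrable[OF \<kappa>_int[of 0 T, unfolded set_integrable_def]] by simp
        then show "(\<lambda>t. indicator {0..T} t * \<kappa> t * cos (t * \<omega>)) \<in> borel_measurable lebesgue" by measurable
        show "(\<lambda>t. indicator {0..T} t * k t * cos (t * \<omega>)) \<in> borel_measurable lebesgue"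
          by (rule measurable_completion) measurable
        show "AE t in lebesgue. indicator {0..T} t * \<kappa> t * cos (t * \<omega>) = indicator {0..T} t * k t * cos (t * \<omega>)"
          using k_ind_eq[of T "\<lambda>t. cos (t * \<omega>)"] by eventually_elim auto
      qed
      also have "\<dots> = (LINT t|lborel. indicator {0..T} t * k t * cos (t * \<omega>))"
        by (rule integral_completion) measurable
      finally show ?thesis by (simp add: Re_KT set_lebesgue_integral_def mult.assoc)
    qed
    then have "((\<lambda>T. Re (KT T \<omega>)) \<longlongrightarrow> I) at_top" using I(1) by (simp add: has_K_cos_def \<kappa>_def)
    moreover have "((\<lambda>T. Re (KT T \<omega>)) \<longlongrightarrow> Re (KH \<omega>)) at_top" by (intro tendsto_Re KT_tendsto \<omega>)
    \<comment> \<open>The truncated cosine integrals are blind to the null set on which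
      \<open>k\<close> and \<open>K\<close> differ, so the positive limit \<open>I\<close> is the
      real part of \<open>KH\<close>.\<close>
    ultimately have "Re (KH \<omega>) = I" by (intro tendsto_unique[of at_top "\<lambda>T. Re (KT T \<omega>)"]) auto
    then show "0 < Re (KH \<omega>)" using I(2) by simp
  qed
  show ?thesis unfolding C1 by (rule msd_asymp[OF assms(8,9)])
qed

end
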